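(* Let $k$ be a field, $r\ge 1$, and let $\mathcal X\subset\mathbb Z^r$ be a Cubist subset. Then the graded algebra $V_{\mathcal X}$ is Koszul.
   Context: $\epsilon_1,\dots,\epsilon_r$ is the standard basis of $\mathbb Z^r$; $x\le y$ means $y-x$ has nonnegative coordinates; $x[n]=x+n(\epsilon_1+\cdots+\epsilon_r)$. A subset $\mathcal X\subset\mathbb Z^r$ is Cubist if $\mathcal X=\mathcal X^-\setminus\mathcal X^-[-1]$ for some nonempty proper ideal (down-closed subset) $\mathcal X^-$ of $(\mathbb Z^r,\le)$. Paths in quivers are composed from left to right. $V_r$ is the graded $k$-algebra (arrows in degree 1) given by the quiver with vertices (idempotents) $f_x$, $x\in\mathbb Z^r$, arrows $\alpha_{x,i}$ from $x$ to $x+\epsilon_i$ and $\beta_{x,i}$ from $x$ to $x-\epsilon_i$ ($1\le i\le r$), with relations, for all $x\in\mathbb Z^r$: $\alpha_{x,i}\alpha_{x+\epsilon_i,j}=\alpha_{x,j}\alpha_{x+\epsilon_j,i}$ and $\beta_{x,i}\beta_{x-\epsilon_i,j}=\beta_{x,j}\beta_{x-\epsilon_j,i}$ for $i\ne j$; $\alpha_{x,i}\beta_{x+\epsilon_i,j}=\beta_{x,j}\alpha_{x-\epsilon_j,i}$ for all $1\le i,j\le r$; and $\sum_{i=1}^r\beta_{x,i}\alpha_{x-\epsilon_i,i}=0$. Put $V_{\mathcal X}=\sum_{x,y\in\mathcal X}f_xV_rf_y$, a nonnegatively graded algebra (without unit if $\mathcal X$ is infinite) whose degree $0$ part has basis $\{f_x: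 x\in\mathcal X\}$. Such a graded algebra $A$ with local idempotents is Koszul if each simple module $L(x)=Ae_x/A_{>0}e_x$, concentrated in degree $0$, has a linear projective resolution in the category of graded modules $M=\bigoplus_x e_xM$, i.e. one whose $n$-th term is a direct sum of modules $Ae_y$ with generators shifted to degree $n$. *)

theory Defs
  imports "HOL-Analysis.Analysis" "HOL-Library.Poly_Mapping"
begin

section \<open>Cubist subsets\<close>

definition shift :: "int ^ 'n \<Rightarrow> int \<Rightarrow> int ^ 'n" where
  "shift x n = x + vec n"

text \<open>The order on \<^typ>\<open>int ^ 'n\<close> is the componentwise one.\<close>

definition cubist :: "(int ^ 'n) set \<Rightarrow> bool" where
  "cubist X \<longleftrightarrow>
     (\<exists>I. I \<noteq> {} \<and> I \<noteq> UNIV \<and> (\<forall>y\<in>I. \<forall>x. x \<le> y \<longrightarrow> x \<in> I) \<and>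
          X = I - (\<lambda>x. shift x (-1)) ` I)"


section \<open>The path algebra of the quiver\<close>

text \<open>\<open>Up i\<close> and \<open>Down i\<close> are the arrows \<open>\<alpha>\<^sub>i\<close> and \<open>\<beta>\<^sub>i\<close>. Every vertex is the source of exactly one
  arrow of each kind, so a path is a source vertex together with a list of kinds.\<close>

datatype 'n arrow = Up 'n | Down 'n

fun step :: "int ^ 'n \<Rightarrow> 'n arrow \<Rightarrow> int ^ 'n" where
  "step x (Up i) = x + axis i 1"
| "step x (Down i) = x - axis i 1"

type_synonym 'n path = "(int ^ 'n) \<times> 'n arrow list"

definition target :: "'n::finite path \<Rightarrow> int ^ 'n" where
  "target p = foldl step (fst p) (snd p)"

text \<open>Paths are composed from left to right, and non-composable paths have product zero.\<close>

definition path_mult ::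
  "('n::finite path \<Rightarrow>\<^sub>0 'k::field) \<Rightarrow> ('n path \<Rightarrow>\<^sub>0 'k) \<Rightarrow> ('n path \<Rightarrow>\<^sub>0 'k)" where
  "path_mult u v =
     (\<Sum>p\<in>Poly_Mapping.keys u. \<Sum>q\<in>Poly_Mapping.keys v.
        if target p = fst q
        then Poly_Mapping.single (fst p, snd p @ snd q)
               (Poly_Mapping.lookup u p * Poly_Mapping.lookup v q)
        else 0)"

definition path_scale :: "'k::field \<Rightarrow> ('n::finite path \<Rightarrow>\<^sub>0 'k) \<Rightarrow> ('n path \<Rightarrow>\<^sub>0 'k)" where
  "path_scale c = Poly_Mapping.map ((*) c)"

abbreviation word :: "int ^ 'n \<Rightarrow> 'n arrow list \<Rightarrow> ('n path \<Rightarrow>\<^sub>0 'k::field)" where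
  "word x ws \<equiv> Poly_Mapping.single (x, ws) 1"

inductive_set relators :: "('n::finite path \<Rightarrow>\<^sub>0 'k::field) set" where
  "i \<noteq> j \<Longrightarrow> word x [Up i, Up j] - word x [Up j, Up i] \<in> relators"
| "i \<noteq> j \<Longrightarrow> word x [Down i, Down j] - word x [Down j, Down i] \<in> relators"
| "word x [Up i, Down j] - word x [Down j, Up i] \<in> relators"
| "(\<Sum>i\<in>UNIV. word x [Down i, Up i]) \<in> relators"

text \<open>The two-sided ideal generated by the relators.\<close>

inductive_set rel_ideal :: "('n::finite path \<Rightarrow>\<^sub>0 'k::field) set" where
  "u \<in> relators \<Longrightarrow> u \<in> rel_ideal"
| "0 \<in> rel_ideal"
| "u \<in> rel_ideal \<Longrightarrow> v \<in> rel_ideal \<Longrightarrow> u + v \<in> rel_ideal"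
| "u \<in> rel_ideal \<Longrightarrow> path_scale c u \<in> rel_ideal"
| "u \<in> rel_ideal \<Longrightarrow> path_mult v u \<in> rel_ideal"
| "u \<in> rel_ideal \<Longrightarrow> path_mult u v \<in> rel_ideal"

definition rel_equiv :: "('n::finite path \<Rightarrow>\<^sub>0 'k::field) \<Rightarrow> ('n path \<Rightarrow>\<^sub>0 'k) \<Rightarrow> bool" where
  "rel_equiv u v \<longleftrightarrow> u - v \<in> rel_ideal"


subsection \<open>The path algebra is an associative algebra\<close>

lemma lookup_path_scale [simp]:
  "Poly_Mapping.lookup (path_scale c u) p = c * Poly_Mapping.lookup u p"
  unfolding path_scale_def by transfer (auto simp: when_def)

lemma path_scale_add: "path_scale c (u + v) = path_scale c u + path_scale c v"
  by (rule poly_mapping_eqI) (simp add: lookup_add algebra_simps)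

lemma path_scale_diff: "path_scale c (u - v) = path_scale c u - path_scale c v"
  by (rule poly_mapping_eqI) (simp add: lookup_minus algebra_simps)

lemma path_scale_add_left: "path_scale (c + d) u = path_scale c u + path_scale d u"
  by (rule poly_mapping_eqI) (simp add: lookup_add algebra_simps)

lemma path_scale_scale: "path_scale c (path_scale d u) = path_scale (c * d) u"
  by (rule poly_mapping_eqI) (simp add: algebra_simps)

lemma path_scale_one [simp]: "path_scale 1 u = u"
  by (rule poly_mapping_eqI) simp

lemma path_scale_minus_one: "path_scale (-1) u = - u"
  by (rule poly_mapping_eqI) simp

lemma path_scale_single [simp]:
  "path_scale c (Poly_Mapping.single p a) = Poly_Mapping.single p (c * a)"
  unfolding path_scale_def by (rule map_single) simp

lemma path_mult_superset:
  assumes "finite A" "Poly_Mapping.keys u \<subseteq> A" "finite B" "Poly_Mapping.keys v \<subseteq> B"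
  shows "path_mult u v = (\<Sum>p\<in>A. \<Sum>q\<in>B.
        if target p = fst q
        then Poly_Mapping.single (fst p, snd p @ snd q)
               (Poly_Mapping.lookup u p * Poly_Mapping.lookup v q)
        else 0)"
proof -
  have "(\<Sum>q\<in>Poly_Mapping.keys v.
        if target p = fst q
        then Poly_Mapping.single (fst p, snd p @ snd q)
               (Poly_Mapping.lookup u p * Poly_Mapping.lookup v q)
        else 0) = (\<Sum>q\<in>B.
        if target p = fst q
        then Poly_Mapping.single (fst p, snd p @ snd q)
               (Poly_Mapping.lookup u p * Poly_Mapping.lookup v q)
        else 0)" for p
    by (rule sum.mono_neutral_left) (use assms in \<open>auto simp: in_keys_iff\<close>)
  then show ?thesis
    unfolding path_mult_def
    by simp (rule sum.mono_neutral_left, use assms in \<open>auto simp: in_keys_iff intro!: sum.neutral\<close>)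
qed

lemma path_mult_add_left: "path_mult (u + v) w = path_mult u w + path_mult v w"
proof -
  let ?A = "Poly_Mapping.keys u \<union> Poly_Mapping.keys v \<union> Poly_Mapping.keys (u + v)"
  let ?B = "Poly_Mapping.keys w"
  show ?thesis
    by (subst (1 2 3) path_mult_superset[where A = ?A and B = ?B])
       (auto simp: lookup_add algebra_simps single_add sum.distrib[symmetric] intro!: sum.cong)
qed

lemma path_mult_add_right: "path_mult w (u + v) = path_mult w u + path_mult w v"
proof -
  let ?A = "Poly_Mapping.keys u \<union> Poly_Mapping.keys v \<union> Poly_Mapping.keys (u + v)"
  let ?B = "Poly_Mapping.keys w"
  show ?thesis
    by (subst (1 2 3) path_mult_superset[where A = ?B and B = ?A])
       (auto simp: lookup_add algebra_simps single_add sum.distrib[symmetric] intro!: sum.cong)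
qed

lemma path_mult_zero [simp]: "path_mult 0 u = 0" "path_mult u 0 = 0"
  by (simp_all add: path_mult_def)

lemma path_mult_uminus: "path_mult (- u) v = - path_mult u v" "path_mult u (- v) = - path_mult u v"
  using path_mult_add_left[of "- u" u v] path_mult_add_right[of u "- v" v]
  by (simp_all add: eq_neg_iff_add_eq_0)

lemma path_mult_diff_left: "path_mult (u - v) w = path_mult u w - path_mult v w"
  using path_mult_add_left[of u "- v" w] by (simp add: path_mult_uminus)

lemma path_mult_diff_right: "path_mult w (u - v) = path_mult w u - path_mult w v"
  using path_mult_add_right[of w u "- v"] by (simp add: path_mult_uminus)

lemma path_mult_single:
  "path_mult (Poly_Mapping.single p a) (Poly_Mapping.single q b) =
     (if target p = fst q then Poly_Mapping.single (fst p, snd p @ snd q) (a * b) else 0)"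
  by (subst path_mult_superset[where A = "{p}" and B = "{q}"]) auto

lemma single_induct [case_names zero single add]:
  assumes "P 0" "\<And>p a. P (Poly_Mapping.single p a)" "\<And>u v. P u \<Longrightarrow> P v \<Longrightarrow> P (u + v)"
  shows "P (u :: 'a \<Rightarrow>\<^sub>0 'b::comm_monoid_add)"
proof (induction u rule: update_induct)
  case const
  show ?case by (rule assms)
next
  case (update f a b)
  have "Poly_Mapping.update a b f = f + Poly_Mapping.single a b"
    by (rule poly_mapping_eqI)
       (use update in \<open>auto simp: lookup_update lookup_add lookup_single when_def in_keys_iff\<close>)
  then show ?case using update assms by simp
qed

lemma path_mult_assoc: "path_mult (path_mult u v) w = path_mult u (path_mult v w)"
proof (induction u rule: single_induct)
  case (single p a)
  show ?case
  proof (induction v rule: single_induct)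
    case (single q b)
    show ?case
    proof (induction w rule: single_induct)
      case (single r c)
      show ?case
        by (auto simp: path_mult_single target_def algebra_simps)
    qed (simp_all add: path_mult_add_right)
  qed (simp_all add: path_mult_add_left path_mult_add_right)
qed (simp_all add: path_mult_add_left)

lemma path_mult_scale:
  "path_mult (path_scale c u) v = path_scale c (path_mult u v)"
  "path_mult u (path_scale c v) = path_scale c (path_mult u v)"
proof -
  have [simp]: "path_scale c 0 = 0" for c and z :: "'a path \<Rightarrow>\<^sub>0 'b"
    by (rule poly_mapping_eqI) simp
  have "path_mult (path_scale c (Poly_Mapping.single p a)) v
        = path_scale c (path_mult (Poly_Mapping.single p a) v) \<and>
        path_mult (Poly_Mapping.single p a) (path_scale c v)
        = path_scale c (path_mult (Poly_Mapping.single p a) v)" for p a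
    by (induction v rule: single_induct)
       (auto simp: path_mult_add_right path_scale_add path_mult_single algebra_simps)
  then show "path_mult (path_scale c u) v = path_scale c (path_mult u v)"
    "path_mult u (path_scale c v) = path_scale c (path_mult u v)"
    by (induction u rule: single_induct) (simp_all add: path_mult_add_left path_scale_add)
qed

lemma rel_ideal_uminus: "u \<in> rel_ideal \<Longrightarrow> - u \<in> rel_ideal"
  using rel_ideal.intros(4)[of u "-1"] by (simp add: path_scale_minus_one)

lemma rel_ideal_diff: "u \<in> rel_ideal \<Longrightarrow> v \<in> rel_ideal \<Longrightarrow> u - v \<in> rel_ideal"
  using rel_ideal.intros(3)[of u "- v"] rel_ideal_uminus by auto


section \<open>The algebra \<open>V\<^sub>r\<close>, with \<open>r\<close> the cardinality of \<open>'n\<close>\<close>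

quotient_type (overloaded) ('n, 'k) valg = "'n::finite path \<Rightarrow>\<^sub>0 'k::field" / rel_equiv
  morphisms rep_valg of_path
proof (rule equivpI)
  show "reflp rel_equiv"
    by (simp add: reflp_def rel_equiv_def rel_ideal.intros)
  show "symp rel_equiv"
    unfolding symp_def rel_equiv_def by (metis minus_diff_eq rel_ideal_uminus)
  show "transp (rel_equiv :: ('n path \<Rightarrow>\<^sub>0 'k) \<Rightarrow> _)"
    unfolding transp_def rel_equiv_def
  proof (intro allI impI)
    fix u v w :: "'n path \<Rightarrow>\<^sub>0 'k"
    assume "u - v \<in> rel_ideal" "v - w \<in> rel_ideal"
    then have "(u - v) + (v - w) \<in> rel_ideal" by (rule rel_ideal.intros(3))
    then show "u - w \<in> rel_ideal" by simp
  qed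
qed

instantiation valg :: (finite, field) ring
begin

lift_definition zero_valg :: "('a, 'b) valg" is 0 .

lift_definition plus_valg :: "('a, 'b) valg \<Rightarrow> ('a, 'b) valg \<Rightarrow> ('a, 'b) valg" is "(+)"
proof -
  fix u u' v v' :: "'a path \<Rightarrow>\<^sub>0 'b"
  assume "rel_equiv u u'" "rel_equiv v v'"
  then have "(u - u') + (v - v') \<in> rel_ideal"
    by (simp add: rel_equiv_def rel_ideal.intros(3))
  then show "rel_equiv (u + v) (u' + v')"
    by (simp add: rel_equiv_def algebra_simps)
qed

lift_definition uminus_valg :: "('a, 'b) valg \<Rightarrow> ('a, 'b) valg" is uminus
proof -
  fix u u' :: "'a path \<Rightarrow>\<^sub>0 'b"
  assume "rel_equiv u u'"
  then have "- (u - u') \<in> rel_ideal"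
    unfolding rel_equiv_def by (rule rel_ideal_uminus)
  then show "rel_equiv (- u) (- u')"
    by (simp add: rel_equiv_def)
qed

lift_definition minus_valg :: "('a, 'b) valg \<Rightarrow> ('a, 'b) valg \<Rightarrow> ('a, 'b) valg" is "(-)"
proof -
  fix u u' v v' :: "'a path \<Rightarrow>\<^sub>0 'b"
  assume "rel_equiv u u'" "rel_equiv v v'"
  then have "(u - u') - (v - v') \<in> rel_ideal"
    by (simp add: rel_equiv_def rel_ideal_diff)
  then show "rel_equiv (u - v) (u' - v')"
    by (simp add: rel_equiv_def algebra_simps)
qed

lift_definition times_valg :: "('a, 'b) valg \<Rightarrow> ('a, 'b) valg \<Rightarrow> ('a, 'b) valg" is path_mult
proof -
  fix u u' v v' :: "'a path \<Rightarrow>\<^sub>0 'b"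
  assume "rel_equiv u u'" "rel_equiv v v'"
  then have "path_mult (u - u') v + path_mult u' (v - v') \<in> rel_ideal"
    unfolding rel_equiv_def by (intro rel_ideal.intros(3) rel_ideal.intros(5)[of "v - v'"]
      rel_ideal.intros(6)[of "u - u'"])
  then show "rel_equiv (path_mult u v) (path_mult u' v')"
    by (simp add: rel_equiv_def path_mult_diff_left path_mult_diff_right)
qed

instance
proof
  have refl: "rel_equiv u u" for u :: "'a path \<Rightarrow>\<^sub>0 'b"
    by (simp add: rel_equiv_def rel_ideal.intros)
  fix a b c :: "('a, 'b) valg"
  show "a * b * c = a * (b * c)" by transfer (simp add: path_mult_assoc refl)
  show "(a + b) * c = a * c + b * c" by transfer (simp add: path_mult_add_left refl)
  show "a * (b + c) = a * b + a * c" by transfer (simp add: path_mult_add_right refl)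
  show "a + b + c = a + (b + c)" by transfer (simp add: refl add.assoc)
  show "a + b = b + a" by transfer (simp add: refl add.commute)
  show "0 + a = a" by transfer (simp add: refl)
  show "- a + a = 0" by transfer (simp add: refl)
  show "a - b = a + - b" by transfer (simp add: refl)
qed

end

lift_definition vscale :: "'k::field \<Rightarrow> ('n::finite, 'k) valg \<Rightarrow> ('n, 'k) valg" is path_scale
  unfolding rel_equiv_def by (metis path_scale_diff rel_ideal.intros(4))

global_interpretation valg: vector_space "vscale :: 'k::field \<Rightarrow> ('n::finite, 'k) valg \<Rightarrow> _"
proof
  have refl: "rel_equiv u u" for u :: "'n path \<Rightarrow>\<^sub>0 'k"
    by (simp add: rel_equiv_def rel_ideal.intros)
  fix a b :: 'k and x y :: "('n, 'k) valg"
  show "vscale a (x + y) = vscale a x + vscale a y" by transfer (simp add: path_scale_add refl)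
  show "vscale (a + b) x = vscale a x + vscale b x" by transfer (simp add: path_scale_add_left refl)
  show "vscale a (vscale b x) = vscale (a * b) x" by transfer (simp add: path_scale_scale refl)
  show "vscale 1 x = x" by transfer (simp add: refl)
qed

definition videm :: "int ^ 'n \<Rightarrow> ('n::finite, 'k::field) valg" where
  "videm x = of_path (word x [])"

definition vdegree :: "nat \<Rightarrow> ('n::finite, 'k::field) valg set" where
  "vdegree n = valg.span {of_path (word x ws) |x ws. length ws = n}"


section \<open>Graded algebras with local idempotents, graded modules\<close>

text \<open>An algebra is a subset of a type of class \<^class>\<open>ring\<close> (rings need not have a unit).\<close>

record ('k, 'x, 'a) galg =
  ascale :: "'k \<Rightarrow> 'a \<Rightarrow> 'a"
  acarrier :: "'a set"
  vertices :: "'x set"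
  idem :: "'x \<Rightarrow> 'a"
  adegree :: "nat \<Rightarrow> 'a set"

definition V_alg :: "(int ^ 'n) set \<Rightarrow> ('k::field, int ^ 'n, ('n::finite, 'k) valg) galg" where
  "V_alg X =
     (let C = valg.span {videm x * v * videm y |x v y. x \<in> X \<and> y \<in> X}
      in \<lparr>ascale = vscale, acarrier = C, vertices = X, idem = videm,
          adegree = (\<lambda>n. C \<inter> vdegree n)\<rparr>)"

text \<open>A graded left module over a graded algebra with elements in \<open>'a\<close>.\<close>

record ('k, 'a, 'm) gmod =
  mcarrier :: "'m set"
  mzero :: 'm
  madd :: "'m \<Rightarrow> 'm \<Rightarrow> 'm"
  mscale :: "'k \<Rightarrow> 'm \<Rightarrow> 'm"
  mact :: "'a \<Rightarrow> 'm \<Rightarrow> 'm"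
  mdegree :: "int \<Rightarrow> 'm set"

text \<open>Homomorphisms of graded modules, of degree 0.\<close>

definition graded_hom ::
  "('k, 'x, 'a) galg \<Rightarrow> ('k, 'a, 'm) gmod \<Rightarrow> ('k, 'a, 'l) gmod \<Rightarrow> ('m \<Rightarrow> 'l) \<Rightarrow> bool" where
  "graded_hom A M N h \<longleftrightarrow>
     h ` mcarrier M \<subseteq> mcarrier N \<and>
     (\<forall>u\<in>mcarrier M. \<forall>v\<in>mcarrier M. h (madd M u v) = madd N (h u) (h v)) \<and>
     (\<forall>c. \<forall>u\<in>mcarrier M. h (mscale M c u) = mscale N c (h u)) \<and>
     (\<forall>a\<in>acarrier A. \<forall>u\<in>mcarrier M. h (mact M a u) = mact N a (h u)) \<and>
     (\<forall>n. h ` mdegree M n \<subseteq> mdegree N n)"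

definition hom_kernel :: "('k, 'a, 'm) gmod \<Rightarrow> ('k, 'a, 'l) gmod \<Rightarrow> ('m \<Rightarrow> 'l) \<Rightarrow> 'm set" where
  "hom_kernel M N h = {u \<in> mcarrier M. h u = mzero N}"

text \<open>Exactness of \<open>\<dots> \<rightarrow> P 1 \<rightarrow> P 0 \<rightarrow> M \<rightarrow> 0\<close>, with maps \<open>d n : P (n + 1) \<rightarrow> P n\<close> and \<open>\<epsilon>\<close>.\<close>

definition resolution ::
  "('k, 'x, 'a) galg \<Rightarrow> ('k, 'a, 'l) gmod \<Rightarrow> (nat \<Rightarrow> ('k, 'a, 'm) gmod)
     \<Rightarrow> (nat \<Rightarrow> 'm \<Rightarrow> 'm) \<Rightarrow> ('m \<Rightarrow> 'l) \<Rightarrow> bool" where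
  "resolution A M P d \<epsilon> \<longleftrightarrow>
     graded_hom A (P 0) M \<epsilon> \<and> (\<forall>n. graded_hom A (P (Suc n)) (P n) (d n)) \<and>
     \<epsilon> ` mcarrier (P 0) = mcarrier M \<and>
     d 0 ` mcarrier (P 1) = hom_kernel (P 0) M \<epsilon> \<and>
     (\<forall>n. d (Suc n) ` mcarrier (P (Suc (Suc n))) = hom_kernel (P (Suc n)) (P n) (d n))"

text \<open>\<open>A e\<^sub>x\<close>, generated in degree 0.\<close>

definition proj_mod :: "('k, 'x, 'a::ring) galg \<Rightarrow> 'x \<Rightarrow> ('k, 'a, 'a) gmod" where
  "proj_mod A x =
     \<lparr>mcarrier = {a * idem A x |a. a \<in> acarrier A}, mzero = 0, madd = (+),
      mscale = ascale A, mact = (*),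
      mdegree = (\<lambda>n. if n < 0 then {0} else {a * idem A x |a. a \<in> adegree A (nat n)})\<rparr>"

text \<open>The direct sum of the modules \<open>A e\<^bsub>y j\<^esub>\<close> (\<open>j \<in> J\<close>), with generators shifted to degree \<open>m\<close>.\<close>

definition proj_sum ::
  "('k, 'x, 'a::ring) galg \<Rightarrow> int \<Rightarrow> 'j set \<Rightarrow> ('j \<Rightarrow> 'x) \<Rightarrow> ('k, 'a, 'j \<Rightarrow>\<^sub>0 'a) gmod" where
  "proj_sum A m J y =
     \<lparr>mcarrier = {u. Poly_Mapping.keys u \<subseteq> J \<and>
                    (\<forall>j\<in>J. Poly_Mapping.lookup u j \<in> mcarrier (proj_mod A (y j)))},
      mzero = 0, madd = (+),
      mscale = (\<lambda>c. Poly_Mapping.map (ascale A c)),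
      mact = (\<lambda>a. Poly_Mapping.map ((*) a)),
      mdegree = (\<lambda>n. {u. Poly_Mapping.keys u \<subseteq> J \<and>
                    (\<forall>j\<in>J. Poly_Mapping.lookup u j \<in> mdegree (proj_mod A (y j)) (n - m))})\<rparr>"

text \<open>The quotient by a graded submodule with set of elements \<open>N\<close>; its elements are cosets.\<close>

definition coset :: "('k, 'a, 'm) gmod \<Rightarrow> 'm set \<Rightarrow> 'm \<Rightarrow> 'm set" where
  "coset M N u = madd M u ` N"

definition quot_mod :: "('k, 'a, 'm) gmod \<Rightarrow> 'm set \<Rightarrow> ('k, 'a, 'm set) gmod" where
  "quot_mod M N =
     \<lparr>mcarrier = coset M N ` mcarrier M, mzero = coset M N (mzero M),
      madd = (\<lambda>U W. \<Union>u\<in>U. \<Union>w\<in>W. coset M N (madd M u w)),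
      mscale = (\<lambda>c U. \<Union>u\<in>U. coset M N (mscale M c u)),
      mact = (\<lambda>a U. \<Union>u\<in>U. coset M N (mact M a u)),
      mdegree = (\<lambda>n. coset M N ` mdegree M n)\<rparr>"

text \<open>\<open>L(x) = A e\<^sub>x / A\<^bsub>>0\<^esub> e\<^sub>x\<close>.\<close>

definition simple_mod :: "('k::field, 'x, 'a::ring) galg \<Rightarrow> 'x \<Rightarrow> ('k, 'a, 'a set) gmod" where
  "simple_mod A x =
     quot_mod (proj_mod A x)
       {a * idem A x |a. a \<in> module.span (ascale A) (\<Union>n\<in>{0<..}. adegree A n)}"

text \<open>The \<open>n\<close>-th term of the resolution of \<open>L(x)\<close> is the direct sum of the \<open>A e\<^bsub>y n j\<^esub>\<close> (\<open>j \<in> J n\<close>)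
  with generators in degree \<open>n\<close>. Index sets of lists of algebra elements suffice, whatever the
  algebra: a resolution of this kind is minimal, so the generators of its \<open>n\<close>-th term form a basis
  of a subspace of the \<open>n\<close>-fold tensor power of \<open>A\<^sub>1\<close> over \<open>A\<^sub>0\<close>, and that tensor power is spanned
  by products of \<open>n\<close> elements of \<open>A\<^sub>1\<close>.\<close>

definition koszul :: "('k::field, 'x, 'a::ring) galg \<Rightarrow> bool" where
  "koszul A \<longleftrightarrow>
     (\<forall>x\<in>vertices A.
        \<exists>(J :: nat \<Rightarrow> 'a list set) (y :: nat \<Rightarrow> 'a list \<Rightarrow> 'x) d \<epsilon>.
          (\<forall>n. y n ` J n \<subseteq> vertices A) \<and>
          resolution A (simple_mod A x) (\<lambda>n. proj_sum A (int n) (J n) (y n)) d \<epsilon>)"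

end

theory Submission
  imports Defs
begin

text \<open>
  Any two paths of \<open>V\<^sub>r\<close> with the same source and the same arrows agree, so \<open>f\<^sub>y V\<^sub>r f\<^sub>z\<close> is free of rank one,
  generated by a shortest path, over the ring \<open>S\<close> of loops: polynomials in \<open>t\<^sub>j = \<alpha>\<^sub>j \<beta>\<^sub>j\<close> with \<open>\<Sum>\<^sub>j t\<^sub>j = 0\<close>.

  Fix \<open>x \<in> X\<close>. For \<open>Y, Z \<subseteq> {1..r}\<close> let the pair \<open>(Y, Z)\<close> sit at the vertex obtained from \<open>x\<close> by a unit step in
  each direction \<open>j \<in> Z\<close>, upwards iff \<open>j \<in> Y\<close>. Adding or removing an element of \<open>Z\<close> is an arrow, and for fixed
  \<open>Y\<close> the signed sum of these arrows is a Koszul matrix factorisation \<open>d\<close> of \<open>\<Sum>\<^sub>j t\<^sub>j = 0\<close>, so \<open>d\<^sup>2 = 0\<close>. The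
  \<open>n\<close>-th term of the resolution of \<open>L(x)\<close> consists of the functions of \<open>(Y, Z)\<close> with \<open>|Z| \<equiv> n\<close> modulo 2 that have
  degree at most \<open>(2r - 2 - n - |Z|) / 2\<close> as polynomials in the indicators \<open>[j \<in> Y]\<close> with \<open>j \<notin> Z\<close>, modulo those that
  split: their restriction to \<open>K = {A. x + \<epsilon>\<^sub>A \<in> X\<^sup>-}\<close>, extended by zero, satisfies the same bound.
  Everything supported at a vertex outside \<open>X\<close> splits, so Gaussian elimination over \<open>k\<close> exhibits this quotient as a sum of projectives \<open>V\<^sub>X f\<^sub>z\<close> with
  \<open>z \<in> X\<close>, and \<open>d\<close> has degree one.

  For exactness at \<open>y \<in> X\<close> let \<open>f\<close> be a cycle of the quotient. Then \<open>d f\<close> is the sum of its parts on \<open>K\<close> and off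
  \<open>K\<close>, each of which is again a cycle in the right degree. If \<open>y \<noteq> x\<close>, a homotopy in a coordinate direction in which \<open>y\<close>
  differs from \<open>x\<close> contracts each part without leaving \<open>K\<close> or its complement, which corrects \<open>f\<close> to an honest
  cycle; that one is a boundary by the same homotopies. If \<open>y = x\<close>, the Koszul complex of the \<open>t\<^sub>j\<close> over \<open>S\<close>, exact
  in degrees at least two, takes their place.
\<close>

section \<open>Koszul matrix factorisations over the cube\<close>

text \<open>The obstacle is that \<open>X\<close> supplies projectives only at its own vertices,
  while the cube around \<open>x\<close> leaves \<open>X\<close>. It is met by the inclusion of
  (functions on \<open>K\<close>) + (functions off \<open>K\<close>) into all functions, every term
  subject to the same degree bound. Whatever sits outside \<open>X\<close> lies in the smaller
  complex, and exactness of the quotient is read off from the other complexes, so that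
  \<open>K\<close> enters only through the question which homotopies preserve it. The bound counts a
  factor [j \<in> Y] twice and an element of \<open>Z\<close> once; with these weights every step of
  the differential costs exactly one. The constant 2r - 2 is the largest bound at which splitting
  along \<open>K\<close> can fail at all: one above, it is automatic, and at 2r - 2 it is a single
  linear equation, so that the first term has one generator, at \<open>x\<close>. Modules are tested
  one source vertex \<open>y\<close> at a time. The algebra then enters only through the scalars 1
  and t_j of the matrix factorisation; which of the two opposite steps carries which scalar depends
  on \<open>y\<close>, and the complexes are therefore studied for an arbitrary orientation.\<close>

definition toggle :: "'a \<Rightarrow> 'a set \<Rightarrow> 'a set" where
  "toggle j Z = (if j \<in> Z then Z - {j} else insert j Z)"

text \<open>The sign of exterior multiplication by the generator \<open>j\<close>. The order on the
  directions is borrowed from \<open>to_nat\<close>, since the index type carries none.\<close>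

definition sg :: "'n::finite \<Rightarrow> 'n set \<Rightarrow> 'b::comm_ring_1" where
  "sg j Z = (-1) ^ card {l \<in> Z. to_nat l < to_nat j}"

lemma toggle_toggle [simp]: "toggle j (toggle j Z) = Z"
  by (auto simp: toggle_def)

lemma toggle_commute: "toggle j (toggle l Z) = toggle l (toggle j Z)"
  by (auto simp: toggle_def)

lemma in_toggle [simp]: "l \<in> toggle j Z \<longleftrightarrow> (if l = j then l \<notin> Z else l \<in> Z)"
  by (auto simp: toggle_def)

lemma card_toggle: "int (card (toggle j (Z :: 'n::finite set))) = (if j \<in> Z then int (card Z) - 1 else int (card Z) + 1)"
proof (cases "j \<in> Z")
  case True
  then have "card Z > 0" by (auto simp: card_gt_0_iff)
  then show ?thesis using True by (simp add: toggle_def of_nat_diff)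
qed (simp add: toggle_def)

lemma sg_sq [simp]: "sg j Z * sg j Z = 1"
  by (simp add: sg_def flip: power_mult_distrib)

lemma sg_sq_left [simp]: "sg j Z * (sg j Z * x) = x"
  by (simp add: mult.assoc[symmetric])

lemma sg_toggle_same [simp]: "sg j (toggle j Z) = sg j Z"
proof -
  have "{l \<in> toggle j Z. to_nat l < to_nat j} = {l \<in> Z. to_nat l < to_nat j}" by auto
  then show ?thesis by (simp add: sg_def)
qed

lemma sg_toggle:
  assumes "j \<noteq> l"
  shows "sg j (toggle l Z) = (if to_nat l < to_nat j then - sg j Z else sg j Z)"
proof (cases "to_nat l < to_nat j")
  case True
  have eq: "{i \<in> toggle l Z. to_nat i < to_nat j} = toggle l {i \<in> Z. to_nat i < to_nat j}"
    using True by (auto simp: toggle_def)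
  have pow: "(-1) ^ card (toggle l W) = (- ((-1) ^ card W) :: 'b::comm_ring_1)" for W :: "'a set"
  proof (cases "l \<in> W")
    case True
    then obtain c where "card W = Suc c" by (metis card_Suc_Diff1 finite)
    then show ?thesis using True by (simp add: toggle_def)
  qed (simp add: toggle_def)
  show ?thesis using True by (simp only: sg_def eq pow if_True)
next
  case False
  then have "{i \<in> toggle l Z. to_nat i < to_nat j} = {i \<in> Z. to_nat i < to_nat j}" by auto
  then show ?thesis using False by (simp add: sg_def)
qed

text \<open>Exactly one of two distinct directions precedes the other, so exactly one of the two
  signs changes when the other direction is toggled.\<close>

lemma sg_anticommute:
  assumes "j \<noteq> l"
  shows "sg j Z * sg l (toggle j Z) = - (sg l Z * sg j (toggle l Z))"
proof -
  have "to_nat j \<noteq> to_nat l" using assms by simp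
  then show ?thesis using assms by (simp add: sg_toggle)
qed

text \<open>Splitting the pairs by order and swapping one half cancels the off-diagonal terms
  without a division by two, which covers characteristic two.\<close>

lemma sum_antisymmetric:
  fixes g :: "'n::finite \<Rightarrow> 'n \<Rightarrow> 'b::comm_ring_1"
  assumes "\<And>j l. j \<noteq> l \<Longrightarrow> g j l = - g l j"
  shows "(\<Sum>j\<in>UNIV. \<Sum>l\<in>UNIV. g j l) = (\<Sum>j\<in>UNIV. g j j)"
proof -
  have split: "g j l = (if j = l then g j j else 0) + ((if to_nat j < to_nat l then g j l else 0)
      - (if to_nat l < to_nat j then g l j else 0))" for j l
    using assms[of j l] by (cases "j = l") (auto simp: not_less le_less)
  have "(\<Sum>j\<in>UNIV. \<Sum>l\<in>UNIV. g j l) = (\<Sum>j\<in>UNIV. g j j)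
     + ((\<Sum>j\<in>UNIV. \<Sum>l\<in>UNIV. if to_nat j < to_nat l then g j l else 0)
      - (\<Sum>j\<in>UNIV. \<Sum>l\<in>UNIV. if to_nat l < to_nat j then g l j else 0))"
    by (subst split) (simp add: sum.distrib sum_subtractf)
  also have "(\<Sum>j\<in>UNIV. \<Sum>l\<in>UNIV. if to_nat l < to_nat j then g l j else 0)
     = (\<Sum>j\<in>UNIV. \<Sum>l\<in>UNIV. if to_nat j < to_nat l then g j l else 0)"
    by (rule sum.swap)
  finally show ?thesis by simp
qed

section \<open>Alternating sums as iterated finite differences\<close>

definition altsum :: "'n::finite set \<Rightarrow> ('n set \<Rightarrow> 'b::comm_ring_1) \<Rightarrow> 'n set \<Rightarrow> 'b" where
  "altsum D F Y = (\<Sum>C\<in>Pow D. (-1) ^ card C * F ((Y - D) \<union> C))"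

lemma altsum_zero [simp]: "altsum D (\<lambda>Y. 0) Y = 0"
  by (simp add: altsum_def)

lemma altsum_add: "altsum D (\<lambda>Y. F Y + G Y) Y = altsum D F Y + altsum D G Y"
  by (simp add: altsum_def sum.distrib algebra_simps)

lemma altsum_diff: "altsum D (\<lambda>Y. F Y - G Y) Y = altsum D F Y - altsum D G Y"
  by (simp add: altsum_def sum_subtractf algebra_simps)

lemma altsum_sum: "altsum D (\<lambda>Y. \<Sum>i\<in>A. F i Y) Y = (\<Sum>i\<in>A. altsum D (F i) Y)"
  unfolding altsum_def sum_distrib_left by (rule sum.swap)

lemma altsum_mult:
  assumes "\<And>C. C \<subseteq> D \<Longrightarrow> c ((Y - D) \<union> C) = k"
  shows "altsum D (\<lambda>Y. c Y * F Y) Y = k * altsum D F Y"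
  unfolding altsum_def sum_distrib_left by (rule sum.cong) (use assms in \<open>auto simp: algebra_simps\<close>)

lemma altsum_const_mult: "altsum D (\<lambda>Y. k * F Y) Y = k * altsum D F Y"
  by (rule altsum_mult) simp

lemma altsum_cong:
  assumes "\<And>C. C \<subseteq> D \<Longrightarrow> F ((Y - D) \<union> C) = G ((Y - D) \<union> C)"
  shows "altsum D F Y = altsum D G Y"
  unfolding altsum_def by (rule sum.cong) (use assms in auto)

text \<open>Sorting the summands by membership of \<open>j\<close> leaves one difference between two
  parallel faces. The degree estimates for the differential and for the homotopies rest on this
  recursion.\<close>

lemma altsum_insert:
  assumes "j \<notin> D"
  shows "altsum (insert j D) F Y = altsum D F (Y - {j}) - altsum D F (insert j Y)"
proof -
  have inj: "inj_on (insert j) (Pow D)"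
    using assms by (auto simp: inj_on_def)
  have "altsum (insert j D) F Y = (\<Sum>C\<in>Pow D. (-1) ^ card C * F ((Y - insert j D) \<union> C))
      + (\<Sum>C\<in>insert j ` Pow D. (-1) ^ card C * F ((Y - insert j D) \<union> C))"
    unfolding altsum_def Pow_insert by (rule sum.union_disjoint) (use assms in auto)
  also have "(\<Sum>C\<in>insert j ` Pow D. (-1) ^ card C * F ((Y - insert j D) \<union> C))
     = (\<Sum>C\<in>Pow D. - ((-1) ^ card C * F ((insert j Y - D) \<union> C)))"
    unfolding sum.reindex[OF inj] comp_def
  proof (rule sum.cong)
    fix C assume "C \<in> Pow D"
    moreover from this have "j \<notin> C" using assms by auto
    moreover have "(Y - insert j D) \<union> insert j C = (insert j Y - D) \<union> C" using assms by auto
    ultimately show "(-1) ^ card (insert j C) * F ((Y - insert j D) \<union> insert j C) = - ((-1) ^ card C * F ((insert j Y - D) \<union> C))"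
      by simp
  qed simp
  also have "Y - insert j D = (Y - {j}) - D" by auto
  finally show ?thesis by (simp add: altsum_def sum_negf)
qed

lemma altsum_eq_0_const:
  assumes "l \<in> D" "\<And>Y. F (insert l Y) = F (Y - {l})"
  shows "altsum D F Y = 0"
proof -
  have D: "D = insert l (D - {l})" using assms(1) by auto
  have "altsum (D - {l}) F (Y - {l}) = altsum (D - {l}) F (insert l Y)"
    unfolding altsum_def
  proof (rule sum.cong)
    fix C assume "C \<in> Pow (D - {l})"
    then have "insert l Y - (D - {l}) \<union> C = insert l (Y - (D - {l}) \<union> C)"
      "Y - {l} - (D - {l}) \<union> C = (Y - (D - {l}) \<union> C) - {l}" by auto
    then show "(- 1) ^ card C * F (Y - {l} - (D - {l}) \<union> C) = (- 1) ^ card C * F (insert l Y - (D - {l}) \<union> C)"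
      by (simp add: assms(2))
  qed simp
  then show ?thesis by (subst D, subst altsum_insert) auto
qed

definition put :: "bool \<Rightarrow> 'a \<Rightarrow> 'a set \<Rightarrow> 'a set" where
  "put e l Y = (if e then insert l Y else Y - {l})"

lemma in_put [simp]: "j \<in> put e l Y \<longleftrightarrow> (if j = l then e else j \<in> Y)"
  by (auto simp: put_def)

lemma put_id: "(l \<in> Y) = e \<Longrightarrow> put e l Y = Y"
  by (auto simp: put_def)

lemma altsum_put:
  assumes "l \<notin> D"
  shows "altsum D (\<lambda>Y. F (put e l Y)) Y = altsum D F (put e l Y)"
proof -
  have "put e l ((Y - D) \<union> C) = (put e l Y - D) \<union> C" if "C \<subseteq> D" for C
    using assms that by (auto simp: put_def)
  then show ?thesis unfolding altsum_def by (intro sum.cong) auto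
qed

text \<open>For each \<open>Z\<close>, a polynomial of degree at most \<open>(N - card Z) / 2\<close> in the indicators \<open>[j \<in> Y]\<close>, \<open>j \<notin> Z\<close>,
  with arbitrary dependence on \<open>Y \<inter> Z\<close>: its alternating sums over larger cubes vanish.\<close>

definition PP :: "int \<Rightarrow> ('n::finite set \<Rightarrow> 'n set \<Rightarrow> 'b::comm_ring_1) \<Rightarrow> bool" where
  "PP N f \<longleftrightarrow> (\<forall>Y Z. odd (int (card Z) + N) \<longrightarrow> f Y Z = 0) \<and>
     (\<forall>Y Z D. D \<inter> Z = {} \<longrightarrow> 2 * int (card D) + int (card Z) > N \<longrightarrow> altsum D (\<lambda>Y. f Y Z) Y = 0)"

lemma PP_parity: "PP N f \<Longrightarrow> odd (int (card Z) + N) \<Longrightarrow> f Y Z = 0"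
  by (auto simp: PP_def)

lemma PP_altsum:
  "PP N f \<Longrightarrow> D \<inter> Z = {} \<Longrightarrow> 2 * int (card D) + int (card Z) > N \<Longrightarrow> altsum D (\<lambda>Y. f Y Z) Y = 0"
  by (auto simp: PP_def)

lemma PP_0 [simp]: "PP N (\<lambda>Y Z. 0)"
  by (simp add: PP_def)

lemma PP_add: "PP N f \<Longrightarrow> PP N g \<Longrightarrow> PP N (\<lambda>Y Z. f Y Z + g Y Z)"
  by (simp add: PP_def altsum_add)

lemma PP_diff: "PP N f \<Longrightarrow> PP N g \<Longrightarrow> PP N (\<lambda>Y Z. f Y Z - g Y Z)"
  by (simp add: PP_def altsum_diff)

lemma PP_mult: "PP N f \<Longrightarrow> PP N (\<lambda>Y Z. k * f Y Z)"
  by (simp add: PP_def altsum_const_mult)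

lemma PP_sum: "(\<And>i. i \<in> A \<Longrightarrow> PP N (f i)) \<Longrightarrow> PP N (\<lambda>Y Z. \<Sum>i\<in>A. f i Y Z)"
  by (simp add: PP_def altsum_sum)

definition restr :: "'n set set \<Rightarrow> ('n set \<Rightarrow> 'n set \<Rightarrow> 'b::comm_ring_1) \<Rightarrow> 'n set \<Rightarrow> 'n set \<Rightarrow> 'b" where
  "restr U f = (\<lambda>Y Z. if Y \<in> U then f Y Z else 0)"

definition supp_on :: "'n set set \<Rightarrow> ('n set \<Rightarrow> 'n set \<Rightarrow> 'b::comm_ring_1) \<Rightarrow> bool" where
  "supp_on U f \<longleftrightarrow> (\<forall>Y Z. Y \<notin> U \<longrightarrow> f Y Z = 0)"

lemma restr_simps:
  "restr U (\<lambda>Y Z. f Y Z + g Y Z) = (\<lambda>Y Z. restr U f Y Z + restr U g Y Z)"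
  "restr U (\<lambda>Y Z. f Y Z - g Y Z) = (\<lambda>Y Z. restr U f Y Z - restr U g Y Z)"
  "restr U (\<lambda>Y Z. k * f Y Z) = (\<lambda>Y Z. k * restr U f Y Z)"
  by (auto simp: restr_def fun_eq_iff)

lemma restr_sum: "restr U (\<lambda>Y Z. \<Sum>i\<in>A. f i Y Z) = (\<lambda>Y Z. \<Sum>i\<in>A. restr U (f i) Y Z)"
  by (auto simp: restr_def fun_eq_iff)

lemma supp_on_restr_compl: "supp_on (- U) f \<Longrightarrow> restr U f = (\<lambda>Y Z. 0)"
  by (auto simp: restr_def supp_on_def fun_eq_iff)

section \<open>The differential for an arbitrary orientation, and its homotopies\<close>

locale cube_complex =
  fixes t :: "'n::finite \<Rightarrow> 'b::comm_ring_1" and p :: "'n \<Rightarrow> bool \<Rightarrow> bool"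
  assumes sum_t: "(\<Sum>j\<in>UNIV. t j) = 0"
begin

text \<open>The steps along \<open>j\<close> in the two opposite directions have coefficients \<open>1\<close> and \<open>t j\<close>, in an order chosen by
  \<open>p\<close>. Their product is \<open>t j\<close>, so \<open>dd\<close> squares to \<open>\<Sum>\<^sub>j t j = 0\<close>.\<close>

definition cf :: "'n \<Rightarrow> 'n set \<Rightarrow> 'n set \<Rightarrow> 'b" where
  "cf j Y Z = (if (j \<in> Z) = p j (j \<in> Y) then 1 else t j)"

definition dd :: "('n set \<Rightarrow> 'n set \<Rightarrow> 'b) \<Rightarrow> 'n set \<Rightarrow> 'n set \<Rightarrow> 'b" where
  "dd f Y Z = (\<Sum>j\<in>UNIV. sg j Z * cf j Y Z * f Y (toggle j Z))"

lemma cf_cong: "(j \<in> Y) = (j \<in> Y') \<Longrightarrow> cf j Y Z = cf j Y' Z"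
  by (simp add: cf_def)

lemma dd_add: "dd (\<lambda>Y Z. f Y Z + g Y Z) = (\<lambda>Y Z. dd f Y Z + dd g Y Z)"
  by (simp add: dd_def fun_eq_iff algebra_simps sum.distrib)

lemma dd_diff: "dd (\<lambda>Y Z. f Y Z - g Y Z) = (\<lambda>Y Z. dd f Y Z - dd g Y Z)"
  by (simp add: dd_def fun_eq_iff algebra_simps sum_subtractf)

lemma dd_zero [simp]: "dd (\<lambda>Y Z. 0) = (\<lambda>Y Z. 0)"
  by (simp add: dd_def fun_eq_iff)

lemma dd_sum: "dd (\<lambda>Y Z. \<Sum>i\<in>A. f i Y Z) = (\<lambda>Y Z. \<Sum>i\<in>A. dd (f i) Y Z)"
  unfolding dd_def fun_eq_iff by (simp add: sum_distrib_left) (intro allI sum.swap)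

lemma dd_restr: "dd (restr U f) = restr U (dd f)"
  by (auto simp: dd_def restr_def fun_eq_iff)

lemma dd_dd [simp]: "dd (dd f) Y Z = 0"
proof -
  let ?g = "\<lambda>j l. sg j Z * cf j Y Z * (sg l (toggle j Z) * cf l Y (toggle j Z) * f Y (toggle l (toggle j Z)))"
  have "dd (dd f) Y Z = (\<Sum>j\<in>UNIV. \<Sum>l\<in>UNIV. ?g j l)"
    by (simp add: dd_def sum_distrib_left)
  also have "\<dots> = (\<Sum>j\<in>UNIV. ?g j j)"
  proof (rule sum_antisymmetric)
    fix j l :: 'n assume "j \<noteq> l"
    then have c: "cf l Y (toggle j Z) = cf l Y Z" "cf j Y (toggle l Z) = cf j Y Z"
      by (auto simp: cf_def)
    have "?g j l = (sg j Z * sg l (toggle j Z)) * (cf j Y Z * cf l Y Z * f Y (toggle l (toggle j Z)))"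
      by (simp add: c algebra_simps)
    also have "\<dots> = - ?g l j"
      by (subst sg_anticommute[OF \<open>j \<noteq> l\<close>]) (simp add: c algebra_simps toggle_commute)
    finally show "?g j l = - ?g l j" .
  qed
  also have "\<dots> = (\<Sum>j\<in>UNIV. t j * f Y Z)"
  proof (rule sum.cong)
    fix j
    have "cf j Y Z * cf j Y (toggle j Z) = t j" by (auto simp: cf_def)
    then have "?g j j = (sg j Z * sg j Z) * (t j * f Y Z)"
      by (simp add: algebra_simps)
    then show "?g j j = t j * f Y Z" by simp
  qed simp
  also have "\<dots> = 0" by (simp add: sum_t flip: sum_distrib_right)
  finally show ?thesis .
qed

text \<open>The coefficient \<open>cf j\<close> only sees whether \<open>j\<close> lies in
  \<open>Y\<close>. For \<open>j\<close> outside \<open>D\<close> it is constant on the face, and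
  toggling \<open>j\<close> costs at most one. For \<open>j\<close> in \<open>D\<close> it uses up
  the difference in direction \<open>j\<close>, a loss of two; but then \<open>j\<close> is not in
  \<open>Z\<close>, and toggling gains one back.\<close>

lemma PP_dd:
  assumes "PP N f"
  shows "PP (N + 1) (dd f)"
  unfolding PP_def
proof (intro conjI allI impI)
  fix Y Z :: "'n set" assume o: "odd (int (card Z) + (N + 1))"
  have "odd (int (card (toggle j Z)) + N)" for j using o by (simp add: card_toggle)
  then show "dd f Y Z = 0" using assms by (simp add: dd_def PP_def)
next
  fix Y Z D :: "'n set"
  assume D: "D \<inter> Z = {}" and N: "N + 1 < 2 * int (card D) + int (card Z)"
  have "altsum D (\<lambda>Y. sg j Z * cf j Y Z * f Y (toggle j Z)) Y = 0" for j
  proof (cases "j \<in> D")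
    case False
    have "altsum D (\<lambda>Y. sg j Z * cf j Y Z * f Y (toggle j Z)) Y
        = sg j Z * cf j Y Z * altsum D (\<lambda>Y. f Y (toggle j Z)) Y"
      by (rule altsum_mult) (use False in \<open>auto intro!: arg_cong2[where f = "(*)"] cf_cong\<close>)
    moreover have "altsum D (\<lambda>Y. f Y (toggle j Z)) Y = 0"
      by (rule PP_altsum[OF assms]) (use D N False in \<open>auto simp: card_toggle split: if_splits\<close>)
    ultimately show ?thesis by simp
  next
    case True
    define D' where "D' = D - {j}"
    have D': "D = insert j D'" "j \<notin> D'" using True by (auto simp: D'_def)
    have jZ: "j \<notin> Z" using True D by auto
    have cD: "int (card D) = int (card D') + 1" by (simp add: D')
    have "altsum D' (\<lambda>Y. sg j Z * cf j Y Z * f Y (toggle j Z)) Y' = 0" for Y'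
    proof -
      have "altsum D' (\<lambda>Y. sg j Z * cf j Y Z * f Y (toggle j Z)) Y'
          = sg j Z * cf j Y' Z * altsum D' (\<lambda>Y. f Y (toggle j Z)) Y'"
        by (rule altsum_mult) (use D' in \<open>auto intro!: arg_cong2[where f = "(*)"] cf_cong\<close>)
      moreover have "altsum D' (\<lambda>Y. f Y (toggle j Z)) Y' = 0"
        by (rule PP_altsum[OF assms]) (use D N D' jZ cD in \<open>auto simp: card_toggle split: if_splits\<close>)
      ultimately show ?thesis by simp
    qed
    then show ?thesis by (simp add: D' altsum_insert)
  qed
  then show "altsum D (\<lambda>Y. dd f Y Z) Y = 0"
    by (simp add: dd_def altsum_sum)
qed

text \<open>Direction \<open>l\<close> cuts the cube into two halves; on each, one of the two steps
  along \<open>l\<close> has coefficient 1, and undoing this step gives a homotopy. On the half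
  opposite to \<open>e\<close>, values at \<open>put e l Y\<close> are added with a sign: they do
  not disturb the homotopy identity, and they keep the degree bounded.\<close>

definition hh :: "bool \<Rightarrow> 'n \<Rightarrow> ('n set \<Rightarrow> 'n set \<Rightarrow> 'b) \<Rightarrow> 'n set \<Rightarrow> 'n set \<Rightarrow> 'b" where
  "hh e l f Y Z = sg l Z * ((if l \<in> Z then f Y (toggle l Z) else 0)
      + (if l \<in> Z then -1 else 1) * f (put e l Y) (toggle l Z))"

text \<open>Directions other than \<open>l\<close> anticommute with \<open>hh\<close>. Along
  \<open>l\<close> the hypothesis on \<open>p\<close> puts the coefficient 1 on opposite steps in
  the two halves, as happens in a coordinate where the source vertex differs from the centre of the
  cube; the terms at \<open>put e l Y\<close> then cancel.\<close>

lemma homotopy: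
  assumes p: "\<And>b. p l b = (b = e)"
  shows "dd (hh e l f) Y Z + hh e l (dd f) Y Z = f Y Z"
proof -
  define rest where "rest f Y Z = (\<Sum>j\<in>UNIV - {l}. sg j Z * cf j Y Z * f Y (toggle j Z))"
    for f :: "'n set \<Rightarrow> 'n set \<Rightarrow> 'b" and Y Z
  define lt where "lt f Y Z = sg l Z * cf l Y Z * f Y (toggle l Z)"
    for f :: "'n set \<Rightarrow> 'n set \<Rightarrow> 'b" and Y Z
  have dd: "dd f Y Z = lt f Y Z + rest f Y Z" for f Y Z
    unfolding dd_def rest_def lt_def by (simp add: sum.remove)
  have hadd: "hh e l (\<lambda>Y Z. f Y Z + g Y Z) Y Z = hh e l f Y Z + hh e l g Y Z" for f g
    by (simp add: hh_def algebra_simps)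
  have hdd: "hh e l (dd f) Y Z = hh e l (lt f) Y Z + hh e l (rest f) Y Z"
    unfolding hadd[symmetric] by (simp add: dd hh_def)
  have "rest (hh e l f) Y Z = - hh e l (rest f) Y Z"
  proof -
    have term_eq: "sg j Z * cf j Y Z * hh e l f Y (toggle j Z)
        = - (sg l Z * ((if l \<in> Z then sg j (toggle l Z) * cf j Y (toggle l Z) * f Y (toggle j (toggle l Z)) else 0)
           + (if l \<in> Z then -1 else 1) * (sg j (toggle l Z) * cf j (put e l Y) (toggle l Z) * f (put e l Y) (toggle j (toggle l Z)))))"
      if "j \<noteq> l" for j
    proof -
      have c: "cf j Y (toggle l Z) = cf j Y Z" "cf j (put e l Y) (toggle l Z) = cf j Y Z"
        using that by (auto simp: cf_def)
      have m: "l \<in> toggle j Z \<longleftrightarrow> l \<in> Z" using that by auto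
      have "sg j Z * cf j Y Z * hh e l f Y (toggle j Z) = (sg j Z * sg l (toggle j Z)) *
         (cf j Y Z * ((if l \<in> Z then f Y (toggle l (toggle j Z)) else 0)
      + (if l \<in> Z then -1 else 1) * f (put e l Y) (toggle l (toggle j Z))))"
        unfolding hh_def m by (simp only: mult_ac)
      also have "\<dots> = - (sg l Z * ((if l \<in> Z then sg j (toggle l Z) * cf j Y (toggle l Z) * f Y (toggle j (toggle l Z)) else 0)
           + (if l \<in> Z then -1 else 1) * (sg j (toggle l Z) * cf j (put e l Y) (toggle l Z) * f (put e l Y) (toggle j (toggle l Z)))))"
        by (subst sg_anticommute[OF that]) (simp add: c algebra_simps toggle_commute)
      finally show ?thesis .
    qed
    have "rest (hh e l f) Y Z = (\<Sum>j\<in>UNIV - {l}. - (sg l Z * ((if l \<in> Z then sg j (toggle l Z) * cf j Y (toggle l Z) * f Y (toggle j (toggle l Z)) else 0)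
           + (if l \<in> Z then -1 else 1) * (sg j (toggle l Z) * cf j (put e l Y) (toggle l Z) * f (put e l Y) (toggle j (toggle l Z))))))"
      unfolding rest_def by (rule sum.cong) (use term_eq in auto)
    also have "\<dots> = - hh e l (rest f) Y Z"
      unfolding sum_negf hh_def rest_def
      by (auto simp: sum_distrib_left sum.distrib sum_negf sum_subtractf algebra_simps)
    finally show ?thesis .
  qed
  moreover have "lt (hh e l f) Y Z + hh e l (lt f) Y Z = f Y Z"
  proof -
    have 1: "lt (hh e l f) Y Z = cf l Y Z * ((if l \<notin> Z then f Y Z else 0) + (if l \<notin> Z then -1 else 1) * f (put e l Y) Z)"
      by (simp add: lt_def hh_def algebra_simps)
    have 2: "hh e l (lt f) Y Z = (if l \<in> Z then cf l Y (toggle l Z) * f Y Z else 0)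
        + (if l \<in> Z then -1 else 1) * cf l (put e l Y) (toggle l Z) * f (put e l Y) Z"
      by (simp add: lt_def hh_def algebra_simps)
    show ?thesis
      unfolding 1 2 using put_id[of l Y e] by (auto simp: cf_def p algebra_simps)
  qed
  ultimately show ?thesis by (simp add: dd hdd algebra_simps)
qed

text \<open>For \<open>l\<close> in \<open>Z\<close> the value is zero or, up to sign, a difference
  in direction \<open>l\<close>, which makes up for removing \<open>l\<close> from \<open>Z\<close>.
  For \<open>l\<close> outside \<open>Z\<close> it does not depend on whether \<open>l\<close> lies
  in \<open>Y\<close>, and it is read at a set with one more element.\<close>

lemma PP_hh:
  assumes f: "PP (N + 1) f"
  shows "PP N (hh e l f)"
  unfolding PP_def
proof (intro conjI allI impI)
  fix Y Z :: "'n set" assume o: "odd (int (card Z) + N)"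
  have "odd (int (card (toggle l Z)) + (N + 1))" using o by (simp add: card_toggle)
  then show "hh e l f Y Z = 0" using f by (simp add: hh_def PP_def)
next
  fix Y Z D :: "'n set"
  assume D: "D \<inter> Z = {}" and N: "N < 2 * int (card D) + int (card Z)"
  let ?F = "\<lambda>Y. f Y (toggle l Z)"
  show "altsum D (\<lambda>Y. hh e l f Y Z) Y = 0"
  proof (cases "l \<in> Z")
    case True
    then have lD: "l \<notin> D" using D by auto
    have "altsum D (\<lambda>Y. hh e l f Y Z) Y = sg l Z * (altsum D ?F Y - altsum D ?F (put e l Y))"
      using True lD by (simp add: hh_def altsum_const_mult altsum_diff altsum_put[where F = ?F])
    moreover have "altsum (insert l D) ?F Y = 0"
      by (rule PP_altsum[OF f]) (use D N lD True in \<open>auto simp: card_toggle split: if_splits\<close>)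
    moreover have "altsum D ?F Y = altsum D ?F (put e l Y) \<or>
        altsum D ?F Y - altsum D ?F (put e l Y) = altsum (insert l D) ?F Y \<or>
        altsum D ?F Y - altsum D ?F (put e l Y) = - altsum (insert l D) ?F Y"
    proof (cases "(l \<in> Y) = e")
      case True then show ?thesis by (simp add: put_id)
    next
      case False
      then show ?thesis
        by (cases e) (auto simp: altsum_insert[OF lD] put_def insert_absorb)
    qed
    ultimately show ?thesis by auto
  next
    case False
    have "altsum D (\<lambda>Y. hh e l f Y Z) Y = sg l Z * altsum D (\<lambda>Y. ?F (put e l Y)) Y"
      using False by (simp add: hh_def altsum_const_mult)
    also have "altsum D (\<lambda>Y. ?F (put e l Y)) Y = 0"
    proof (cases "l \<in> D")
      case True
      then show ?thesis by (rule altsum_eq_0_const) (auto simp: put_def)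
    next
      case lD: False
      have "altsum D ?F (put e l Y) = 0"
        by (rule PP_altsum[OF f]) (use D N lD False in \<open>auto simp: card_toggle split: if_splits\<close>)
      then show ?thesis by (simp add: altsum_put[OF lD, where F = ?F])
    qed
    finally show ?thesis by simp
  qed
qed

lemma supp_on_hh:
  assumes "supp_on U f" "\<And>Y. put e l Y \<in> U \<Longrightarrow> Y \<in> U"
  shows "supp_on U (hh e l f)"
  unfolding supp_on_def
proof (intro allI impI)
  fix Y Z assume "Y \<notin> U"
  moreover from this have "put e l Y \<notin> U" using assms(2) by blast
  ultimately show "hh e l f Y Z = 0" using assms(1) by (simp add: supp_on_def hh_def)
qed

lemma hh_zero [simp]: "hh e l (\<lambda>Y Z. 0) = (\<lambda>Y Z. 0)"
  by (simp add: hh_def fun_eq_iff)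

text \<open>For \<open>e = True\<close> the last condition on \<open>U\<close> is closure under
  removing \<open>l\<close>, as for \<open>K\<close>; for \<open>e = False\<close> it is closure
  under adding \<open>l\<close>, as for the complement of \<open>K\<close>.\<close>

lemma contract:
  assumes "\<And>b. p l b = (b = e)" "PP (N + 1) f" "supp_on U f" "\<And>Y. put e l Y \<in> U \<Longrightarrow> Y \<in> U"
    "dd f = (\<lambda>Y Z. 0)"
  shows "\<exists>g. PP N g \<and> supp_on U g \<and> dd g = f"
proof (intro exI conjI)
  show "PP N (hh e l f)" by (rule PP_hh) (rule assms)
  show "supp_on U (hh e l f)" by (rule supp_on_hh) (use assms in auto)
  show "dd (hh e l f) = f"
    using homotopy[OF assms(1), of f] by (simp add: assms(5) fun_eq_iff)
qed

text \<open>The part of \<open>hh\<close> with \<open>l\<close> outside \<open>Z\<close>. It serves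
  directions in which only the half \<open>(l \<in> Y) = e\<close> is known to have the right
  coefficients.\<close>

definition h0 :: "bool \<Rightarrow> 'n \<Rightarrow> ('n set \<Rightarrow> 'n set \<Rightarrow> 'b) \<Rightarrow> 'n set \<Rightarrow> 'n set \<Rightarrow> 'b" where
  "h0 e l f Y Z = (if l \<in> Z then 0 else sg l Z * f (put e l Y) (toggle l Z))"

lemma PP_h0:
  assumes f: "PP (N + 1) f"
  shows "PP N (h0 e l f)"
  unfolding PP_def
proof (intro conjI allI impI)
  fix Y Z :: "'n set" assume o: "odd (int (card Z) + N)"
  show "h0 e l f Y Z = 0" using PP_parity[OF PP_hh[OF f] o, of e l Y] by (auto simp: h0_def hh_def)
next
  fix Y Z D :: "'n set"
  assume D: "D \<inter> Z = {}" and N: "N < 2 * int (card D) + int (card Z)"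
  show "altsum D (\<lambda>Y. h0 e l f Y Z) Y = 0"
    using PP_altsum[OF PP_hh[OF f] D N, of e l Y] by (cases "l \<in> Z") (simp_all add: h0_def hh_def)
qed

text \<open>For \<open>l\<close> in \<open>Z\<close> only the summand along \<open>l\<close>
  survives, with coefficient 1. For \<open>l\<close> outside \<open>Z\<close> the cycle equation at
  \<open>toggle l Z\<close>, in which \<open>f Y Z\<close> has coefficient 1 up to sign, is solved
  for \<open>f Y Z\<close>.\<close>

lemma h0_reduce:
  assumes p: "p l e" and cyc: "dd f = (\<lambda>Y Z. 0)" and Y: "(l \<in> Y) = e"
  shows "dd (h0 e l f) Y Z = f Y Z"
proof -
  have put: "put e l Y = Y" using Y by (rule put_id)
  have dd: "dd f Y Z = sg l Z * cf l Y Z * f Y (toggle l Z) + (\<Sum>j\<in>UNIV - {l}. sg j Z * cf j Y Z * f Y (toggle j Z))" for f Z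
    unfolding dd_def by (simp add: sum.remove)
  show ?thesis
  proof (cases "l \<in> Z")
    case True
    have "(\<Sum>j\<in>UNIV - {l}. sg j Z * cf j Y Z * h0 e l f Y (toggle j Z)) = 0"
      by (rule sum.neutral) (use True in \<open>auto simp: h0_def\<close>)
    moreover have "cf l Y Z = 1" using True Y p by (auto simp: cf_def)
    ultimately show ?thesis using True put unfolding dd by (simp add: h0_def algebra_simps)
  next
    case False
    let ?s = "\<Sum>j\<in>UNIV - {l}. sg j (toggle l Z) * cf j Y (toggle l Z) * f Y (toggle j (toggle l Z))"
    have "cf l Y (toggle l Z) = 1" using False Y p by (auto simp: cf_def)
    then have s: "sg l Z * f Y Z + ?s = 0"
      using cyc dd[of f "toggle l Z"] by simp
    have "dd (h0 e l f) Y Z = (\<Sum>j\<in>UNIV - {l}. sg j Z * cf j Y Z * h0 e l f Y (toggle j Z))"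
      using False unfolding dd by (simp add: h0_def)
    also have "\<dots> = (\<Sum>j\<in>UNIV - {l}. - (sg l Z * (sg j (toggle l Z) * cf j Y (toggle l Z) * f Y (toggle j (toggle l Z)))))"
    proof (rule sum.cong)
      fix j assume "j \<in> UNIV - {l}"
      then have jl: "j \<noteq> l" by simp
      have c: "cf j Y (toggle l Z) = cf j Y Z" using jl by (auto simp: cf_def)
      have "sg j Z * cf j Y Z * h0 e l f Y (toggle j Z) = (sg j Z * sg l (toggle j Z)) * (cf j Y Z * f Y (toggle l (toggle j Z)))"
        using False jl put by (simp add: h0_def algebra_simps)
      then show "sg j Z * cf j Y Z * h0 e l f Y (toggle j Z) =
          - (sg l Z * (sg j (toggle l Z) * cf j Y (toggle l Z) * f Y (toggle j (toggle l Z))))"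
        by (subst (asm) sg_anticommute[OF jl]) (simp add: c algebra_simps toggle_commute)
    qed simp
    also have "\<dots> = - (sg l Z * ?s)" by (simp add: sum_negf sum_distrib_left)
    also have "?s = - (sg l Z * f Y Z)" using s by (simp add: eq_neg_iff_add_eq_0 add.commute)
    finally show ?thesis by simp
  qed
qed

text \<open>Each direction of \<open>W\<close> in turn clears the half
  \<open>(l \<in> Y) = e\<close>. What has been cleared stays so, because \<open>put e l\<close>
  changes no other direction and never leads from outside \<open>U\<close> into
  \<open>U\<close>.\<close>

lemma reduce_many:
  assumes "\<And>l. l \<in> W \<Longrightarrow> p l e" "PP (N + 1) f" "supp_on U f"
    "\<And>l Y. l \<in> W \<Longrightarrow> put e l Y \<in> U \<Longrightarrow> Y \<in> U" "dd f = (\<lambda>Y Z. 0)"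
  shows "\<exists>g. PP N g \<and> supp_on U g \<and> supp_on {Y \<in> U. \<forall>l\<in>W. (l \<in> Y) \<noteq> e} (\<lambda>Y Z. f Y Z - dd g Y Z)"
proof -
  have "finite W" by simp
  then show ?thesis using assms
  proof (induction W rule: finite_induct)
    case empty
    show ?case by (rule exI[of _ "\<lambda>Y Z. 0"]) (use empty in \<open>auto simp: supp_on_def\<close>)
  next
    case (insert l W)
    have "\<exists>g. PP N g \<and> supp_on U g \<and> supp_on {Y \<in> U. \<forall>l\<in>W. (l \<in> Y) \<noteq> e} (\<lambda>Y Z. f Y Z - dd g Y Z)"
      by (rule insert.IH) (fact insert.prems | use insert.prems(1,4) in \<open>blast\<close>)+
    then obtain g where g: "PP N g" "supp_on U g"
      "supp_on {Y \<in> U. \<forall>l\<in>W. (l \<in> Y) \<noteq> e} (\<lambda>Y Z. f Y Z - dd g Y Z)"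
      by blast
    define f' where "f' = (\<lambda>Y Z. f Y Z - dd g Y Z)"
    have f': "PP (N + 1) f'" "dd f' = (\<lambda>Y Z. 0)"
      unfolding f'_def using insert.prems(2,5) PP_dd[OF g(1)]
      by (auto intro!: PP_diff simp: dd_diff)
    have sf': "f' Y Z = 0" if "Y \<notin> U \<or> (\<exists>l\<in>W. (l \<in> Y) = e)" for Y Z
      using g(3) that unfolding supp_on_def f'_def by blast
    define g' where "g' = h0 e l f'"
    have g'0: "g' Y Z = 0" if "Y \<notin> U \<or> (\<exists>l\<in>W. (l \<in> Y) = e)" for Y Z
    proof -
      have "put e l Y \<notin> U \<or> (\<exists>l'\<in>W. (l' \<in> put e l Y) = e)"
        using that insert.prems(4) by auto
      then show ?thesis using sf' by (auto simp: g'_def h0_def)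
    qed
    have dg'0: "dd g' Y Z = 0" if "Y \<notin> U \<or> (\<exists>l\<in>W. (l \<in> Y) = e)" for Y Z
      using g'0[OF that] by (simp add: dd_def)
    have red: "dd g' Y Z = f' Y Z" if "(l \<in> Y) = e" for Y Z
      unfolding g'_def using insert.prems(1) f'(2) that by (intro h0_reduce) auto
    show ?case
    proof (intro exI conjI)
      show "PP N (\<lambda>Y Z. g Y Z + g' Y Z)"
        unfolding g'_def by (intro PP_add g PP_h0 f')
      show "supp_on U (\<lambda>Y Z. g Y Z + g' Y Z)"
        using g(2) g'0 by (auto simp: supp_on_def)
      have "f Y Z - dd (\<lambda>Y Z. g Y Z + g' Y Z) Y Z = f' Y Z - dd g' Y Z" for Y Z
        by (simp add: dd_add f'_def)
      moreover have "f' Y Z - dd g' Y Z = 0" if "Y \<notin> {Y \<in> U. \<forall>l\<in>insert l W. (l \<in> Y) \<noteq> e}" for Y Z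
      proof (cases "(l \<in> Y) = e")
        case True
        then show ?thesis by (simp add: red)
      next
        case False
        then have "Y \<notin> U \<or> (\<exists>l\<in>W. (l \<in> Y) = e)" using that by blast
        then show ?thesis using sf' dg'0 by simp
      qed
      ultimately show "supp_on {Y \<in> U. \<forall>l\<in>insert l W. (l \<in> Y) \<noteq> e} (\<lambda>Y Z. f Y Z - dd (\<lambda>Y Z. g Y Z + g' Y Z) Y Z)"
        unfolding supp_on_def by simp
    qed
  qed
qed

end

section \<open>The top degrees and the augmentation\<close>

lemma altsum_eq_0: "(\<And>Y. F Y = 0) \<Longrightarrow> altsum D F Y = 0"
  by (simp add: altsum_def)

lemma supp_on_add: "supp_on U f \<Longrightarrow> supp_on U g \<Longrightarrow> supp_on U (\<lambda>Y Z. f Y Z + g Y Z)"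
  by (simp add: supp_on_def)

lemma supp_on_mono: "supp_on U f \<Longrightarrow> U \<subseteq> V \<Longrightarrow> supp_on V f"
  by (auto simp: supp_on_def)

lemma altsum_delta:
  "altsum D (\<lambda>Y. if Y = Y1 then a else 0) Y = (if Y1 - D = Y - D then (-1) ^ card (Y1 \<inter> D) * a else 0)"
proof -
  have "altsum D (\<lambda>Y. if Y = Y1 then a else 0) Y
     = (\<Sum>C\<in>Pow D. if C = Y1 \<inter> D \<and> Y1 - D = Y - D then (-1) ^ card C * a else 0)"
    unfolding altsum_def by (rule sum.cong) auto
  also have "\<dots> = (if Y1 - D = Y - D then (-1) ^ card (Y1 \<inter> D) * a else 0)"
    by (cases "Y1 - D = Y - D") (simp_all add: sum.delta)
  finally show ?thesis .
qed

lemma altsum_supp_single: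
  assumes "\<And>Y. Y \<noteq> Y1 \<Longrightarrow> F Y = 0"
  shows "altsum D F Y = (if Y1 - D = Y - D then (-1) ^ card (Y1 \<inter> D) * F Y1 else 0)"
proof -
  have "F = (\<lambda>Y. if Y = Y1 then F Y1 else 0)" using assms by auto
  then have "altsum D F Y = altsum D (\<lambda>Y. if Y = Y1 then F Y1 else 0) Y" by (rule arg_cong)
  then show ?thesis by (simp only: altsum_delta)
qed

text \<open>The signs make every alternating sum over a face through both points vanish, whereas
  \<open>phi\<close> picks out a single point if the other one lies outside
  \<open>K\<close>.\<close>

definition signed_pair :: "'n::finite set \<Rightarrow> 'n set \<Rightarrow> 'n set \<Rightarrow> 'b::comm_ring_1" where
  "signed_pair Y1 Y2 Y = (if Y = Y1 then (-1) ^ card Y1 else 0) - (if Y = Y2 then (-1) ^ card Y2 else 0)"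

lemma minus_one_power_card_split: "(-1) ^ card (Y \<inter> D) * (-1) ^ card Y = ((-1) ^ card (Y - D) :: 'b::comm_ring_1)"
  for Y D :: "'n::finite set"
proof -
  have "card Y = card (Y \<inter> D) + card (Y - D)" by (simp add: card_Int_Diff)
  then show ?thesis by (simp add: power_add mult.assoc[symmetric] flip: power_mult_distrib)
qed

lemma altsum_signed_pair:
  assumes "Y1 - D = Y2 - D"
  shows "altsum D (signed_pair Y1 Y2) Y = 0"
proof -
  have "altsum D (signed_pair Y1 Y2) Y = altsum D (\<lambda>Y. (if Y = Y1 then (-1) ^ card Y1 else 0) - (if Y = Y2 then (-1) ^ card Y2 else 0)) Y"
    by (rule altsum_cong) (simp add: signed_pair_def)
  also have "\<dots> = 0"
    unfolding altsum_diff altsum_delta by (simp add: minus_one_power_card_split assms)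
  finally show ?thesis .
qed

text \<open>The only obstruction to splitting along \<open>K\<close> in the top degree; it becomes the augmentation.\<close>

definition phi :: "'n::finite set set \<Rightarrow> ('n set \<Rightarrow> 'n set \<Rightarrow> 'b::comm_ring_1) \<Rightarrow> 'b" where
  "phi K f = (\<Sum>Y\<in>K. (-1) ^ card Y * f Y {})"

lemma phi_diff: "phi K (\<lambda>Y Z. f Y Z - g Y Z) = phi K f - phi K g"
  by (simp add: phi_def algebra_simps sum_subtractf)

lemma phi_mult: "phi K (\<lambda>Y Z. k * f Y Z) = k * phi K f"
  by (simp add: phi_def algebra_simps sum_distrib_left)

lemma phi_sum: "phi K (\<lambda>Y Z. \<Sum>i\<in>A. f i Y Z) = (\<Sum>i\<in>A. phi K (f i))"
  unfolding phi_def sum_distrib_left by (rule sum.swap)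

lemma altsum_UNIV: "altsum UNIV (\<lambda>Y. restr K f Y {}) Y = phi K f"
proof -
  have "altsum UNIV (\<lambda>Y. restr K f Y {}) Y = (\<Sum>Y\<in>UNIV. if Y \<in> K then (-1) ^ card Y * f Y {} else 0)"
    unfolding altsum_def restr_def by (rule sum.cong) auto
  also have "\<dots> = phi K f" by (simp add: phi_def sum.If_cases)
  finally show ?thesis .
qed

lemma card_disjoint_le:
  fixes D Z :: "'n::finite set"
  assumes "D \<inter> Z = {}"
  shows "card D + card Z \<le> CARD('n)"
  using card_mono[of UNIV "D \<union> Z"] card_Un_disjoint[of D Z] assms by simp

text \<open>Disjointness of \<open>D\<close> and \<open>Z\<close> together with the strict bound
  leaves \<open>card Z \<le> 1\<close>; parity excludes 1, and then \<open>D\<close> is everything.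
  So only one alternating sum has to be tested.\<close>

lemma phi_eq_0_iff:
  fixes f :: "'n::finite set \<Rightarrow> 'n set \<Rightarrow> 'b::comm_ring_1"
  assumes f: "PP (2 * int CARD('n) - 2) f"
  shows "phi K f = 0 \<longleftrightarrow> PP (2 * int CARD('n) - 2) (restr K f)"
proof
  assume phi: "phi K f = 0"
  show "PP (2 * int CARD('n) - 2) (restr K f)"
    unfolding PP_def
  proof (intro conjI allI impI)
    fix Y Z :: "'n set" assume "odd (int (card Z) + (2 * int CARD('n) - 2))"
    from PP_parity[OF f this] show "restr K f Y Z = 0" by (simp add: restr_def)
  next
    fix Y Z D :: "'n set"
    assume DZ: "D \<inter> Z = {}" and N: "2 * int CARD('n) - 2 < 2 * int (card D) + int (card Z)"
    have le: "card D + card Z \<le> CARD('n)" using DZ by (rule card_disjoint_le)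
    show "altsum D (\<lambda>Y. restr K f Y Z) Y = 0"
    proof (cases "odd (card Z)")
      case True
      then have "f Y Z = 0" for Y by (intro PP_parity[OF f]) simp
      then show ?thesis by (intro altsum_eq_0) (simp add: restr_def)
    next
      case False
      then have "card Z \<noteq> 1" by auto
      then have "card Z = 0" using le N by linarith
      then have Z: "Z = {}" by simp
      then have "card D = CARD('n)" using le N by simp
      then have "D = UNIV" by (simp add: card_eq_UNIV_imp_eq_UNIV)
      then show ?thesis using Z phi by (simp add: altsum_UNIV)
    qed
  qed
next
  assume "PP (2 * int CARD('n) - 2) (restr K f)"
  then have "altsum UNIV (\<lambda>Y. restr K f Y {}) {} = 0" by (rule PP_altsum) simp_all
  then show "phi K f = 0" by (simp add: altsum_UNIV)
qed

text \<open>The same count as for the bound one below again leaves only \<open>Z = {}\<close>, which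
  now has the wrong parity. In the end this gives the cycle condition at the first term of the
  resolution, away from \<open>x\<close>, for free.\<close>

lemma PP_top:
  fixes f :: "'n::finite set \<Rightarrow> 'n set \<Rightarrow> 'b::comm_ring_1"
  assumes f: "PP (2 * int CARD('n) - 1) f"
  shows "PP (2 * int CARD('n) - 1) (restr K f)"
  unfolding PP_def
proof (intro conjI allI impI)
  fix Y Z :: "'n set" assume "odd (int (card Z) + (2 * int CARD('n) - 1))"
  from PP_parity[OF f this] show "restr K f Y Z = 0" by (simp add: restr_def)
next
  fix Y Z D :: "'n set"
  assume DZ: "D \<inter> Z = {}" and N: "2 * int CARD('n) - 1 < 2 * int (card D) + int (card Z)"
  have "card D + card Z \<le> CARD('n)" using DZ by (rule card_disjoint_le)
  then have "card Z = 0" using N by linarith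
  then have "f Y Z = 0" for Y by (intro PP_parity[OF f]) simp
  then show "altsum D (\<lambda>Y. restr K f Y Z) Y = 0" by (intro altsum_eq_0) (simp add: restr_def)
qed

lemma phi_unit:
  assumes "{} \<in> K" "UNIV \<notin> K"
  shows "\<exists>f :: 'n::finite set \<Rightarrow> 'n set \<Rightarrow> 'b::comm_ring_1. PP (2 * int CARD('n) - 2) f \<and> phi K f = 1"
proof (intro exI conjI)
  \<comment> \<open>The only alternating sum to be tested runs over the whole cube and contains both
    corners; of these, \<open>K\<close> contains just the empty set.\<close>
  let ?f = "\<lambda>(Y :: 'n set) (Z :: 'n set). if Z = {} then signed_pair {} UNIV Y else 0 :: 'b"
  show "PP (2 * int CARD('n) - 2) ?f"
    unfolding PP_def
  proof (intro conjI allI impI)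
    fix Y Z D :: "'n set"
    assume DZ: "D \<inter> Z = {}" and N: "2 * int CARD('n) - 2 < 2 * int (card D) + int (card Z)"
    show "altsum D (\<lambda>Y. ?f Y Z) Y = 0"
    proof (cases "Z = {}")
      case True
      then have "card D = CARD('n)" using N card_disjoint_le[OF DZ] by simp
      then have "D = UNIV" by (simp add: card_eq_UNIV_imp_eq_UNIV)
      then show ?thesis using True altsum_signed_pair[of "{}" UNIV UNIV Y] by simp
    qed simp
  qed auto
  have "phi K ?f = (\<Sum>Y\<in>K. if Y = {} then 1 else 0)"
    unfolding phi_def by (rule sum.cong) (use assms in \<open>auto simp: signed_pair_def\<close>)
  also have "\<dots> = 1" using assms by simp
  finally show "phi K ?f = 1" .
qed

section \<open>Exactness for paths from a vertex other than the centre\<close>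

context cube_complex
begin

text \<open>The chase in the long exact sequence. As \<open>dd\<close> never mixes different
  \<open>Y\<close>, both parts of \<open>dd f\<close> are cycles. \<open>E3\<close> admits a
  remainder that splits, which the quotient does not see.\<close>

lemma exact_from_parts:
  assumes E1: "\<And>g. PP (N + 1) g \<Longrightarrow> supp_on K g \<Longrightarrow> dd g = (\<lambda>Y Z. 0) \<Longrightarrow> \<exists>h. PP N h \<and> supp_on K h \<and> dd h = g"
    and E2: "\<And>g. PP (N + 1) g \<Longrightarrow> supp_on (- K) g \<Longrightarrow> dd g = (\<lambda>Y Z. 0) \<Longrightarrow> \<exists>h. PP N h \<and> supp_on (- K) h \<and> dd h = g"
    and E3: "\<And>f. PP N f \<Longrightarrow> dd f = (\<lambda>Y Z. 0) \<Longrightarrow> \<exists>g. PP (N - 1) g \<and> PP N (restr K (\<lambda>Y Z. f Y Z - dd g Y Z))"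
    and f: "PP N f" "PP (N + 1) (restr K (dd f))"
  shows "\<exists>g. PP (N - 1) g \<and> PP N (restr K (\<lambda>Y Z. f Y Z - dd g Y Z))"
proof -
  let ?g1 = "restr K (dd f)"
  let ?g2 = "\<lambda>Y Z. dd f Y Z - restr K (dd f) Y Z"
  have cyc1: "dd ?g1 = (\<lambda>Y Z. 0)" by (simp add: dd_restr fun_eq_iff) (simp add: restr_def)
  have "\<exists>h. PP N h \<and> supp_on K h \<and> dd h = ?g1"
    by (rule E1) (use f cyc1 in \<open>auto simp: supp_on_def restr_def\<close>)
  then obtain h1 where h1: "PP N h1" "supp_on K h1" "dd h1 = ?g1" by blast
  have "\<exists>h. PP N h \<and> supp_on (- K) h \<and> dd h = ?g2"
  proof (rule E2)
    show "PP (N + 1) ?g2" by (intro PP_diff PP_dd f)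
    show "supp_on (- K) ?g2" by (auto simp: supp_on_def restr_def)
    show "dd ?g2 = (\<lambda>Y Z. 0)" by (simp add: dd_diff cyc1)
  qed
  then obtain h2 where h2: "PP N h2" "supp_on (- K) h2" "dd h2 = ?g2" by blast
  let ?f = "\<lambda>Y Z. f Y Z - (h1 Y Z + h2 Y Z)"
  have "\<exists>g. PP (N - 1) g \<and> PP N (restr K (\<lambda>Y Z. ?f Y Z - dd g Y Z))"
  proof (rule E3)
    show "PP N ?f" by (intro PP_diff PP_add f h1 h2)
    show "dd ?f = (\<lambda>Y Z. 0)" by (simp add: dd_diff dd_add h1 h2)
  qed
  then obtain g where g: "PP (N - 1) g" "PP N (restr K (\<lambda>Y Z. ?f Y Z - dd g Y Z))" by blast
  have "restr K (\<lambda>Y Z. f Y Z - dd g Y Z) = (\<lambda>Y Z. restr K (\<lambda>Y Z. ?f Y Z - dd g Y Z) Y Z + h1 Y Z)"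
    using h1(2) h2(2) by (auto simp: restr_def supp_on_def fun_eq_iff)
  then show ?thesis using g PP_add[OF g(2) h1(1)] by auto
qed

text \<open>Here \<open>u\<close> is the displacement of the source vertex. A direction with
  \<open>u l < 0\<close> contracts the functions on \<open>K\<close>, one with
  \<open>u l > 0\<close> those off \<open>K\<close>; \<open>H1\<close> and \<open>H2\<close> say
  what replaces a missing sign.\<close>

theorem exact_away:
  fixes u :: "'n \<Rightarrow> int"
  assumes p: "\<And>j b. p j b = (if b then u j \<le> 0 else u j \<ge> 0)"
    and down: "\<And>A B. A \<in> K \<Longrightarrow> B \<subseteq> A \<Longrightarrow> B \<in> K"
    and H1: "{j. u j < 0} \<noteq> {} \<or> ({j. u j > 0} \<noteq> {} \<and> {j. u j > 0} \<in> K)"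
    and H2: "{j. u j > 0} \<noteq> {} \<or> ({j. u j < 0} \<noteq> {} \<and> - {j. u j < 0} \<notin> K)"
    and f: "PP N f" "PP (N + 1) (restr K (dd f))"
  shows "\<exists>g. PP (N - 1) g \<and> PP N (restr K (\<lambda>Y Z. f Y Z - dd g Y Z))"
proof (rule exact_from_parts[OF _ _ _ f])
  have neg: "\<exists>g. PP M g \<and> supp_on U g \<and> dd g = f"
    if "u l < 0" "PP (M + 1) f" "supp_on U f" "\<And>Y. insert l Y \<in> U \<Longrightarrow> Y \<in> U" "dd f = (\<lambda>Y Z. 0)" for l M f U
    by (rule contract[of l True]) (use that p in \<open>auto simp: put_def\<close>)
  have pos: "\<exists>g. PP M g \<and> supp_on U g \<and> dd g = f"
    if "u l > 0" "PP (M + 1) f" "supp_on U f" "\<And>Y. Y - {l} \<in> U \<Longrightarrow> Y \<in> U" "dd f = (\<lambda>Y Z. 0)" for l M f U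
    by (rule contract[of l False]) (use that p in \<open>auto simp: put_def\<close>)
  {
    fix g assume g: "PP (N + 1) g" "supp_on K g" "dd g = (\<lambda>Y Z. 0)"
    show "\<exists>h. PP N h \<and> supp_on K h \<and> dd h = g"
    proof (cases "\<exists>l. u l < 0")
      case True
      then obtain l where "u l < 0" by blast
      then show ?thesis using g down by (rule_tac neg) auto
    next
      case False
      then obtain l where l: "u l > 0" and Pos: "{j. u j > 0} \<in> K" using H1 by auto
      \<comment> \<open>No \<open>u j\<close> is negative, so these are the directions with
        \<open>u j = 0\<close>. Clearing them leaves the subsets of \<open>{j. u j > 0}\<close>: a
        family closed under adding \<open>l\<close>, and inside \<open>K\<close> because its largest
        member is.\<close>
      let ?W = "- {j. u j > 0}"
      have "\<exists>h. PP N h \<and> supp_on K h \<and> supp_on {Y \<in> K. \<forall>l\<in>?W. (l \<in> Y) \<noteq> True} (\<lambda>Y Z. g Y Z - dd h Y Z)"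
        by (rule reduce_many) (use g down p in \<open>auto simp: put_def\<close>)
      then obtain h where h: "PP N h" "supp_on K h"
        "supp_on {Y \<in> K. \<forall>l\<in>?W. (l \<in> Y) \<noteq> True} (\<lambda>Y Z. g Y Z - dd h Y Z)" by blast
      have "\<exists>h'. PP N h' \<and> supp_on (Pow {j. u j > 0}) h' \<and> dd h' = (\<lambda>Y Z. g Y Z - dd h Y Z)"
      proof (rule pos[OF l])
        show "PP (N + 1) (\<lambda>Y Z. g Y Z - dd h Y Z)" by (intro PP_diff PP_dd g h)
        show "supp_on (Pow {j. u j > 0}) (\<lambda>Y Z. g Y Z - dd h Y Z)"
          using h(3) by (auto simp: supp_on_def)
        show "dd (\<lambda>Y Z. g Y Z - dd h Y Z) = (\<lambda>Y Z. 0)" by (simp add: dd_diff g)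
      qed (use l in auto)
      then obtain h' where h': "PP N h'" "supp_on (Pow {j. u j > 0}) h'" "dd h' = (\<lambda>Y Z. g Y Z - dd h Y Z)" by blast
      have "supp_on K h'" using h'(2) down[OF Pos] unfolding supp_on_def by blast
      then show ?thesis using h h'
        by (intro exI[of _ "\<lambda>Y Z. h Y Z + h' Y Z"]) (simp add: PP_add dd_add supp_on_add)
    qed
  }
  {
    fix g assume g: "PP (N + 1) g" "supp_on (- K) g" "dd g = (\<lambda>Y Z. 0)"
    show "\<exists>h. PP N h \<and> supp_on (- K) h \<and> dd h = g"
    proof (cases "\<exists>l. u l > 0")
      case True
      then obtain l where "u l > 0" by blast
      then show ?thesis using g down by (rule_tac pos) auto
    next
      case False
      then obtain l where l: "u l < 0" and Neg: "- {j. u j < 0} \<notin> K" using H2 by auto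
      \<comment> \<open>The mirror image: the surviving sets contain \<open>?W\<close>, a family
        closed under removing \<open>l\<close> and outside \<open>K\<close> because its smallest
        member is.\<close>
      let ?W = "- {j. u j < 0}"
      have "\<exists>h. PP N h \<and> supp_on (- K) h \<and> supp_on {Y \<in> - K. \<forall>l\<in>?W. (l \<in> Y) \<noteq> False} (\<lambda>Y Z. g Y Z - dd h Y Z)"
        by (rule reduce_many) (use g down p in \<open>auto simp: put_def\<close>)
      then obtain h where h: "PP N h" "supp_on (- K) h"
        "supp_on {Y \<in> - K. \<forall>l\<in>?W. (l \<in> Y) \<noteq> False} (\<lambda>Y Z. g Y Z - dd h Y Z)" by blast
      have "\<exists>h'. PP N h' \<and> supp_on {Y. ?W \<subseteq> Y} h' \<and> dd h' = (\<lambda>Y Z. g Y Z - dd h Y Z)"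
      proof (rule neg[OF l])
        show "PP (N + 1) (\<lambda>Y Z. g Y Z - dd h Y Z)" by (intro PP_diff PP_dd g h)
        show "supp_on {Y. ?W \<subseteq> Y} (\<lambda>Y Z. g Y Z - dd h Y Z)"
          using h(3) by (auto simp: supp_on_def)
        show "dd (\<lambda>Y Z. g Y Z - dd h Y Z) = (\<lambda>Y Z. 0)" by (simp add: dd_diff g)
      qed (use l in auto)
      then obtain h' where h': "PP N h'" "supp_on {Y. ?W \<subseteq> Y} h'" "dd h' = (\<lambda>Y Z. g Y Z - dd h Y Z)" by blast
      have "supp_on (- K) h'" using h'(2) down Neg unfolding supp_on_def by blast
      then show ?thesis using h h'
        by (intro exI[of _ "\<lambda>Y Z. h Y Z + h' Y Z"]) (simp add: PP_add dd_add supp_on_add)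
    qed
  }
  {
    fix f assume f: "PP N f" "dd f = (\<lambda>Y Z. 0)"
    have "\<exists>g. PP (N - 1) g \<and> supp_on UNIV g \<and> dd g = f"
    proof (cases "\<exists>l. u l > 0")
      case True
      then obtain l where "u l > 0" by blast
      then show ?thesis using f by (rule_tac pos) (auto simp: supp_on_def)
    next
      case False
      then obtain l where "u l < 0" using H2 by auto
      then show ?thesis using f by (rule_tac neg) (auto simp: supp_on_def)
    qed
    then obtain g where "PP (N - 1) g" "dd g = f" by blast
    then show "\<exists>g. PP (N - 1) g \<and> PP N (restr K (\<lambda>Y Z. f Y Z - dd g Y Z))"
      by (intro exI[of _ g]) (auto simp: restr_def)
  }
qed

end

section \<open>Exactness for paths from the centre of the cube\<close>

locale local_cube_complex = cube_complex t p for t :: "'n::finite \<Rightarrow> 'b::comm_ring_1" and p +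
  assumes p_True: "p j b"
    and koszul_exact: "\<And>q c. q \<ge> 2 \<Longrightarrow> (\<And>Z. card Z \<noteq> q \<Longrightarrow> c Z = 0) \<Longrightarrow>
      (\<And>Z. (\<Sum>j\<in>-Z. sg j Z * t j * c (insert j Z)) = 0) \<Longrightarrow>
      \<exists>b. (\<forall>Z. card Z \<noteq> Suc q \<longrightarrow> b Z = 0) \<and> (\<forall>Z. c Z = (\<Sum>j\<in>-Z. sg j Z * t j * b (insert j Z)))"
begin

definition dv :: "('n set \<Rightarrow> 'b) \<Rightarrow> 'n set \<Rightarrow> 'b" where
  "dv c Z = (\<Sum>j\<in>UNIV. sg j Z * (if j \<in> Z then 1 else t j) * c (toggle j Z))"

lemma dd_eq_dv: "dd f Y Z = dv (f Y) Z"
  by (auto simp: dd_def dv_def cf_def p_True intro!: sum.cong)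

lemma dv_dv: "dv (dv c) Z = 0"
proof -
  have "dd (dd (\<lambda>Y. c)) {} Z = dv (dv c) Z"
  proof -
    have "dd (\<lambda>Y. c) {} = dv c" by (simp add: dd_eq_dv fun_eq_iff)
    then show ?thesis by (simp add: dd_eq_dv)
  qed
  then show ?thesis by simp
qed

lemma dv_split: "dv c Z = (\<Sum>j\<in>Z. sg j Z * c (Z - {j})) + (\<Sum>j\<in>-Z. sg j Z * t j * c (insert j Z))"
proof -
  have "dv c Z = (\<Sum>j\<in>Z \<union> -Z. sg j Z * (if j \<in> Z then 1 else t j) * c (toggle j Z))"
    by (simp add: dv_def)
  also have "\<dots> = (\<Sum>j\<in>Z. sg j Z * (if j \<in> Z then 1 else t j) * c (toggle j Z))
     + (\<Sum>j\<in>-Z. sg j Z * (if j \<in> Z then 1 else t j) * c (toggle j Z))"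
    by (rule sum.union_disjoint) auto
  finally show ?thesis by (simp add: toggle_def)
qed

text \<open>Filtration by \<open>card Z\<close>: the lowest layer of a cycle is a Koszul cycle, and
  subtracting \<open>dv\<close> of a Koszul primitive removes it. The process ends when the layers
  exceed \<open>CARD('n)\<close>.\<close>

lemma dv_exact:
  assumes "q \<ge> 2" "\<And>Z. c Z \<noteq> 0 \<Longrightarrow> card Z \<ge> q \<and> even (card Z + q)" "\<And>Z. dv c Z = 0"
  shows "\<exists>b. (\<forall>Z. b Z \<noteq> 0 \<longrightarrow> card Z \<ge> Suc q \<and> odd (card Z + q)) \<and> (\<forall>Z. c Z = dv b Z)"
  using assms
proof (induction "CARD('n) + 1 - q" arbitrary: q c rule: less_induct)
  case less
  show ?case
  proof (cases "q > CARD('n)")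
    case True
    have "c Z = 0" for Z
    proof (rule ccontr)
      assume "c Z \<noteq> 0"
      then have "card Z \<ge> q" using less.prems by blast
      moreover have "card Z \<le> CARD('n)" by (rule card_mono) auto
      ultimately show False using True by simp
    qed
    then show ?thesis by (intro exI[of _ "\<lambda>_. 0"]) (simp add: dv_def)
  next
    case False
    let ?cq = "\<lambda>Z. if card Z = q then c Z else 0"
    have cq0: "(\<Sum>j\<in>-Z. sg j Z * t j * ?cq (insert j Z)) = 0" for Z
    proof (cases "Suc (card Z) = q")
      case True
      have "(\<Sum>j\<in>Z. sg j Z * c (Z - {j})) = 0"
      proof (rule sum.neutral, rule ballI)
        fix j assume "j \<in> Z"
        then have "card (Z - {j}) < q" using True by (metis Suc_lessD card_Diff1_less finite lessI less_SucI)
        then have "c (Z - {j}) = 0" using less.prems(2)[of "Z - {j}"] by linarith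
        then show "sg j Z * c (Z - {j}) = 0" by simp
      qed
      moreover have "(\<Sum>j\<in>-Z. sg j Z * t j * ?cq (insert j Z)) = (\<Sum>j\<in>-Z. sg j Z * t j * c (insert j Z))"
        by (rule sum.cong) (use True in auto)
      ultimately show ?thesis using less.prems(3)[of Z] by (simp add: dv_split)
    next
      case False
      then show ?thesis by (intro sum.neutral) auto
    qed
    have "\<exists>b. (\<forall>Z. card Z \<noteq> Suc q \<longrightarrow> b Z = 0) \<and> (\<forall>Z. ?cq Z = (\<Sum>j\<in>-Z. sg j Z * t j * b (insert j Z)))"
      by (rule koszul_exact) (use less.prems cq0 in auto)
    then obtain b where b: "\<And>Z. card Z \<noteq> Suc q \<Longrightarrow> b Z = 0"
      "\<And>Z. ?cq Z = (\<Sum>j\<in>-Z. sg j Z * t j * b (insert j Z))" by blast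
    \<comment> \<open>Size \<open>q\<close> cancels and size \<open>q + 1\<close> has the wrong
      parity, so the remainder starts at \<open>q + 2\<close>.\<close>
    define c' where "c' Z = c Z - dv b Z" for Z
    have c'0: "card Z \<ge> q + 2 \<and> even (card Z + (q + 2))" if "c' Z \<noteq> 0" for Z
    proof (cases "card Z = q")
      case True
      have "b (Z - {j}) = 0" if "j \<in> Z" for j
        by (rule b(1)) (use True that in \<open>auto simp: card_Diff_singleton\<close>)
      then have "dv b Z = c Z" using True b(2)[of Z] by (simp add: dv_split)
      then show ?thesis using that by (simp add: c'_def)
    next
      case False
      show ?thesis
      proof (cases "c Z = 0")
        case True
        then have "dv b Z \<noteq> 0" using that by (simp add: c'_def)
        moreover have "(\<Sum>j\<in>-Z. sg j Z * t j * b (insert j Z)) = 0" using b(2)[of Z] False by simp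
        ultimately have "(\<Sum>j\<in>Z. sg j Z * b (Z - {j})) \<noteq> 0" by (simp add: dv_split)
        then obtain j where j: "j \<in> Z" "b (Z - {j}) \<noteq> 0"
          by (metis (no_types, lifting) mult_zero_right sum.neutral)
        then have "card (Z - {j}) = Suc q" using b(1) by blast
        then have "card Z = q + 2" using j(1) by (metis add_2_eq_Suc' card_Suc_Diff1 finite)
        then show ?thesis by simp
      next
        case cZ: False
        then have "card Z \<ge> q" "even (card Z + q)" using less.prems(2) by auto
        then show ?thesis using False by (cases "card Z = Suc q") auto
      qed
    qed
    have dvc': "dv c' Z = 0" for Z
    proof -
      have "dv c' Z = dv c Z - dv (dv b) Z"
        by (simp add: dv_def[of _ Z] c'_def algebra_simps sum_subtractf)
      then show ?thesis using less.prems(3) by (simp add: dv_dv)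
    qed
    have "\<exists>b'. (\<forall>Z. b' Z \<noteq> 0 \<longrightarrow> card Z \<ge> Suc (q + 2) \<and> odd (card Z + (q + 2))) \<and> (\<forall>Z. c' Z = dv b' Z)"
      by (rule less.hyps) (use False less.prems(1) c'0 dvc' in auto)
    then obtain b' where b': "\<And>Z. b' Z \<noteq> 0 \<Longrightarrow> card Z \<ge> Suc (q + 2) \<and> odd (card Z + (q + 2))"
      "\<And>Z. c' Z = dv b' Z" by blast
    show ?thesis
    proof (intro exI conjI allI impI)
      fix Z
      have "dv (\<lambda>Z. b Z + b' Z) Z = dv b Z + dv b' Z"
        by (simp add: dv_def algebra_simps sum.distrib)
      then show "c Z = dv (\<lambda>Z. b Z + b' Z) Z" using b'(2)[of Z] by (simp add: c'_def algebra_simps)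
      assume "b Z + b' Z \<noteq> 0"
      then have "b Z \<noteq> 0 \<or> b' Z \<noteq> 0" by auto
      then have "Suc q \<le> card Z \<and> odd (card Z + q)" using b(1)[of Z] b'(1)[of Z] by fastforce
      then show "Suc q \<le> card Z" "odd (card Z + q)" by auto
    qed
  qed
qed

lemma exact_single:
  assumes f: "PP (N + 1) f" "supp_on {Y0} f" "dd f = (\<lambda>Y Z. 0)" and N: "N < 2 * int CARD('n) - 2"
  shows "\<exists>g. PP N g \<and> supp_on {Y0} g \<and> dd g = f"
proof -
  \<comment> \<open>At a single \<open>Y0\<close> the alternating sum over \<open>- Z\<close> sees
    the value alone, up to sign. So the degree bound only allows \<open>Z\<close> with
    \<open>2 * (CARD('n) - card Z) + card Z \<le> N + 1\<close>, that is
    \<open>card Z \<ge> q\<close>; the assumption on \<open>N\<close> gives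
    \<open>q \<ge> 2\<close>.\<close>
  define q where "q = nat (2 * int CARD('n) - (N + 1))"
  have q: "int q = 2 * int CARD('n) - (N + 1)" "q \<ge> 2" using N by (auto simp: q_def)
  have "\<exists>b. (\<forall>Z. b Z \<noteq> 0 \<longrightarrow> card Z \<ge> Suc q \<and> odd (card Z + q)) \<and> (\<forall>Z. f Y0 Z = dv b Z)"
  proof (rule dv_exact[OF q(2)])
    fix Z assume nz: "f Y0 Z \<noteq> 0"
    have par: "even (int (card Z) + (N + 1))" using PP_parity[OF f(1)] nz by blast
    have "altsum (- Z) (\<lambda>Y. f Y Z) Y0 = (-1) ^ card (Y0 \<inter> - Z) * f Y0 Z"
      by (subst altsum_supp_single[of Y0]) (use f(2) in \<open>auto simp: supp_on_def\<close>)
    moreover have "((-1) ^ card (Y0 \<inter> - Z) * f Y0 Z) \<noteq> 0"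
    proof
      assume "(-1) ^ card (Y0 \<inter> - Z) * f Y0 Z = 0"
      then have "(-1) ^ card (Y0 \<inter> - Z) * ((-1) ^ card (Y0 \<inter> - Z) * f Y0 Z) = 0" by simp
      then show False using nz by (simp add: mult.assoc[symmetric] flip: power_mult_distrib)
    qed
    ultimately have "\<not> 2 * int (card (- Z)) + int (card Z) > N + 1"
      using PP_altsum[OF f(1), of "- Z" Z Y0] by auto
    moreover have "card (- Z) + card Z = CARD('n)"
      using card_Un_disjoint[of "- Z" Z] by simp
    ultimately have "int (card Z) \<ge> int q" using q by auto
    moreover have "even (int (card Z + q))" using par q(1) by auto
    ultimately show "q \<le> card Z \<and> even (card Z + q)" by auto
  next
    show "dv (f Y0) Z = 0" for Z using f(3) by (simp add: dd_eq_dv[symmetric])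
  qed
  then obtain b where b: "\<And>Z. b Z \<noteq> 0 \<Longrightarrow> card Z \<ge> Suc q \<and> odd (card Z + q)" "\<And>Z. f Y0 Z = dv b Z" by blast
  let ?g = "\<lambda>Y Z. if Y = Y0 then b Z else 0"
  show ?thesis
  proof (intro exI conjI)
    show "supp_on {Y0} ?g" by (simp add: supp_on_def)
    have "dd ?g Y Z = f Y Z" for Y Z
      using b(2)[of Z] f(2) by (cases "Y = Y0") (auto simp: dd_eq_dv supp_on_def dv_def)
    then show "dd ?g = f" by (simp add: fun_eq_iff)
    show "PP N ?g"
      unfolding PP_def
    proof (intro conjI allI impI)
      fix Y Z :: "'n set" assume o: "odd (int (card Z) + N)"
      show "?g Y Z = 0"
      proof (rule ccontr)
        assume "?g Y Z \<noteq> 0"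
        then have "odd (card Z + q)" using b(1)[of Z] by (auto split: if_splits)
        then have "odd (int (card Z) + int q)" by (metis even_of_nat of_nat_add)
        then show False using o q(1) by auto
      qed
    next
      fix Y Z D :: "'n set" assume D: "D \<inter> Z = {}" and ND: "N < 2 * int (card D) + int (card Z)"
      have "b Z = 0"
      proof (rule ccontr)
        assume "b Z \<noteq> 0"
        then have "card Z \<ge> Suc q" using b(1)[of Z] by blast
        then show False using ND q card_disjoint_le[OF D] by linarith
      qed
      then show "altsum D (\<lambda>Y. ?g Y Z) Y = 0" by (intro altsum_eq_0) simp
    qed
  qed
qed

text \<open>All directions can be cleared, with either choice of \<open>e\<close>. This concentrates
  a cycle at one corner of the cube, where the Koszul complex takes over.\<close>

theorem exact_at:
  assumes down: "\<And>A B. A \<in> K \<Longrightarrow> B \<subseteq> A \<Longrightarrow> B \<in> K"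
    and U: "UNIV \<notin> K"
    and f: "PP N f" "PP (N + 1) (restr K (dd f))" and N: "N < 2 * int CARD('n) - 2"
  shows "\<exists>g. PP (N - 1) g \<and> PP N (restr K (\<lambda>Y Z. f Y Z - dd g Y Z))"
proof (rule exact_from_parts[OF _ _ _ f])
  have vertex: "\<exists>h. PP N h \<and> supp_on U h \<and> dd h = g"
    if g: "PP (N + 1) g" "supp_on U g" "dd g = (\<lambda>Y Z. 0)"
      and U: "\<And>l Y. put e l Y \<in> U \<Longrightarrow> Y \<in> U" for g U e
  proof -
    have "\<exists>h. PP N h \<and> supp_on U h \<and> supp_on {Y \<in> U. \<forall>l\<in>UNIV. (l \<in> Y) \<noteq> e} (\<lambda>Y Z. g Y Z - dd h Y Z)"
      by (rule reduce_many) (use g p_True U in auto)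
    then obtain h where h: "PP N h" "supp_on U h"
        "supp_on {Y \<in> U. \<forall>l\<in>UNIV. (l \<in> Y) \<noteq> e} (\<lambda>Y Z. g Y Z - dd h Y Z)" by blast
    \<comment> \<open>The empty set for \<open>e = True\<close>, as needed on \<open>K\<close>, and
      \<open>UNIV\<close> for \<open>e = False\<close>, as needed off \<open>K\<close>.\<close>
    define Y0 where "Y0 = {l :: 'n. \<not> e}"
    have Y0: "{Y \<in> U. \<forall>l\<in>UNIV. (l \<in> Y) \<noteq> e} \<subseteq> {Y0} \<inter> U" by (auto simp: Y0_def)
    have "\<exists>h'. PP N h' \<and> supp_on {Y0} h' \<and> dd h' = (\<lambda>Y Z. g Y Z - dd h Y Z)"
    proof (rule exact_single[OF _ _ _ N])
      show "PP (N + 1) (\<lambda>Y Z. g Y Z - dd h Y Z)" by (intro PP_diff PP_dd g h)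
      show "supp_on {Y0} (\<lambda>Y Z. g Y Z - dd h Y Z)"
        by (rule supp_on_mono[OF h(3)]) (use Y0 in blast)
      show "dd (\<lambda>Y Z. g Y Z - dd h Y Z) = (\<lambda>Y Z. 0)" by (simp add: dd_diff g)
    qed
    then obtain h' where h': "PP N h'" "supp_on {Y0} h'" "dd h' = (\<lambda>Y Z. g Y Z - dd h Y Z)" by blast
    show ?thesis
    proof (cases "Y0 \<in> U")
      case True
      then have sh': "supp_on U h'" using h'(2) unfolding supp_on_def by (metis singletonD)
      show ?thesis
      proof (intro exI conjI)
        show "PP N (\<lambda>Y Z. h Y Z + h' Y Z)" by (intro PP_add h h')
        show "supp_on U (\<lambda>Y Z. h Y Z + h' Y Z)" by (intro supp_on_add h sh')
        show "dd (\<lambda>Y Z. h Y Z + h' Y Z) = g" by (simp add: dd_add h'(3))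
      qed
    next
      case False
      then have "{Y \<in> U. \<forall>l\<in>UNIV. (l \<in> Y) \<noteq> e} = {}" using Y0 by blast
      then have "g Y Z - dd h Y Z = 0" for Y Z using h(3) by (simp only: supp_on_def empty_iff not_False_eq_True simp_thms)
      then have "dd h = g" by (simp add: fun_eq_iff)
      then show ?thesis using h(1,2) by blast
    qed
  qed
  {
    fix g assume "PP (N + 1) g" "supp_on K g" "dd g = (\<lambda>Y Z. 0)"
    then show "\<exists>h. PP N h \<and> supp_on K h \<and> dd h = g"
      by (rule vertex[of _ _ True]) (use down in \<open>auto simp: put_def\<close>)
  }
  {
    fix g assume "PP (N + 1) g" "supp_on (- K) g" "dd g = (\<lambda>Y Z. 0)"
    then show "\<exists>h. PP N h \<and> supp_on (- K) h \<and> dd h = g"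
      by (rule vertex[of _ _ False]) (use down in \<open>auto simp: put_def\<close>)
  }
  {
    fix f assume f: "PP N f" "dd f = (\<lambda>Y Z. 0)"
    have "\<exists>g. PP (N - 1) g \<and> supp_on UNIV g \<and> supp_on {Y \<in> UNIV. \<forall>l\<in>UNIV. (l \<in> Y) \<noteq> False} (\<lambda>Y Z. f Y Z - dd g Y Z)"
      by (rule reduce_many) (use f p_True in \<open>auto simp: supp_on_def\<close>)
    then obtain g where g: "PP (N - 1) g" "supp_on {Y. \<forall>l. l \<in> Y} (\<lambda>Y Z. f Y Z - dd g Y Z)" by auto
    \<comment> \<open>The remainder sits at \<open>UNIV\<close>, outside \<open>K\<close>, and
      therefore splits.\<close>
    have "restr K (\<lambda>Y Z. f Y Z - dd g Y Z) = (\<lambda>Y Z. 0)"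

    proof (rule supp_on_restr_compl, unfold supp_on_def, intro allI impI)
      fix Y Z assume "Y \<notin> - K"
      then have "Y \<noteq> UNIV" using U by auto
      then have "Y \<notin> {Y. \<forall>l. l \<in> Y}" by auto
      then show "f Y Z - dd g Y Z = 0" using g(2) unfolding supp_on_def by blast
    qed
    then show "\<exists>g. PP (N - 1) g \<and> PP N (restr K (\<lambda>Y Z. f Y Z - dd g Y Z))" using g by auto
  }
qed

text \<open>The witness is a signed pair placed at \<open>Z = {j}\<close>. The face tested there
  omits \<open>j\<close>, hence both points have to agree about \<open>j\<close>. The step from
  \<open>{j}\<close> to the empty set contributes \<open>t j\<close>, and \<open>phi\<close> sees
  only the point in \<open>K\<close>.\<close>

lemma phi_dd_surj:
  assumes "(\<exists>Y1\<in>K. \<exists>Y2. Y2 \<notin> K \<and> (j \<in> Y1 \<longleftrightarrow> j \<in> Y2))"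
  shows "\<exists>g. PP (2 * int CARD('n) - 3) g \<and> phi K (dd g) = t j * s"
proof -
  obtain Y1 Y2 where Y: "Y1 \<in> K" "Y2 \<notin> K" "j \<in> Y1 \<longleftrightarrow> j \<in> Y2" using assms by blast
  let ?g = "\<lambda>Y Z. s * (if Z = {j} then signed_pair Y1 Y2 Y else 0)"
  show ?thesis
  proof (intro exI conjI)
    show "PP (2 * int CARD('n) - 3) ?g"
    proof (rule PP_mult, unfold PP_def, intro conjI allI impI)
      fix Y Z D :: "'n set"
      assume DZ: "D \<inter> Z = {}" and N: "2 * int CARD('n) - 3 < 2 * int (card D) + int (card Z)"
      show "altsum D (\<lambda>Y. if Z = {j} then signed_pair Y1 Y2 Y else 0) Y = 0"
      proof (cases "Z = {j}")
        case True
        then have "card D = CARD('n) - 1" "j \<notin> D" using N card_disjoint_le[OF DZ] DZ by auto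
        then have "insert j D = UNIV"
          by (intro card_eq_UNIV_imp_eq_UNIV) (auto simp: card_gt_0_iff Suc_leI)
        then have "Y1 - D = Y2 - D" using Y(3) by auto
        then show ?thesis using True altsum_signed_pair[of Y1 D Y2 Y] by simp
      qed simp
    qed auto
    have dg: "dd ?g Y {} = t j * s * signed_pair Y1 Y2 Y" for Y
    proof -
      have "dd ?g Y {} = (\<Sum>l\<in>UNIV. if l = j then t j * s * signed_pair Y1 Y2 Y else 0)"
        unfolding dd_eq_dv dv_def by (rule sum.cong) (auto simp: toggle_def sg_def)
      then show ?thesis by simp
    qed
    have "phi K (dd ?g) = (\<Sum>Y\<in>K. if Y = Y1 then t j * s else 0)"
      unfolding phi_def dg
    proof (rule sum.cong)
      fix Y assume "Y \<in> K"
      then have "Y \<noteq> Y2" using Y by blast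
      then show "(- 1) ^ card Y * (t j * s * signed_pair Y1 Y2 Y) = (if Y = Y1 then t j * s else 0)"
        by (auto simp: signed_pair_def algebra_simps simp flip: power_mult_distrib)
    qed simp
    then show "phi K (dd ?g) = t j * s" using Y by simp
  qed
qed

text \<open>A direction \<open>j\<close> fails the condition of \<open>phi_dd_surj\<close> only if
  membership in \<open>K\<close> is decided by \<open>j\<close> alone, that is, if \<open>K\<close>
  consists of the sets without \<open>j\<close>. Hence at most one direction fails.\<close>

theorem exact_end:
  assumes down: "\<And>A B. A \<in> K \<Longrightarrow> B \<subseteq> A \<Longrightarrow> B \<in> K"
    and K: "{} \<in> K" "UNIV \<notin> K"
    and f: "PP (2 * int CARD('n) - 2) f" "phi K f = (\<Sum>j\<in>UNIV. t j * s j)"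
  shows "\<exists>g. PP (2 * int CARD('n) - 3) g \<and> PP (2 * int CARD('n) - 2) (restr K (\<lambda>Y Z. f Y Z - dd g Y Z))"
proof -
  define good where "good j \<longleftrightarrow> (\<exists>Y1\<in>K. \<exists>Y2. Y2 \<notin> K \<and> (j \<in> Y1 \<longleftrightarrow> j \<in> Y2))" for j
  have bad: "{j} \<notin> K \<and> - {j} \<in> K" if "\<not> good j" for j
    using that K unfolding good_def by (metis ComplD Compl_iff UNIV_I empty_iff insertI1 insert_iff)
  have uniq: "i = j" if "\<not> good i" "\<not> good j" for i j
  proof (rule ccontr)
    assume "i \<noteq> j"
    then have "{i} \<subseteq> - {j}" by auto
    then show False using bad[OF that(1)] bad[OF that(2)] down by blast
  qed
  have "\<exists>i. \<forall>j. j \<noteq> i \<longrightarrow> good j"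
  proof (cases "\<exists>i. \<not> good i")
    case True
    then obtain i where "\<not> good i" by blast
    then show ?thesis using uniq by blast
  qed auto
  then obtain i where i: "\<And>j. j \<noteq> i \<Longrightarrow> good j" by blast
  \<comment> \<open>As the \<open>t j\<close> sum to zero, subtracting \<open>s i\<close> from all
    coefficients does not change the value and kills the term of the possibly bad direction
    \<open>i\<close>.\<close>
  have "\<exists>g. \<forall>j\<in>-{i}. PP (2 * int CARD('n) - 3) (g j) \<and> phi K (dd (g j)) = t j * (s j - s i)"
    by (rule bchoice) (use phi_dd_surj i in \<open>auto simp: good_def\<close>)
  then obtain g where "\<forall>j\<in>-{i}. PP (2 * int CARD('n) - 3) (g j) \<and> phi K (dd (g j)) = t j * (s j - s i)" by blast
  then have g: "PP (2 * int CARD('n) - 3) (g j)" "phi K (dd (g j)) = t j * (s j - s i)" if "j \<noteq> i" for j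
    using that by auto
  let ?g = "\<lambda>Y Z. \<Sum>j\<in>-{i}. g j Y Z"
  have Pg: "PP (2 * int CARD('n) - 3) ?g" by (rule PP_sum) (use g in auto)
  have "phi K (dd ?g) = (\<Sum>j\<in>-{i}. t j * (s j - s i))"
    by (simp add: dd_sum phi_sum g)
  also have "\<dots> = (\<Sum>j\<in>UNIV. t j * (s j - s i))"
    by (rule sum.mono_neutral_left) auto
  also have "\<dots> = phi K f"
    by (simp add: f(2) algebra_simps sum_subtractf sum_t flip: sum_distrib_left)
  finally have "phi K (\<lambda>Y Z. f Y Z - dd ?g Y Z) = 0" by (simp add: phi_diff)
  moreover have "PP (2 * int CARD('n) - 2) (\<lambda>Y Z. f Y Z - dd ?g Y Z)"
    using PP_dd[OF Pg] by (intro PP_diff f) simp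
  ultimately have "PP (2 * int CARD('n) - 2) (restr K (\<lambda>Y Z. f Y Z - dd ?g Y Z))"
    by (simp add: phi_eq_0_iff)
  then show ?thesis using Pg by blast
qed

end

section \<open>Exactness of the Koszul complex\<close>

definition koszul_bd :: "('n::finite \<Rightarrow> 'b::comm_ring_1) \<Rightarrow> ('n set \<Rightarrow> 'b) \<Rightarrow> 'n set \<Rightarrow> 'b" where
  "koszul_bd t c Z = (\<Sum>j\<in>-Z. sg j Z * t j * c (insert j Z))"

text \<open>Chains on \<open>E\<close> are functions on all sets with support in \<open>E\<close>;
  the boundary is then one map for all \<open>E\<close>, and induction on \<open>E\<close> changes
  no types.\<close>

definition supp_card :: "'n::finite set \<Rightarrow> nat \<Rightarrow> ('n set \<Rightarrow> 'b::comm_ring_1) \<Rightarrow> bool" where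
  "supp_card E q c \<longleftrightarrow> (\<forall>Z. c Z \<noteq> 0 \<longrightarrow> Z \<subseteq> E \<and> card Z = q)"

definition koszul_acyclic :: "('n::finite \<Rightarrow> 'b::comm_ring_1) \<Rightarrow> 'n set \<Rightarrow> nat \<Rightarrow> bool" where
  "koszul_acyclic t E q \<longleftrightarrow> (\<forall>c. supp_card E q c \<longrightarrow> koszul_bd t c = (\<lambda>Z. 0) \<longrightarrow>
     (\<exists>b. supp_card E (Suc q) b \<and> koszul_bd t b = c))"

lemma supp_cardD: "supp_card E q c \<Longrightarrow> \<not> (Z \<subseteq> E \<and> card Z = q) \<Longrightarrow> c Z = 0"
  by (auto simp: supp_card_def)

text \<open>Splitting off the direction \<open>j\<close>: \<open>c\<close> is assembled from a part \<open>a\<close> without \<open>j\<close> and a coefficient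
  \<open>b\<close> of the generator \<open>j\<close>.\<close>

definition koszul_join :: "'n::finite \<Rightarrow> ('n set \<Rightarrow> 'b::comm_ring_1) \<Rightarrow> ('n set \<Rightarrow> 'b) \<Rightarrow> 'n set \<Rightarrow> 'b" where
  "koszul_join j a b Z = (if j \<in> Z then sg j (Z - {j}) * b (Z - {j}) else a Z)"

lemma sg_insert_commute:
  assumes "j \<noteq> l" "j \<notin> W" "l \<notin> W"
  shows "sg l (insert j W) * sg j (insert l W) = (- (sg l W * sg j W) :: 'b::comm_ring_1)"
proof -
  have "sg l W * sg j (insert l W) = (- (sg j W * sg l (insert j W)) :: 'b)"
    using sg_anticommute[of l j W] assms by (simp add: toggle_def)
  then have "sg l W * sg l (insert j W) * (sg l W * sg j (insert l W))
      = (sg l W * sg l (insert j W) * (- (sg j W * sg l (insert j W))) :: 'b)" by (simp only:)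
  moreover have "sg l W * sg l (insert j W) * (sg l W * sg j (insert l W))
      = ((sg l W * sg l W) :: 'b) * (sg l (insert j W) * sg j (insert l W))" by (simp only: mult_ac)
  moreover have "sg l W * sg l (insert j W) * (- (sg j W * sg l (insert j W)))
      = - (((sg l (insert j W) :: 'b) * sg l (insert j W)) * (sg l W * sg j W))" by (simp only: mult_ac mult_minus_right)
  ultimately show ?thesis by simp
qed

text \<open>Adjoining \<open>j\<close> forms the mapping cone of multiplication by
  \<open>t j\<close>.\<close>

lemma koszul_bd_join:
  assumes a: "\<And>Z. j \<in> Z \<Longrightarrow> a Z = 0" and b: "\<And>Z. j \<in> Z \<Longrightarrow> b Z = 0"
  shows "koszul_bd t (koszul_join j a b) = koszul_join j (\<lambda>Z. koszul_bd t a Z + t j * b Z) (\<lambda>Z. - koszul_bd t b Z)"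
proof
  fix Z
  show "koszul_bd t (koszul_join j a b) Z = koszul_join j (\<lambda>Z. koszul_bd t a Z + t j * b Z) (\<lambda>Z. - koszul_bd t b Z) Z"
  proof (cases "j \<in> Z")
    case True
    define W where "W = Z - {j}"
    have Z: "Z = insert j W" "j \<notin> W" using True by (auto simp: W_def)
    have "koszul_bd t b W = (\<Sum>l\<in>-Z. sg l W * t l * b (insert l W)) + sg j W * t j * b (insert j W)"
      unfolding koszul_bd_def using Z by (subst sum.remove[of "- W" j]) (auto simp: Compl_insert)
    then have bdb: "koszul_bd t b W = (\<Sum>l\<in>-Z. sg l W * t l * b (insert l W))" by (simp add: b)
    have "koszul_bd t (koszul_join j a b) Z = (\<Sum>l\<in>-Z. - (sg j W * (sg l W * t l * b (insert l W))))"
      unfolding koszul_bd_def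
    proof (rule sum.cong)
      fix l assume "l \<in> - Z"
      then have l: "l \<noteq> j" "l \<notin> W" using Z by auto
      have "insert l Z - {j} = insert l W" using Z l by auto
      then have "sg l Z * t l * koszul_join j a b (insert l Z) = (sg l (insert j W) * sg j (insert l W)) * (t l * b (insert l W))"
        using Z by (simp add: koszul_join_def algebra_simps)
      also have "\<dots> = - (sg j W * (sg l W * t l * b (insert l W)))"
        using l Z by (subst sg_insert_commute) (auto simp: algebra_simps)
      finally show "sg l Z * t l * koszul_join j a b (insert l Z) = - (sg j W * (sg l W * t l * b (insert l W)))" .
    qed simp
    also have "\<dots> = - (sg j W * koszul_bd t b W)"
      by (simp add: bdb sum_negf sum_distrib_left)
    finally show ?thesis using True by (simp add: koszul_join_def W_def)
  next
    case False
    have "koszul_bd t (koszul_join j a b) Z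
        = (\<Sum>l\<in>-Z - {j}. sg l Z * t l * koszul_join j a b (insert l Z)) + sg j Z * t j * koszul_join j a b (insert j Z)"
      unfolding koszul_bd_def using False by (subst sum.remove[of "- Z" j]) auto
    also have "(\<Sum>l\<in>-Z - {j}. sg l Z * t l * koszul_join j a b (insert l Z)) = (\<Sum>l\<in>-Z - {j}. sg l Z * t l * a (insert l Z))"
      by (rule sum.cong) (use False in \<open>auto simp: koszul_join_def\<close>)
    also have "\<dots> = koszul_bd t a Z"
      unfolding koszul_bd_def by (rule sum.mono_neutral_left) (auto simp: a)
    also have "sg j Z * t j * koszul_join j a b (insert j Z) = t j * b Z"
      using False by (simp add: koszul_join_def algebra_simps)
    finally show ?thesis using False by (simp add: koszul_join_def[where Z = Z])
  qed
qed

lemma koszul_bd_zero_outside: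
  assumes "supp_card E q b" "j \<notin> E" "j \<in> Z"
  shows "koszul_bd t b Z = 0"
  unfolding koszul_bd_def
proof (rule sum.neutral, rule ballI)
  fix l assume "l \<in> - Z"
  have "b (insert l Z) = 0" by (rule supp_cardD[OF assms(1)]) (use assms(2,3) in auto)
  then show "sg l Z * t l * b (insert l Z) = 0" by simp
qed

text \<open>The long exact sequence of the cone. The coefficient of \<open>j\<close> in a cycle is a
  cycle of degree \<open>q - 1\<close>, and \<open>lower\<close> makes it a boundary: by acyclicity
  in that degree, or for \<open>q = 1\<close> because \<open>t j\<close> is regular modulo the ideal
  of the \<open>t l\<close> with \<open>l\<close> in \<open>E\<close>.\<close>

lemma koszul_acyclic_insert:
  assumes j: "j \<notin> E" and Eq: "koszul_acyclic t E q" and q: "q > 0"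
    and lower: "koszul_acyclic t E (q - 1) \<and> q \<ge> 2 \<or>
      (\<forall>x g. t j * x = (\<Sum>l\<in>E. t l * g l) \<longrightarrow> (\<exists>g'. x = (\<Sum>l\<in>E. t l * g' l))) \<and> q = 1"
  shows "koszul_acyclic t (insert j E) q"
  unfolding koszul_acyclic_def
proof (intro allI impI)
  fix c assume c: "supp_card (insert j E) q c" and bdc: "koszul_bd t c = (\<lambda>Z. 0)"
  define a where "a Z = (if j \<in> Z then 0 else c Z)" for Z
  define b where "b Z = (if j \<in> Z then 0 else sg j Z * c (insert j Z))" for Z
  have cj: "c = koszul_join j a b"
  proof
    fix Z show "c Z = koszul_join j a b Z"
      by (cases "j \<in> Z") (auto simp: koszul_join_def a_def b_def insert_absorb)
  qed
  have a: "supp_card E q a" unfolding supp_card_def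
  proof (intro allI impI)
    fix Z assume "a Z \<noteq> 0"
    then have "j \<notin> Z" "c Z \<noteq> 0" by (auto simp: a_def split: if_splits)
    then show "Z \<subseteq> E \<and> card Z = q" using c unfolding supp_card_def by blast
  qed
  have b: "supp_card E (q - 1) b" unfolding supp_card_def
  proof (intro allI impI)
    fix Z assume "b Z \<noteq> 0"
    then have "j \<notin> Z" "c (insert j Z) \<noteq> 0" by (auto simp: b_def split: if_splits)
    moreover from this have "insert j Z \<subseteq> insert j E \<and> card (insert j Z) = q" using c unfolding supp_card_def by blast
    ultimately show "Z \<subseteq> E \<and> card Z = q - 1" by auto
  qed
  have eq: "koszul_join j (\<lambda>Z. koszul_bd t a Z + t j * b Z) (\<lambda>Z. - koszul_bd t b Z) = (\<lambda>Z. 0)"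
    using bdc by (subst koszul_bd_join[symmetric]) (auto simp: a_def b_def cj[symmetric])
  have bdb: "koszul_bd t b = (\<lambda>Z. 0)"
  proof
    fix W show "koszul_bd t b W = 0"
    proof (cases "j \<in> W")
      case True then show ?thesis by (rule koszul_bd_zero_outside[OF b j])
    next
      case False
      then have "sg j W * koszul_bd t b W = 0"
        using fun_cong[OF eq, of "insert j W"] by (simp add: koszul_join_def)
      then have "sg j W * (sg j W * koszul_bd t b W) = 0" by simp
      then show ?thesis by simp
    qed
  qed
  have bda: "koszul_bd t a Z + t j * b Z = 0" for Z
  proof (cases "j \<in> Z")
    case True then show ?thesis by (simp add: koszul_bd_zero_outside[OF a j] b_def)
  next
    case False then show ?thesis using fun_cong[OF eq, of Z] by (simp add: koszul_join_def)
  qed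
  have "\<exists>b2. supp_card E q b2 \<and> koszul_bd t b2 = b"
    using lower
  proof (elim disjE conjE)
    assume "koszul_acyclic t E (q - 1)" "q \<ge> 2"
    moreover from this have "Suc (q - 1) = q" by simp
    ultimately show ?thesis using b bdb unfolding koszul_acyclic_def by metis
  next
    assume reg: "\<forall>x g. t j * x = (\<Sum>l\<in>E. t l * g l) \<longrightarrow> (\<exists>g'. x = (\<Sum>l\<in>E. t l * g' l))" and q1: "q = 1"
    have "koszul_bd t a {} = (\<Sum>l\<in>E. t l * (sg l {} * a {l}))"
    proof -
      have "koszul_bd t a {} = (\<Sum>l\<in>UNIV. t l * (sg l {} * a {l}))" by (simp add: koszul_bd_def algebra_simps)
      also have "\<dots> = (\<Sum>l\<in>E. t l * (sg l {} * a {l}))"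
        by (rule sum.mono_neutral_right) (use supp_cardD[OF a] in auto)
      finally show ?thesis .
    qed
    then have "t j * b {} = (\<Sum>l\<in>E. t l * (- (sg l {} * a {l})))"
      using bda[of "{}"] by (simp add: sum_negf eq_neg_iff_add_eq_0 add.commute)
    then obtain g where g: "b {} = (\<Sum>l\<in>E. t l * g l)"
      using reg[rule_format, of "b {}" "\<lambda>l. - (sg l {} * a {l})"] by blast
    define b2 where "b2 Z = (\<Sum>l\<in>E. if Z = {l} then sg l {} * g l else 0)" for Z
    have s2: "supp_card E q b2" unfolding supp_card_def
    proof (intro allI impI)
      fix Z assume "b2 Z \<noteq> 0"
      then obtain l where "l \<in> E" "(if Z = {l} then sg l {} * g l else 0) \<noteq> 0" unfolding b2_def by (rule sum.not_neutral_contains_not_neutral)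
      then show "Z \<subseteq> E \<and> card Z = q" using q1 by (auto split: if_splits)
    qed
    have "koszul_bd t b2 Z = b Z" for Z
    proof (cases "Z = {}")
      case True
      have b2l: "b2 {l} = (if l \<in> E then sg l {} * g l else 0)" for l
        by (simp add: b2_def)
      have "koszul_bd t b2 {} = (\<Sum>l\<in>UNIV. if l \<in> E then t l * g l else 0)"
        unfolding koszul_bd_def by (rule sum.cong) (auto simp: b2l algebra_simps)
      then show ?thesis using True g by (simp add: sum.If_cases)
    next
      case False
      have "koszul_bd t b2 Z = 0" unfolding koszul_bd_def
      proof (rule sum.neutral, rule ballI)
        fix l assume "l \<in> - Z"
        then have "card (insert l Z) \<noteq> q" using False q1 by auto
        then have "b2 (insert l Z) = 0" using supp_cardD[OF s2] by blast
        then show "sg l Z * t l * b2 (insert l Z) = 0" by simp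
      qed
      moreover have "b Z = 0" using False q1 by (intro supp_cardD[OF b]) simp
      ultimately show ?thesis by simp
    qed
    then show ?thesis using s2 by blast
  qed
  then obtain b2 where b2: "supp_card E q b2" "koszul_bd t b2 = b" by blast
  \<comment> \<open>Since \<open>b\<close> is the boundary of \<open>b2\<close> and the boundary of
    \<open>a\<close> is \<open>- t j * b\<close>, this combination is a cycle that does not involve
    \<open>j\<close>.\<close>
  have "supp_card E q (\<lambda>Z. a Z + t j * b2 Z)"
    using a b2(1) unfolding supp_card_def by (metis add.right_neutral mult_zero_right)
  moreover have "koszul_bd t (\<lambda>Z. a Z + t j * b2 Z) = (\<lambda>Z. 0)"
  proof
    fix Z
    have "koszul_bd t (\<lambda>Z. a Z + t j * b2 Z) Z = koszul_bd t a Z + t j * koszul_bd t b2 Z"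
      by (simp add: koszul_bd_def algebra_simps sum.distrib sum_distrib_left)
    then show "koszul_bd t (\<lambda>Z. a Z + t j * b2 Z) Z = 0" using bda by (simp add: b2)
  qed
  ultimately obtain a2 where a2: "supp_card E (Suc q) a2" "koszul_bd t a2 = (\<lambda>Z. a Z + t j * b2 Z)"
    using Eq unfolding koszul_acyclic_def by blast
  let ?r = "koszul_join j a2 (\<lambda>Z. - b2 Z)"
  have "koszul_bd t ?r = koszul_join j (\<lambda>Z. koszul_bd t a2 Z + t j * - b2 Z) (\<lambda>Z. - koszul_bd t (\<lambda>Z. - b2 Z) Z)"
    by (rule koszul_bd_join) (use j in \<open>auto intro!: supp_cardD[OF a2(1)] supp_cardD[OF b2(1)]\<close>)
  also have "(\<lambda>Z. - koszul_bd t (\<lambda>Z. - b2 Z) Z) = b"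
    unfolding b2(2)[symmetric] by (simp add: koszul_bd_def sum_negf fun_eq_iff)
  also have "(\<lambda>Z. koszul_bd t a2 Z + t j * - b2 Z) = a" by (simp add: a2)
  finally have "koszul_bd t ?r = c" using cj by simp
  moreover have "supp_card (insert j E) (Suc q) ?r" unfolding supp_card_def
  proof (intro allI impI)
    fix Z assume nz: "?r Z \<noteq> 0"
    show "Z \<subseteq> insert j E \<and> card Z = Suc q"
    proof (cases "j \<in> Z")
      case True
      then have "b2 (Z - {j}) \<noteq> 0" using nz by (auto simp: koszul_join_def)
      then have "Z - {j} \<subseteq> E" "card (Z - {j}) = q" using b2(1) unfolding supp_card_def by blast+
      then show ?thesis using True by (metis card_Suc_Diff1 finite insert_Diff insert_mono)
    next
      case False
      then have "a2 Z \<noteq> 0" using nz by (auto simp: koszul_join_def)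
      then show ?thesis using a2(1) unfolding supp_card_def by blast
    qed
  qed
  ultimately show "\<exists>b. supp_card (insert j E) (Suc q) b \<and> koszul_bd t b = c" by blast
qed

lemma koszul_acyclic_empty: "q > 0 \<Longrightarrow> koszul_acyclic t {} q"
  unfolding koszul_acyclic_def
proof (intro allI impI)
  fix c :: "'a set \<Rightarrow> 'b" assume q: "q > 0" and c: "supp_card {} q c"
  have "c = (\<lambda>Z. 0)"
  proof
    fix Z show "c Z = 0" by (rule supp_cardD[OF c]) (use q in auto)
  qed
  then show "\<exists>b. supp_card {} (Suc q) b \<and> koszul_bd t b = c"
    by (intro exI[of _ "\<lambda>Z. 0"]) (simp add: supp_card_def koszul_bd_def fun_eq_iff)
qed

section \<open>Polynomials with one linear relation\<close>

type_synonym ('n, 'k) poly_ring = "('n \<Rightarrow>\<^sub>0 nat) \<Rightarrow>\<^sub>0 'k"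

definition pvar :: "'n \<Rightarrow> ('n, 'k::field) poly_ring" where
  "pvar j = Poly_Mapping.single (Poly_Mapping.single j 1) 1"

text \<open>Division by the variable \<open>j\<close>, dropping the monomials not divisible by it.
  It is left inverse to multiplication by that variable and commutes with the other variables, which
  yields regularity without quotient rings.\<close>

definition pdiv :: "'n \<Rightarrow> ('n, 'k::field) poly_ring \<Rightarrow> ('n, 'k) poly_ring" where
  "pdiv j = Poly_Mapping.map_key (\<lambda>m. m + Poly_Mapping.single j 1)"

lemma inj_add_single: "inj (\<lambda>m. m + Poly_Mapping.single j (1 :: nat))"
  by (simp add: inj_def)

lemma lookup_pdiv: "Poly_Mapping.lookup (pdiv j s) m = Poly_Mapping.lookup s (m + Poly_Mapping.single j 1)"
  unfolding pdiv_def map_key.rep_eq[OF inj_add_single] comp_def ..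

lemma pdiv_add: "pdiv j (s + s') = pdiv j s + pdiv j s'"
  by (rule poly_mapping_eqI) (simp add: lookup_pdiv lookup_add)

lemma pdiv_zero [simp]: "pdiv j 0 = 0"
  by (rule poly_mapping_eqI) (simp add: lookup_pdiv)

lemma pdiv_sum: "pdiv j (\<Sum>i\<in>A. f i) = (\<Sum>i\<in>A. pdiv j (f i))"
  by (induction A rule: infinite_finite_induct) (simp_all add: pdiv_add)

lemma pvar_times_single:
  "pvar j * Poly_Mapping.single m a = Poly_Mapping.single (m + Poly_Mapping.single j 1) a"
  by (simp add: pvar_def mult_single add.commute)

lemma pdiv_pvar: "pdiv j (pvar j * s) = s"
proof (induction s rule: single_induct)
  case (single m a)
  show ?case
    unfolding pvar_times_single
    by (rule poly_mapping_eqI) (simp add: lookup_pdiv lookup_single when_def)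
qed (simp_all add: distrib_left pdiv_add)

lemma single_add_commute_eq:
  assumes "l \<noteq> j"
  shows "(m + Poly_Mapping.single l (1::nat) = m' + Poly_Mapping.single j 1) \<longleftrightarrow>
     (\<exists>m0. m = m0 + Poly_Mapping.single j 1 \<and> m' = m0 + Poly_Mapping.single l 1)"
proof
  assume eq: "m + Poly_Mapping.single l 1 = m' + Poly_Mapping.single j 1"
  have eq': "Poly_Mapping.lookup m i + (1 when l = i) = Poly_Mapping.lookup m' i + (1 when j = i)" for i
    using arg_cong[OF eq, of "\<lambda>x. Poly_Mapping.lookup x i"] by (simp add: lookup_add lookup_single)
  let ?m0 = "m - Poly_Mapping.single j 1"
  have "m = ?m0 + Poly_Mapping.single j 1"
    by (rule poly_mapping_eqI) (use eq'[of j] assms in \<open>auto simp: lookup_add lookup_minus lookup_single when_def\<close>)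
  moreover have "m' = ?m0 + Poly_Mapping.single l 1"
  proof (rule poly_mapping_eqI)
    fix i show "Poly_Mapping.lookup m' i = Poly_Mapping.lookup (?m0 + Poly_Mapping.single l 1) i"
      using eq'[of i] assms by (cases "i = j"; cases "i = l") (auto simp: lookup_add lookup_minus lookup_single when_def)
  qed
  ultimately show "\<exists>m0. m = m0 + Poly_Mapping.single j 1 \<and> m' = m0 + Poly_Mapping.single l 1" by blast
qed (auto simp: algebra_simps)

lemma pdiv_pvar_other:
  assumes "l \<noteq> j"
  shows "pdiv j (pvar l * s) = pvar l * pdiv j s"
proof (induction s rule: single_induct)
  case (single m a)
  show ?case
  proof (cases "\<exists>m0. m = m0 + Poly_Mapping.single j 1")
    case True
    then obtain m0 where m: "m = m0 + Poly_Mapping.single j 1" by blast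
    have 1: "pdiv j (Poly_Mapping.single (k + Poly_Mapping.single j 1) a) = Poly_Mapping.single k a" for k
      by (rule poly_mapping_eqI) (simp add: lookup_pdiv lookup_single when_def)
    have "m + Poly_Mapping.single l 1 = (m0 + Poly_Mapping.single l 1) + Poly_Mapping.single j 1"
      by (simp add: m algebra_simps)
    then show ?thesis by (simp only: pvar_times_single 1 m)
  next
    case False
    have "pdiv j (Poly_Mapping.single m a) = 0"
      by (rule poly_mapping_eqI) (use False in \<open>auto simp: lookup_pdiv lookup_single when_def\<close>)
    moreover have "pdiv j (pvar l * Poly_Mapping.single m a) = 0"
      unfolding pvar_times_single
      by (rule poly_mapping_eqI)
         (use False in \<open>auto simp: lookup_pdiv lookup_single when_def single_add_commute_eq[OF assms, simplified]\<close>)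
    ultimately show ?thesis by simp
  qed
qed (simp_all add: distrib_left pdiv_add)

text \<open>The relation \<open>\<Sum>\<^sub>j t\<^sub>j = 0\<close> is imposed by eliminating one distinguished direction. The variable of that
  direction is kept as a spare one, which saves a quotient; hence \<open>eta\<close> below is only a left inverse of \<open>psi\<close>.\<close>

definition spare :: "'n" where
  "spare = (SOME j. True)"

definition tvar :: "'n::finite \<Rightarrow> ('n, 'k::field) poly_ring" where
  "tvar j = (if j = spare then - (\<Sum>l\<in>UNIV - {spare}. pvar l) else pvar j)"

lemma sum_tvar: "(\<Sum>j\<in>UNIV. tvar j) = 0"
proof -
  have "(\<Sum>j\<in>UNIV. tvar j) = tvar spare + (\<Sum>j\<in>UNIV - {spare}. tvar j)"
    by (simp add: sum.remove)
  also have "(\<Sum>j\<in>UNIV - {spare}. tvar j) = (\<Sum>j\<in>UNIV - {spare}. pvar j)"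
    by (rule sum.cong) (auto simp: tvar_def)
  finally show ?thesis by (simp add: tvar_def)
qed

text \<open>Without the spare direction the \<open>tvar\<close> are variables, each regular modulo
  the others, so homology vanishes in positive degrees. The spare one lies in the ideal of the
  others; adjoining it last costs one degree, whence \<open>q \<ge> 2\<close>.\<close>

lemma koszul_acyclic_tvar:
  assumes "q \<ge> 2"
  shows "koszul_acyclic (tvar :: 'n::finite \<Rightarrow> ('n, 'k::field) poly_ring) UNIV q"
proof -
  have E: "\<forall>q>0. koszul_acyclic (tvar :: 'n \<Rightarrow> ('n, 'k) poly_ring) E q" if "spare \<notin> E" for E
  proof -
    have "finite E" by simp
    then show ?thesis using that
    proof (induction E rule: finite_induct)
      case empty
      then show ?case by (simp add: koszul_acyclic_empty)
    next
      case (insert j E)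
      have sp: "j \<noteq> spare" "spare \<notin> E" using insert.prems by auto
      have reg: "\<exists>g'. x = (\<Sum>l\<in>E. tvar l * g' l)" if "tvar j * x = (\<Sum>l\<in>E. tvar l * g l)" for x :: "('n, 'k) poly_ring" and g
      proof -
        have tv: "tvar l = pvar l \<and> l \<noteq> j" if "l \<in> E" for l
          using that sp insert.hyps by (auto simp: tvar_def)
        have "x = pdiv j (tvar j * x)" using sp by (simp add: tvar_def pdiv_pvar)
        also have "\<dots> = (\<Sum>l\<in>E. pdiv j (tvar l * g l))" by (simp add: that pdiv_sum)
        also have "\<dots> = (\<Sum>l\<in>E. tvar l * pdiv j (g l))"
          by (rule sum.cong) (use tv pdiv_pvar_other in metis)+
        finally show ?thesis by (rule exI[of _ "\<lambda>l. pdiv j (g l)"])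
      qed
      show ?case
      proof (intro allI impI)
        fix q :: nat assume q: "q > 0"
        show "koszul_acyclic (tvar :: 'n \<Rightarrow> ('n, 'k) poly_ring) (insert j E) q"
        proof (rule koszul_acyclic_insert[OF insert.hyps(2) _ q])
          show "koszul_acyclic (tvar :: 'n \<Rightarrow> ('n, 'k) poly_ring) E q" using insert.IH sp q by blast
          show "koszul_acyclic (tvar :: 'n \<Rightarrow> ('n, 'k) poly_ring) E (q - 1) \<and> q \<ge> 2 \<or>
            (\<forall>x g. (tvar j :: ('n, 'k) poly_ring) * x = (\<Sum>l\<in>E. tvar l * g l) \<longrightarrow> (\<exists>g'. x = (\<Sum>l\<in>E. tvar l * g' l))) \<and> q = 1"
            using insert.IH sp q reg by (cases "q = 1") auto
        qed
      qed
    qed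
  qed
  have "koszul_acyclic (tvar :: 'n \<Rightarrow> ('n, 'k) poly_ring) (insert spare (UNIV - {spare})) q"
    by (rule koszul_acyclic_insert) (use assms E[of "UNIV - {spare}"] in auto)
  then show ?thesis by (simp add: insert_absorb)
qed

interpretation tvar: cube_complex "tvar :: 'n::finite \<Rightarrow> ('n, 'k::field) poly_ring" p for p
  by standard (rule sum_tvar)

lemma local_cube_complex_tvar:
  "local_cube_complex (tvar :: 'n::finite \<Rightarrow> ('n, 'k::field) poly_ring) (\<lambda>j b. True)"
proof
  fix q and c :: "'n set \<Rightarrow> ('n, 'k) poly_ring"
  assume q: "q \<ge> 2" and c: "\<And>Z. card Z \<noteq> q \<Longrightarrow> c Z = 0"
    and bd: "\<And>Z. (\<Sum>j\<in>-Z. sg j Z * tvar j * c (insert j Z)) = 0"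
  have "supp_card UNIV q c" using c by (auto simp: supp_card_def)
  moreover have "koszul_bd tvar c = (\<lambda>Z. 0)" using bd by (simp add: koszul_bd_def fun_eq_iff)
  ultimately obtain b where b: "supp_card UNIV (Suc q) b" "koszul_bd tvar b = c"
    using koszul_acyclic_tvar[OF q] unfolding koszul_acyclic_def by blast
  then show "\<exists>b. (\<forall>Z. card Z \<noteq> Suc q \<longrightarrow> b Z = 0) \<and> (\<forall>Z. c Z = (\<Sum>j\<in>-Z. sg j Z * tvar j * b (insert j Z)))"
    by (intro exI[of _ b]) (auto simp: supp_card_def koszul_bd_def)
qed simp

section \<open>Normal forms of paths\<close>

definition vword :: "int ^ 'n \<Rightarrow> 'n::finite arrow list \<Rightarrow> ('n, 'k::field) valg" where
  "vword x ws = of_path (word x ws)"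

lemma of_path_zero [simp]: "of_path 0 = 0"
  by (simp add: zero_valg_def)

lemma of_path_sum: "of_path (\<Sum>i\<in>A. f i) = (\<Sum>i\<in>A. of_path (f i))"
  by (induction A rule: infinite_finite_induct) (simp_all flip: plus_valg.abs_eq)

lemma vword_mult:
  "vword x ws * vword y vs = (if foldl step x ws = y then vword x (ws @ vs) else 0)"
  by (simp add: vword_def times_valg.abs_eq path_mult_single target_def)

lemma videm_eq_vword: "videm x = vword x []"
  by (simp add: videm_def vword_def)

lemma of_path_single: "of_path (Poly_Mapping.single (x, ws) c) = vscale c (vword x ws)"
  by (simp add: vword_def vscale.abs_eq)

lemma valg_induct [case_names zero vword add]:
  assumes "P 0" "\<And>c x ws. P (vscale c (vword x ws))" "\<And>u v. P u \<Longrightarrow> P v \<Longrightarrow> P (u + v)"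
  shows "P (v :: ('n::finite, 'k::field) valg)"
proof (induction v rule: valg.abs_induct)
  case (1 u)
  show ?case
  proof (induction u rule: single_induct)
    case (single p a)
    show ?case using assms(2)[of a "fst p" "snd p"] by (simp flip: of_path_single)
  qed (use assms in \<open>auto simp flip: plus_valg.abs_eq\<close>)
qed

lemma vscale_mult_left: "vscale c u * v = vscale c (u * v)"
  by transfer (simp add: path_mult_scale rel_equiv_def rel_ideal.intros)

lemma vscale_mult_right: "u * vscale c v = vscale c (u * v)"
  by transfer (simp add: path_mult_scale rel_equiv_def rel_ideal.intros)

lemma of_path_eqI: "u - v \<in> rel_ideal \<Longrightarrow> of_path u = of_path v"
  by (simp add: valg.abs_eq_iff rel_equiv_def)

text \<open>The first three families of relators make any two consecutive arrows commute; opposite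
  arrows of equal index fall under the third.\<close>

lemma vword_swap2: "(vword x [a, b] :: ('n::finite, 'k::field) valg) = vword x [b, a]"
proof -
  have *: "vword x [c, d] = (vword x [d, c] :: ('n, 'k) valg)"
    if "word x [c, d] - word x [d, c] \<in> (relators :: ('n path \<Rightarrow>\<^sub>0 'k) set)" for c d
    unfolding vword_def by (rule of_path_eqI, rule rel_ideal.intros(1), rule that)
  show ?thesis
  proof (cases a)
    case (Up i)
    show ?thesis
    proof (cases b)
      case (Up j)
      then show ?thesis using \<open>a = Up i\<close> *[of "Up i" "Up j"] relators.intros(1)[of i j x] by (cases "i = j") auto
    next
      case (Down j)
      then show ?thesis using \<open>a = Up i\<close> *[of "Up i" "Down j"] relators.intros(3)[of x i j] by auto
    qed
  next
    case (Down i)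
    show ?thesis
    proof (cases b)
      case (Up j)
      show ?thesis unfolding \<open>a = Down i\<close> \<open>b = Up j\<close>
        by (rule *[symmetric]) (rule relators.intros(3))
    next
      case (Down j)
      then show ?thesis using \<open>a = Down i\<close> *[of "Down i" "Down j"] relators.intros(2)[of i j x] by (cases "i = j") auto
    qed
  qed
qed

lemma step_commute: "step (step x a) b = step (step x b) a"
  by (cases a; cases b) (simp_all add: algebra_simps)

lemma vword_append: "vword x (ws @ vs) = vword x ws * vword (foldl step x ws) vs"
  by (simp add: vword_mult)

lemma vword_swap: "vword x (a # b # ws) = (vword x (b # a # ws) :: ('n::finite, 'k::field) valg)"
proof -
  have "vword x (a # b # ws) = (vword x [a, b] * vword (step (step x a) b) ws :: ('n, 'k) valg)"
    using vword_append[of x "[a, b]" ws] by simp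
  also have "\<dots> = vword x [b, a] * vword (step (step x b) a) ws"
    by (simp add: vword_swap2[of x a b] step_commute[of x a b])
  also have "\<dots> = vword x (b # a # ws)"
    by (simp add: vword_append[of x "[b, a]" ws, simplified])
  finally show ?thesis .
qed

lemma vword_Cons: "vword x (a # ws) = vword x [a] * vword (step x a) ws"
  using vword_append[of x "[a]" ws] by simp

lemma vword_move: "vword x (a # us @ vs) = (vword x (us @ a # vs) :: ('n::finite, 'k::field) valg)"
proof (induction us arbitrary: x)
  case (Cons b us)
  have "vword x (a # (b # us) @ vs) = (vword x (b # a # us @ vs) :: ('n, 'k) valg)" by (simp add: vword_swap)
  also have "\<dots> = vword x [b] * vword (step x b) (us @ a # vs)"
    by (subst vword_Cons) (simp only: Cons.IH)
  also have "\<dots> = vword x (b # us @ a # vs)" by (rule vword_Cons[symmetric])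
  finally show ?case by simp
qed simp

lemma vword_mset: "mset ws = mset ws' \<Longrightarrow> vword x ws = (vword x ws' :: ('n::finite, 'k::field) valg)"
proof (induction ws arbitrary: ws' x)
  case (Cons a ws)
  have "a \<in> set ws'" using Cons.prems by (metis list.set_intros(1) set_mset_mset)
  then obtain us vs where ws': "ws' = us @ a # vs" by (metis split_list)
  then have "mset ws = mset (us @ vs)" using Cons.prems by simp
  from Cons.IH[OF this] have "vword x (a # ws) = (vword x (a # us @ vs) :: ('n, 'k) valg)"
    by (subst (1 2) vword_Cons) simp
  then show ?case by (simp add: ws' vword_move)
qed simp

lemma sum_vword_loops: "(\<Sum>j\<in>UNIV. vword x (Down j # Up j # ws)) = (0 :: ('n::finite, 'k::field) valg)"
proof -
  have "(\<Sum>j\<in>UNIV. vword x [Down j, Up j]) = (0 :: ('n, 'k) valg)"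
  proof -
    have "(\<Sum>i\<in>UNIV. word x [Down i, Up i]) - 0 \<in> (rel_ideal :: ('n path \<Rightarrow>\<^sub>0 'k) set)"
      by (simp add: rel_ideal.intros(1) relators.intros(4))
    from of_path_eqI[OF this] show ?thesis by (simp add: of_path_sum vword_def)
  qed
  moreover have "vword x (Down j # Up j # ws) = (vword x [Down j, Up j] * vword x ws :: ('n, 'k) valg)" for j
    using vword_append[of x "[Down j, Up j]" ws] by simp
  ultimately show ?thesis by (simp flip: sum_distrib_right)
qed

section \<open>Coordinates of paths relative to shortest paths\<close>

lemma foldl_step_nth:
  "foldl step x ws $ i = x $ i + int (count (mset ws) (Up i)) - int (count (mset ws) (Down i))"
proof (induction ws arbitrary: x)
  case (Cons a ws)
  have "step x a $ i = x $ i + (if a = Up i then 1 else 0) - (if a = Down i then 1 else 0)"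
    by (cases a) (auto simp: axis_def)
  then show ?case by (simp add: Cons.IH)
qed simp

text \<open>\<open>h\<close> receives the coefficient as an argument, so that the same operator
  extends maps into polynomials and into the algebra, whose scalar multiplications differ.\<close>

definition lin_ext :: "('a \<Rightarrow> 'k::field \<Rightarrow> 'c::ab_group_add) \<Rightarrow> ('a \<Rightarrow>\<^sub>0 'k) \<Rightarrow> 'c" where
  "lin_ext h u = (\<Sum>p\<in>Poly_Mapping.keys u. h p (Poly_Mapping.lookup u p))"

lemma lin_ext_zero [simp]: "lin_ext h 0 = 0"
  by (simp add: lin_ext_def)

lemma lin_ext_add:
  assumes h: "\<And>p a b. h p (a + b) = h p a + h p b"
  shows "lin_ext h (u + v) = lin_ext h u + lin_ext h v"
proof -
  have h0: "h p 0 = 0" for p using h[of p 0 0] by simp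
  let ?A = "Poly_Mapping.keys u \<union> Poly_Mapping.keys v"
  have sup: "lin_ext h w = (\<Sum>p\<in>?A. h p (Poly_Mapping.lookup w p))" if "Poly_Mapping.keys w \<subseteq> ?A" for w
    unfolding lin_ext_def by (rule sum.mono_neutral_left) (use that in \<open>auto simp: in_keys_iff h0\<close>)
  show ?thesis
    by (simp add: sup keys_add lookup_add h sum.distrib)
qed

lemma lin_ext_single:
  assumes "h p 0 = 0"
  shows "lin_ext h (Poly_Mapping.single p a) = h p a"
  using assms by (cases "a = 0") (simp_all add: lin_ext_def)

text \<open>Every path from \<open>y\<close> to \<open>z\<close> equals a shortest one times loops; \<open>loops_mon\<close> records the loops.\<close>

definition loops_mon :: "'n::finite arrow multiset \<Rightarrow> ('n, 'k::field) poly_ring" where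
  "loops_mon M = (\<Prod>j\<in>UNIV. tvar j ^ min (count M (Up j)) (count M (Down j)))"

lemma loops_mon_add_loop: "loops_mon (add_mset (Down i) (add_mset (Up i) M)) = tvar i * loops_mon M"
proof -
  have "loops_mon (add_mset (Down i) (add_mset (Up i) M))
      = (\<Prod>j\<in>UNIV. (if j = i then tvar i else 1) * tvar j ^ min (count M (Up j)) (count M (Down j)))"
    unfolding loops_mon_def by (rule prod.cong) auto
  then show ?thesis by (simp add: prod.distrib loops_mon_def)
qed

definition coeff_const :: "'k::field \<Rightarrow> ('n, 'k) poly_ring" where
  "coeff_const c = Poly_Mapping.single 0 c"

lemma coeff_const_simps [simp]:
  "coeff_const 0 = 0" "coeff_const 1 = 1" "coeff_const (a + b) = coeff_const a + coeff_const b"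
  "coeff_const (a * b) = coeff_const a * coeff_const b" "coeff_const (- a) = - coeff_const a"
  by (simp_all add: coeff_const_def single_add mult_single single_uminus)

text \<open>The number of loops is not additive under composition. The extra arrows \<open>M\<close>
  record the context in which a path is multiplied, which makes vanishing on the ideal an induction
  over its generation.\<close>

definition psi_pre :: "int ^ 'n \<Rightarrow> int ^ 'n \<Rightarrow> 'n arrow multiset \<Rightarrow> ('n::finite path \<Rightarrow>\<^sub>0 'k::field) \<Rightarrow> ('n, 'k) poly_ring" where
  "psi_pre y z M = lin_ext (\<lambda>p a. if fst p = y \<and> target p = z then coeff_const a * loops_mon (mset (snd p) + M) else 0)"

lemma psi_pre_zero [simp]: "psi_pre y z M 0 = 0"
  by (simp add: psi_pre_def)

lemma psi_pre_add: "psi_pre y z M (u + v) = psi_pre y z M u + psi_pre y z M v"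
  unfolding psi_pre_def by (rule lin_ext_add) (auto simp: algebra_simps)

lemma psi_pre_single:
  "psi_pre y z M (Poly_Mapping.single p a) = (if fst p = y \<and> target p = z then coeff_const a * loops_mon (mset (snd p) + M) else 0)"
  unfolding psi_pre_def by (rule lin_ext_single) auto

lemma psi_pre_uminus: "psi_pre y z M (- u) = - psi_pre y z M u"
  using psi_pre_add[of y z M u "- u"] by (simp add: eq_neg_iff_add_eq_0 add.commute)

lemma psi_pre_diff: "psi_pre y z M (u - v) = psi_pre y z M u - psi_pre y z M v"
  using psi_pre_add[of y z M u "- v"] by (simp add: psi_pre_uminus)

lemma psi_pre_sum: "psi_pre y z M (\<Sum>i\<in>A. f i) = (\<Sum>i\<in>A. psi_pre y z M (f i))"
  by (induction A rule: infinite_finite_induct) (simp_all add: psi_pre_add)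

lemma psi_pre_scale: "psi_pre y z M (path_scale c u) = coeff_const c * psi_pre y z M u"
proof (induction u rule: single_induct)
  case zero
  have "path_scale c (0 :: 'a path \<Rightarrow>\<^sub>0 'b) = 0" by (rule poly_mapping_eqI) simp
  then show ?case by simp
qed (simp_all add: psi_pre_single psi_pre_add path_scale_add algebra_simps)

lemma psi_pre_mult_single_left:
  "psi_pre y z M (path_mult (Poly_Mapping.single q a) u) =
     (if fst q = y then coeff_const a * psi_pre (target q) z (mset (snd q) + M) u else 0)"
proof (induction u rule: single_induct)
  case (single p b)
  then show ?case by (auto simp: path_mult_single psi_pre_single target_def algebra_simps)
qed (simp_all add: path_mult_add_right psi_pre_add algebra_simps)

lemma psi_pre_mult_single_right:
  "psi_pre y z M (path_mult u (Poly_Mapping.single q a)) =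
     (if target q = z then coeff_const a * psi_pre y (fst q) (mset (snd q) + M) u else 0)"
proof (induction u rule: single_induct)
  case (single p b)
  then show ?case by (auto simp: path_mult_single psi_pre_single target_def algebra_simps)
qed (simp_all add: path_mult_add_left psi_pre_add algebra_simps)

text \<open>Both terms of a commutation relator have the same arrows and endpoints; the last relator
  yields the sum of the \<open>tvar i\<close> times a common factor.\<close>

lemma psi_pre_relators: "u \<in> relators \<Longrightarrow> psi_pre y z M u = (0 :: ('n::finite, 'k::field) poly_ring)"
proof (induction u rule: relators.induct)
  case (4 x)
  have "psi_pre y z M (word x [Down i, Up i]) = (if x = y \<and> x = z then tvar i * loops_mon M else 0 :: ('n, 'k) poly_ring)" for i
    by (auto simp: psi_pre_single target_def loops_mon_add_loop)
  then have "(\<Sum>i\<in>UNIV. psi_pre y z M (word x [Down i, Up i])) =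
      (if x = y \<and> x = z then (\<Sum>i\<in>UNIV. tvar i * loops_mon M) else 0 :: ('n, 'k) poly_ring)"
    by (cases "x = y \<and> x = z") auto
  also have "\<dots> = 0" by (simp add: sum_tvar flip: sum_distrib_right)
  finally show ?case by (simp add: psi_pre_sum)
qed (auto simp: psi_pre_diff psi_pre_single target_def algebra_simps add_mset_commute)

lemma psi_pre_rel_ideal: "u \<in> rel_ideal \<Longrightarrow> psi_pre y z M u = 0"
proof (induction u arbitrary: y z M rule: rel_ideal.induct)
  case (5 u v)
  show ?case
    by (induction v rule: single_induct) (simp_all add: path_mult_add_left psi_pre_add psi_pre_mult_single_left 5)
next
  case (6 u v)
  show ?case
    by (induction v rule: single_induct) (simp_all add: path_mult_add_right psi_pre_add psi_pre_mult_single_right 6)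
qed (simp_all add: psi_pre_relators psi_pre_add psi_pre_scale)

lift_definition psi :: "int ^ 'n \<Rightarrow> int ^ 'n \<Rightarrow> ('n::finite, 'k::field) valg \<Rightarrow> ('n, 'k) poly_ring" is
  "\<lambda>y z. psi_pre y z {#}"
proof -
  fix y z :: "int ^ 'n" and u v :: "'n path \<Rightarrow>\<^sub>0 'k"
  assume "rel_equiv u v"
  then have "psi_pre y z {#} (u - v) = 0" unfolding rel_equiv_def by (rule psi_pre_rel_ideal)
  then show "psi_pre y z {#} u = psi_pre y z {#} v" by (simp add: psi_pre_diff)
qed

lemma psi_add: "psi y z (u + v) = psi y z u + psi y z v"
  by transfer (rule psi_pre_add)

lemma psi_zero [simp]: "psi y z 0 = 0"
  using psi_add[of y z 0 0] by simp

lemma psi_sum: "psi y z (\<Sum>i\<in>A. f i) = (\<Sum>i\<in>A. psi y z (f i))"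
  by (induction A rule: infinite_finite_induct) (simp_all add: psi_add)

lemma psi_vscale: "psi y z (vscale c v) = coeff_const c * psi y z v"
  by transfer (rule psi_pre_scale)

lemma psi_vword: "psi y z (vword x ws) = (if x = y \<and> foldl step x ws = z then loops_mon (mset ws) else 0)"
  by (auto simp: vword_def psi.abs_eq psi_pre_single target_def)

definition vmset :: "int ^ 'n \<Rightarrow> 'n::finite arrow multiset \<Rightarrow> ('n, 'k::field) valg" where
  "vmset y M = vword y (SOME ws. mset ws = M)"

lemma vmset_mset: "vmset y (mset ws) = vword y ws"
  unfolding vmset_def by (rule vword_mset) (rule someI[of _ ws], rule refl)

text \<open>The arrows of a shortest path from \<open>y\<close> to \<open>z\<close> together with the loops of the monomial \<open>m\<close>.\<close>

definition path_mset :: "int ^ 'n \<Rightarrow> int ^ 'n \<Rightarrow> ('n \<Rightarrow>\<^sub>0 nat) \<Rightarrow> 'n::finite arrow multiset" where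
  "path_mset y z m = (\<Sum>j\<in>UNIV. replicate_mset (Poly_Mapping.lookup m j + nat (z $ j - y $ j)) (Up j)
      + replicate_mset (Poly_Mapping.lookup m j + nat (y $ j - z $ j)) (Down j))"

lemma count_path_mset [simp]:
  "count (path_mset y z m) (Up j) = Poly_Mapping.lookup m j + nat (z $ j - y $ j)"
  "count (path_mset y z m) (Down j) = Poly_Mapping.lookup m j + nat (y $ j - z $ j)"
proof -
  have [simp]: "(Up i = Up j) = (i = j)" "(Down i = Down j) = (i = j)" for i j :: 'a by auto
  show "count (path_mset y z m) (Up j) = Poly_Mapping.lookup m j + nat (z $ j - y $ j)"
    unfolding path_mset_def count_sum by (simp add: if_distrib[of "\<lambda>b. b + _"] cong: if_cong)
  show "count (path_mset y z m) (Down j) = Poly_Mapping.lookup m j + nat (y $ j - z $ j)"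
    unfolding path_mset_def count_sum by (simp cong: if_cong)
qed

lemma arrow_multiset_eqI:
  assumes "\<And>j. count M (Up j) = count M' (Up j)" "\<And>j. count M (Down j) = count M' (Down j)"
  shows "M = M'"
proof (rule multiset_eqI)
  fix a show "count M a = count M' a" using assms by (cases a) auto
qed

lemma foldl_step_path_mset:
  assumes "mset ws = path_mset y z m"
  shows "foldl step y ws = z"
  by (simp add: vec_eq_iff foldl_step_nth assms)

lemma vmset_mult:
  assumes "M = path_mset y z m"
  shows "vmset y M * vword z [a] = vmset y (add_mset a M)"
proof -
  obtain ws where ws: "mset ws = M" by (metis ex_mset)
  have "foldl step y ws = z" using foldl_step_path_mset ws assms by metis
  then have "vword y ws * vword z [a] = vword y (ws @ [a])" by (simp add: vword_mult)
  moreover have "mset (ws @ [a]) = add_mset a M" by (simp add: ws)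
  ultimately show ?thesis by (metis vmset_mset ws)
qed

lemma vmset_add_loop: "vmset y (add_mset (Down j) (add_mset (Up j) (mset ws))) = vword y (Down j # Up j # ws)"
  by (metis vmset_mset mset.simps(2))

definition eta :: "int ^ 'n \<Rightarrow> int ^ 'n \<Rightarrow> ('n::finite, 'k::field) poly_ring \<Rightarrow> ('n, 'k) valg" where
  "eta y z = lin_ext (\<lambda>m a. vscale a (vmset y (path_mset y z m)))"

lemma eta_add: "eta y z (s + s') = eta y z s + eta y z s'"
  unfolding eta_def by (rule lin_ext_add) (simp add: valg.scale_left_distrib)

lemma eta_zero [simp]: "eta y z 0 = 0"
  by (simp add: eta_def)

lemma eta_single: "eta y z (Poly_Mapping.single m a) = vscale a (vmset y (path_mset y z m))"
  unfolding eta_def by (rule lin_ext_single) simp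

lemma eta_uminus: "eta y z (- s) = - eta y z s"
  using eta_add[of y z s "- s"] by (simp add: eq_neg_iff_add_eq_0 add.commute)

lemma eta_sum: "eta y z (\<Sum>i\<in>A. f i) = (\<Sum>i\<in>A. eta y z (f i))"
  by (induction A rule: infinite_finite_induct) (simp_all add: eta_add)

lemma eta_const: "eta y z (coeff_const c * s) = vscale c (eta y z s)"
  by (induction s rule: single_induct)
     (simp_all add: eta_single eta_add coeff_const_def mult_single distrib_left valg.scale_right_distrib)

lemma path_mset_add_single:
  "path_mset y z (m + Poly_Mapping.single j 1) = add_mset (Down j) (add_mset (Up j) (path_mset y z m))"
  by (rule arrow_multiset_eqI) (auto simp: lookup_add lookup_single when_def)

lemma sum_eta_pvar: "(\<Sum>j\<in>UNIV. eta y z (pvar j * s)) = 0"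
proof (induction s rule: single_induct)
  case (single m a)
  obtain ws where ws: "mset ws = path_mset y z m" by (metis ex_mset)
  have "(\<Sum>j\<in>UNIV. eta y z (pvar j * Poly_Mapping.single m a)) = (\<Sum>j\<in>UNIV. vscale a (vword y (Down j # Up j # ws)))"
    by (simp only: pvar_times_single eta_single path_mset_add_single flip: ws) (simp only: vmset_add_loop)
  also have "\<dots> = 0" by (simp add: sum_vword_loops flip: valg.scale_sum_right)
  finally show ?case .
qed (simp_all add: distrib_left eta_add sum.distrib)

text \<open>The difference between \<open>pvar spare\<close> and \<open>tvar spare\<close> is the
  sum of all variables, whose multiples \<open>eta\<close> kills.\<close>

lemma eta_tvar: "eta y z (tvar j * s) = eta y z (pvar j * s)"
proof (cases "j = spare")
  case True
  have "eta y z (pvar spare * s) + (\<Sum>l\<in>UNIV - {spare}. eta y z (pvar l * s)) = 0"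
    using sum_eta_pvar[of y z s] by (simp add: sum.remove)
  then show ?thesis
    using True by (simp add: tvar_def sum_distrib_right eta_uminus eta_sum neg_eq_iff_add_eq_0 add.commute)
qed (simp add: tvar_def)

lemma eta_tvar_power: "eta y z (tvar j ^ k * s) = eta y z (pvar j ^ k * s)"
proof (induction k arbitrary: s)
  case (Suc k)
  have "eta y z (tvar j ^ Suc k * s) = eta y z (pvar j * (tvar j ^ k * s))"
    by (simp add: mult.assoc eta_tvar)
  also have "\<dots> = eta y z (tvar j ^ k * (pvar j * s))" by (simp only: mult_ac)
  also have "\<dots> = eta y z (pvar j ^ k * (pvar j * s))" by (rule Suc.IH)
  finally show ?case by (simp add: mult_ac)
qed simp

lemma eta_prod_tvar:
  "eta y z ((\<Prod>j\<in>A. tvar j ^ c j) * s) = eta y z ((\<Prod>j\<in>A. pvar j ^ c j) * s)"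
proof (induction A arbitrary: s rule: infinite_finite_induct)
  case (insert j A)
  have "eta y z ((\<Prod>j\<in>insert j A. tvar j ^ c j) * s) = eta y z (tvar j ^ c j * ((\<Prod>j\<in>A. tvar j ^ c j) * s))"
    using insert.hyps by (simp add: mult.assoc)
  also have "\<dots> = eta y z ((\<Prod>j\<in>A. tvar j ^ c j) * (pvar j ^ c j * s))"
    by (simp add: eta_tvar_power mult.left_commute)
  also have "\<dots> = eta y z ((\<Prod>j\<in>A. pvar j ^ c j) * (pvar j ^ c j * s))" by (rule insert.IH)
  also have "\<dots> = eta y z ((\<Prod>j\<in>insert j A. pvar j ^ c j) * s)"
    using insert.hyps by (simp add: mult_ac)
  finally show ?case .
qed simp_all

lemma pvar_power: "pvar j ^ k = Poly_Mapping.single (Poly_Mapping.single j k) 1"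
  by (induction k) (simp_all add: pvar_def mult_single flip: single_add)

lemma prod_pvar: "(\<Prod>j\<in>A. pvar j ^ c j) = Poly_Mapping.single (\<Sum>j\<in>A. Poly_Mapping.single j (c j)) 1"
  by (induction A rule: infinite_finite_induct) (simp_all add: pvar_power mult_single)

lemma lookup_sum_single: "Poly_Mapping.lookup (\<Sum>j\<in>UNIV. Poly_Mapping.single j (c j)) i = (c i :: nat)" for i :: "'n::finite"
  by (simp add: lookup_sum lookup_single when_def)

lemma eta_loops_mon:
  assumes "foldl step y ws = z"
  shows "eta y z (loops_mon (mset ws)) = vword y ws"
proof -
  let ?c = "\<lambda>j. min (count (mset ws) (Up j)) (count (mset ws) (Down j))"
  have "eta y z (loops_mon (mset ws)) = eta y z (Poly_Mapping.single (\<Sum>j\<in>UNIV. Poly_Mapping.single j (?c j)) 1)"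
    using eta_prod_tvar[where A = UNIV and c = ?c and s = 1] by (simp add: loops_mon_def prod_pvar)
  also have "\<dots> = vmset y (path_mset y z (\<Sum>j\<in>UNIV. Poly_Mapping.single j (?c j)))"
    by (simp add: eta_single)
  also have "path_mset y z (\<Sum>j\<in>UNIV. Poly_Mapping.single j (?c j)) = mset ws"
    by (rule arrow_multiset_eqI) (auto simp: lookup_sum_single foldl_step_nth simp flip: assms)
  finally show ?thesis by (simp add: vmset_mset)
qed

text \<open>On a word, the shortest path and the recorded loops together use the same arrows as the
  word itself. Consequently the coordinates \<open>psi\<close> determine an element between two
  idempotents.\<close>

lemma eta_psi: "eta y z (psi y z v) = videm y * v * videm z"
  by (induction v rule: valg_induct)
     (auto simp: psi_add eta_add psi_vscale eta_const psi_vword eta_loops_mon videm_eq_vword vword_mult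
        vscale_mult_left vscale_mult_right algebra_simps)

text \<open>An arrow leading from \<open>z\<close> back towards \<open>y\<close> closes a loop with
  an arrow of the shortest path; any other arrow makes that path longer.\<close>

definition step_coeff :: "int ^ 'n \<Rightarrow> int ^ 'n \<Rightarrow> 'n::finite arrow \<Rightarrow> ('n, 'k::field) poly_ring" where
  "step_coeff y z a = (case a of Up j \<Rightarrow> if z $ j < y $ j then tvar j else 1
                               | Down j \<Rightarrow> if z $ j > y $ j then tvar j else 1)"

lemma loops_mon_add_mset:
  assumes "\<And>j. z $ j = y $ j + int (count M (Up j)) - int (count M (Down j))"
  shows "loops_mon (add_mset a M) = step_coeff y z a * loops_mon M"
proof -
  define j where "j = (case a of Up j \<Rightarrow> j | Down j \<Rightarrow> j)"
  have "loops_mon (add_mset a M)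
      = (\<Prod>l\<in>UNIV. (if l = j then step_coeff y z a else 1) * tvar l ^ min (count M (Up l)) (count M (Down l)))"
    unfolding loops_mon_def
  proof (rule prod.cong)
    fix l
    show "tvar l ^ min (count (add_mset a M) (Up l)) (count (add_mset a M) (Down l)) =
       (if l = j then step_coeff y z a else 1) * tvar l ^ min (count M (Up l)) (count M (Down l))"
      using assms[of l] by (cases a) (auto simp: j_def step_coeff_def min_def le_Suc_eq)
  qed simp
  then show ?thesis by (simp add: prod.distrib loops_mon_def)
qed

lemma psi_mult_arrow: "psi y (step z a) (v * vword z [a]) = (step_coeff y z a * psi y z v :: ('n::finite, 'k::field) poly_ring)"
proof (induction v rule: valg_induct)
  case (vword c x ws)
  show ?case
  proof (cases "x = y \<and> foldl step x ws = z")
    case True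
    then have "z $ j = y $ j + int (count (mset ws) (Up j)) - int (count (mset ws) (Down j))" for j
      using foldl_step_nth[of x ws j] by auto
    then have "loops_mon (add_mset a (mset ws)) = (step_coeff y z a * loops_mon (mset ws) :: ('n, 'k) poly_ring)"
      by (rule loops_mon_add_mset)
    then show ?thesis using True
      by (simp add: vscale_mult_left vword_mult psi_vscale psi_vword mult_ac)
  next
    case False
    then show ?thesis by (auto simp: vscale_mult_left vword_mult psi_vscale psi_vword)
  qed
qed (simp_all add: psi_add distrib_left distrib_right)

lemma eta_mult_arrow: "eta y z s * vword z [a] = eta y (step z a) (step_coeff y z a * s)"
proof (induction s rule: single_induct)
  case (single m c)
  have L: "eta y z (Poly_Mapping.single m c) * vword z [a] = vscale c (vmset y (add_mset a (path_mset y z m)))"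
    by (simp add: eta_single vscale_mult_left vmset_mult)
  have st: "step z a $ i = z $ i + (if a = Up i then 1 else 0) - (if a = Down i then 1 else 0)" for i
    by (cases a) (auto simp: axis_def)
  show ?case
  proof (cases "step_coeff y z a = (1 :: ('a, 'b) poly_ring)")
    case True
    show ?thesis
    proof (cases "\<exists>j. (a = Up j \<and> z $ j < y $ j) \<or> (a = Down j \<and> z $ j > y $ j)")
      case False
      have "add_mset a (path_mset y z m) = path_mset y (step z a) m"
        by (rule arrow_multiset_eqI) (use False in \<open>auto simp: st\<close>)
      then show ?thesis unfolding L True by (simp add: eta_single)
    next
      \<comment> \<open>A loop with \<open>tvar j = 1\<close> is treated like any other loop instead
        of being ruled out.\<close>
      case c: True
      then obtain j where j: "step_coeff y z a = (tvar j :: ('a, 'b) poly_ring)"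
          "(a = Up j \<and> z $ j < y $ j) \<or> (a = Down j \<and> z $ j > y $ j)"
        by (auto simp: step_coeff_def)
      have "add_mset a (path_mset y z m) = path_mset y (step z a) (m + Poly_Mapping.single j 1)"
        by (rule arrow_multiset_eqI) (use j(2) in \<open>auto simp: st lookup_add lookup_single when_def\<close>)
      then show ?thesis unfolding L j(1) eta_tvar pvar_times_single by (simp add: eta_single)
    qed
  next
    case False
    then obtain j where j: "step_coeff y z a = (tvar j :: ('a, 'b) poly_ring)"
        "(a = Up j \<and> z $ j < y $ j) \<or> (a = Down j \<and> z $ j > y $ j)"
      by (auto simp: step_coeff_def split: arrow.splits if_splits)
    have "add_mset a (path_mset y z m) = path_mset y (step z a) (m + Poly_Mapping.single j 1)"
      by (rule arrow_multiset_eqI) (use j(2) in \<open>auto simp: st lookup_add lookup_single when_def\<close>)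
    then show ?thesis unfolding L j(1) eta_tvar pvar_times_single by (simp add: eta_single)
  qed
qed (simp_all add: eta_add distrib_left distrib_right)

lemma eta_idem: "videm y * eta y z s * videm z = eta y z s"
proof (induction s rule: single_induct)
  case (single m c)
  obtain ws where ws: "mset ws = path_mset y z m" by (metis ex_mset)
  have "vmset y (path_mset y z m) = (vword y ws :: ('a, 'b) valg)" by (metis vmset_mset ws)
  then show ?case using foldl_step_path_mset[OF ws]
    by (simp add: eta_single videm_eq_vword vscale_mult_left vscale_mult_right vword_mult)
qed (simp_all add: eta_add distrib_left distrib_right)

section \<open>Functions on the cube modulo split ones\<close>

text \<open>Gaussian elimination, carrying along the dual functionals \<open>g\<close> of the chosen
  columns.\<close>

lemma column_basis:
  fixes L :: "'i \<Rightarrow> 'q::finite \<Rightarrow> 'k::field"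
  assumes "finite I"
  shows "\<exists>J\<subseteq>I. \<exists>g :: 'i \<Rightarrow> 'q \<Rightarrow> 'k.
     (\<forall>i\<in>I. \<forall>q. L i q = (\<Sum>j\<in>J. (\<Sum>q'\<in>UNIV. g j q' * L i q') * L j q)) \<and>
     (\<forall>j\<in>J. \<forall>i\<in>J. (\<Sum>q\<in>UNIV. g j q * L i q) = (if i = j then 1 else 0))"
  using assms
proof (induction I rule: finite_induct)
  case empty
  then show ?case by auto
next
  case (insert i I)
  then obtain J g where J: "J \<subseteq> I"
    and rep: "\<And>i q. i \<in> I \<Longrightarrow> L i q = (\<Sum>j\<in>J. (\<Sum>q'\<in>UNIV. g j q' * L i q') * L j q)"
    and dual: "\<And>i j. j \<in> J \<Longrightarrow> i \<in> J \<Longrightarrow> (\<Sum>q\<in>UNIV. g j q * L i q) = (if i = j then 1 else 0)"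
    by blast
  have finJ: "finite J" using J insert.hyps finite_subset by blast
  have iJ: "i \<notin> J" using J insert.hyps by auto
  define a where "a j = (\<Sum>q\<in>UNIV. g j q * L i q)" for j
  define res where "res q = L i q - (\<Sum>j\<in>J. a j * L j q)" for q
  show ?case
  proof (cases "\<forall>q. res q = 0")
    case True
    have new: "L i q = (\<Sum>j\<in>J. (\<Sum>q'\<in>UNIV. g j q' * L i q') * L j q)" for q
      using True[rule_format, of q] unfolding res_def a_def by (rule eq_iff_diff_eq_0[THEN iffD2])
    have "L l q = (\<Sum>j\<in>J. (\<Sum>q'\<in>UNIV. g j q' * L l q') * L j q)" if "l \<in> insert i I" for l q
    proof (cases "l = i")
      case True
      show ?thesis unfolding True by (rule new)
    next
      case False
      then show ?thesis using that by (intro rep) simp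
    qed
    moreover have "J \<subseteq> insert i I" using J by auto
    ultimately show ?thesis using dual by blast
  next
    case False
    then obtain q0 where q0: "res q0 \<noteq> 0" by blast
    \<comment> \<open>The \<open>q0\<close>-coordinate of the residue modulo the old columns,
      normalised to be 1 on the new one; the old functionals are then corrected to vanish on the new
      column.\<close>
    define gi where "gi q = ((if q = q0 then 1 else 0) - (\<Sum>j\<in>J. L j q0 * g j q)) / res q0" for q
    define g' where "g' j q = (if j = i then gi q else g j q - a j * gi q)" for j q
    have pair_gi: "(\<Sum>q\<in>UNIV. gi q * L l q) = (L l q0 - (\<Sum>j\<in>J. L j q0 * (\<Sum>q\<in>UNIV. g j q * L l q))) / res q0" for l
    proof -
      have "(\<Sum>q\<in>UNIV. gi q * L l q)
          = (\<Sum>q\<in>UNIV. ((if q = q0 then L l q else 0) - (\<Sum>j\<in>J. L j q0 * g j q * L l q)) / res q0)"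
        unfolding gi_def by (rule sum.cong) (auto simp: algebra_simps sum_distrib_left diff_divide_distrib)
      also have "\<dots> = (L l q0 - (\<Sum>q\<in>UNIV. \<Sum>j\<in>J. L j q0 * g j q * L l q)) / res q0"
        by (simp add: sum_subtractf flip: sum_divide_distrib)
      also have "(\<Sum>q\<in>UNIV. \<Sum>j\<in>J. L j q0 * g j q * L l q) = (\<Sum>j\<in>J. L j q0 * (\<Sum>q\<in>UNIV. g j q * L l q))"
        by (subst sum.swap) (simp add: sum_distrib_left mult.assoc)
      finally show ?thesis .
    qed
    have gi_J: "(\<Sum>q\<in>UNIV. gi q * L l q) = 0" if "l \<in> J" for l
    proof -
      have "(\<Sum>j\<in>J. L j q0 * (\<Sum>q\<in>UNIV. g j q * L l q)) = (\<Sum>j\<in>J. if j = l then L l q0 else 0)"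
        by (rule sum.cong) (use dual that in auto)
      then show ?thesis using that finJ by (simp add: pair_gi)
    qed
    have gi_i: "(\<Sum>q\<in>UNIV. gi q * L i q) = 1"
      using q0 by (simp add: pair_gi res_def a_def mult.commute)
    have g'_pair: "(\<Sum>q\<in>UNIV. g' j q * L l q) = (\<Sum>q\<in>UNIV. g j q * L l q) - a j * (\<Sum>q\<in>UNIV. gi q * L l q)" if "j \<in> J" for j l
    proof -
      have "g' j q = g j q - a j * gi q" for q using that iJ by (auto simp: g'_def)
      then show ?thesis by (simp add: left_diff_distrib sum_subtractf sum_distrib_left mult.assoc)
    qed
    have g'_i: "(\<Sum>q\<in>UNIV. g' i q * L l q) = (\<Sum>q\<in>UNIV. gi q * L l q)" for l
      by (simp add: g'_def)
    have dual': "(\<Sum>q\<in>UNIV. g' j q * L l q) = (if l = j then 1 else 0)" if "j \<in> insert i J" "l \<in> insert i J" for j l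
    proof (cases "j = i")
      case True
      then show ?thesis using that iJ gi_J gi_i by (auto simp: g'_i)
    next
      case False
      then have "j \<in> J" using that by simp
      then show ?thesis using that iJ gi_J gi_i dual by (auto simp: g'_pair a_def[symmetric])
    qed
    have span: "L l q = (\<Sum>j\<in>insert i J. (\<Sum>q'\<in>UNIV. g' j q' * L l q') * L j q)"
      if ex: "\<exists>c. \<forall>q. L l q = (\<Sum>j\<in>insert i J. c j * L j q)" for l q
    proof -
      obtain c where c: "\<And>q. L l q = (\<Sum>j\<in>insert i J. c j * L j q)" using ex by blast
      have "(\<Sum>q'\<in>UNIV. g' j q' * L l q') = c j" if j: "j \<in> insert i J" for j
      proof -
        have "(\<Sum>q'\<in>UNIV. g' j q' * L l q') = (\<Sum>m\<in>insert i J. c m * (\<Sum>q'\<in>UNIV. g' j q' * L m q'))"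
          unfolding c sum_distrib_left by (subst sum.swap) (simp add: algebra_simps)
        also have "\<dots> = (\<Sum>m\<in>insert i J. if m = j then c j else 0)"
          by (rule sum.cong) (use dual' j in auto)
        also have "\<dots> = c j" using j finJ by simp
        finally show ?thesis .
      qed
      then show ?thesis unfolding c[of q] by (intro sum.cong) auto
    qed
    show ?thesis
    proof (intro exI[of _ "insert i J"] conjI exI[of _ g'] ballI allI)
      fix l q assume l: "l \<in> insert i I"
      show "L l q = (\<Sum>j\<in>insert i J. (\<Sum>q'\<in>UNIV. g' j q' * L l q') * L j q)"
      proof (rule span)
        show "\<exists>c. \<forall>q. L l q = (\<Sum>j\<in>insert i J. c j * L j q)"
        proof (cases "l = i")
          case True
          have "(\<Sum>j\<in>J. (if j = i then 1 else 0) * L j q) = 0" for q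
            by (rule sum.neutral) (use iJ in auto)
          then show ?thesis using True finJ iJ
            by (intro exI[of _ "\<lambda>j. if j = i then 1 else 0"]) simp
        next
          case False
          then have "l \<in> I" using l by simp
          define d where "d j = (\<Sum>q'\<in>UNIV. g j q' * L l q')" for j
          have d: "L l q = (\<Sum>j\<in>J. d j * L j q)" for q
            unfolding d_def by (rule rep) fact
          have "(\<Sum>j\<in>J. (if j = i then 0 else d j) * L j q) = (\<Sum>j\<in>J. d j * L j q)" for q
            by (rule sum.cong) (use iJ in auto)
          then show ?thesis using finJ iJ
            by (intro exI[of _ "\<lambda>j. if j = i then 0 else d j"]) (simp add: d)
        qed
      qed
    qed (use J dual' in auto)
  qed
qed

text \<open>Moebius inversion on the subsets of \<open>W\<close>: up to sign, the alternating sums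
  at the empty set are the coefficients of \<open>G\<close> as a polynomial in indicators.\<close>

lemma sum_Pow_mobius:
  fixes G :: "'n::finite set \<Rightarrow> 'b::comm_ring_1"
  shows "(\<Sum>C\<in>Pow W. (-1) ^ card C * altsum C G {}) = G W"
proof -
  have "finite W" by simp
  then show ?thesis
  proof (induction W arbitrary: G rule: finite_induct)
    case empty
    show ?case by (simp add: altsum_def)
  next
    case (insert j W)
    have inj: "inj_on (insert j) (Pow W)" using insert.hyps by (auto simp: inj_on_def)
    let ?Gj = "\<lambda>X. G (insert j X)"
    have step: "(-1) ^ card (insert j C) * altsum (insert j C) G {} = (-1) ^ card C * altsum C ?Gj {} - (-1) ^ card C * altsum C G {}"
      if "C \<subseteq> W" for C
    proof -
      have jC: "j \<notin> C" using that insert.hyps by auto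
      have "altsum C G {j} = altsum C ?Gj {}"
        unfolding altsum_def by (rule sum.cong) (use jC in \<open>auto simp: insert_Diff_if\<close>)
      then show ?thesis using jC by (simp add: altsum_insert algebra_simps)
    qed
    have "(\<Sum>C\<in>Pow (insert j W). (-1) ^ card C * altsum C G {})
        = (\<Sum>C\<in>Pow W. (-1) ^ card C * altsum C G {}) + (\<Sum>C\<in>insert j ` Pow W. (-1) ^ card C * altsum C G {})"
      unfolding Pow_insert by (rule sum.union_disjoint) (use insert.hyps in auto)
    also have "(\<Sum>C\<in>insert j ` Pow W. (-1) ^ card C * altsum C G {})
        = (\<Sum>C\<in>Pow W. (-1) ^ card C * altsum C ?Gj {} - (-1) ^ card C * altsum C G {})"
      unfolding sum.reindex[OF inj] comp_def by (rule sum.cong) (use step in auto)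
    also have "\<dots> = G (insert j W) - (\<Sum>C\<in>Pow W. (-1) ^ card C * altsum C G {})"
      by (simp add: sum_subtractf insert.IH)
    finally show ?case by simp
  qed
qed

section \<open>A basis of the functions of bounded degree, over the ground field\<close>

type_synonym 'n cube_index = "'n set \<times> 'n set \<times> 'n set"

text \<open>The index \<open>(A, Z, C)\<close> stands for the monomial \<open>\<Prod>\<^bsub>j\<in>C\<^esub> [j \<in> Y]\<close> on the face \<open>{Y. Y \<inter> Z = A}\<close>.\<close>

definition bfun :: "'n cube_index \<Rightarrow> 'n set \<Rightarrow> 'n set \<Rightarrow> 'b::comm_ring_1" where
  "bfun i Y Z = (case i of (A, Z', C) \<Rightarrow> if Z = Z' \<and> Y \<inter> Z = A \<and> C \<subseteq> Y then 1 else 0)"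

definition bindex :: "int \<Rightarrow> 'n::finite cube_index set" where
  "bindex N = {(A, Z, C). A \<subseteq> Z \<and> C \<inter> Z = {} \<and> even (int (card Z) + N) \<and> 2 * int (card C) + int (card Z) \<le> N}"

text \<open>A face with too many directions has one outside \<open>C\<close>, along which the
  monomial is constant.\<close>

lemma PP_bfun:
  assumes "i \<in> bindex N"
  shows "PP N (bfun i)"
proof -
  obtain A Z C where i: "i = (A, Z, C)" by (cases i)
  show ?thesis
    unfolding PP_def
  proof (intro conjI allI impI)
    fix Y Z' :: "'a set" assume "odd (int (card Z') + N)"
    then show "bfun i Y Z' = (0 :: 'b)" using assms by (auto simp: bindex_def bfun_def i)
  next
    fix Y Z' D :: "'a set" assume D: "D \<inter> Z' = {}" and N: "N < 2 * int (card D) + int (card Z')"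
    show "altsum D (\<lambda>Y. bfun i Y Z') Y = (0 :: 'b)"
    proof (cases "Z' = Z")
      case True
      have "\<not> D \<subseteq> C"
      proof
        assume "D \<subseteq> C"
        then have "card D \<le> card C" by (intro card_mono) auto
        then show False using N True assms by (auto simp: bindex_def i)
      qed
      then obtain l where l: "l \<in> D" "l \<notin> C" by blast
      then have "l \<notin> Z'" using D by auto
      then show ?thesis using l by (intro altsum_eq_0_const[of l]) (auto simp: bfun_def i)
    qed (simp add: bfun_def i)
  qed
qed

lemma finite_bindex [simp]: "finite (bindex N)"
  by (rule finite)

text \<open>The coefficients come from Moebius inversion on each face, and the degree bound kills
  those outside \<open>bindex N\<close>. They may lie in any ring while \<open>bfun\<close> takes
  the values 0 and 1, so linear algebra over the field suffices for polynomial values.\<close>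

lemma PP_expand:
  assumes f: "PP N f"
  shows "f = (\<lambda>Y Z. \<Sum>i\<in>bindex N. (case i of (A, Z, C) \<Rightarrow> (-1) ^ card C * altsum C (\<lambda>Y. f Y Z) A) * bfun i Y Z)"
proof (intro ext)
  fix Y Z :: "'a set"
  let ?v = "\<lambda>i. case i of (A, Z, C) \<Rightarrow> (-1) ^ card C * altsum C (\<lambda>Y. f Y Z) A"
  let ?S = "(\<lambda>C. (Y \<inter> Z, Z, C)) ` Pow (Y - Z)"
  have inj: "inj_on (\<lambda>C. (Y \<inter> Z, Z, C)) (Pow (Y - Z))" by (auto simp: inj_on_def)
  have v0: "?v (Y \<inter> Z, Z, C) = 0" if "C \<subseteq> Y - Z" "(Y \<inter> Z, Z, C) \<notin> bindex N" for C
  proof -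
    have CZ: "C \<inter> Z = {}" using that by auto
    have "altsum C (\<lambda>Y. f Y Z) (Y \<inter> Z) = 0"
    proof (cases "odd (int (card Z) + N)")
      case True
      then show ?thesis using PP_parity[OF f] by (intro altsum_eq_0) auto
    next
      case False
      then have "2 * int (card C) + int (card Z) > N" using that(2) CZ by (auto simp: bindex_def)
      then show ?thesis using PP_altsum[OF f CZ] by blast
    qed
    then show ?thesis by simp
  qed
  have "(\<Sum>i\<in>bindex N. ?v i * bfun i Y Z) = (\<Sum>i\<in>bindex N \<inter> ?S. ?v i * bfun i Y Z)"
    by (rule sum.mono_neutral_right) (auto simp: bfun_def bindex_def split: prod.splits)
  also have "\<dots> = (\<Sum>i\<in>?S. ?v i * bfun i Y Z)"
  proof (rule sum.mono_neutral_left)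
    show "\<forall>i\<in>?S - bindex N \<inter> ?S. ?v i * bfun i Y Z = 0"
    proof
      fix i assume "i \<in> ?S - bindex N \<inter> ?S"
      then obtain C where "i = (Y \<inter> Z, Z, C)" "C \<subseteq> Y - Z" "(Y \<inter> Z, Z, C) \<notin> bindex N" by auto
      then have "?v i = 0" using v0[of C] by blast
      then show "?v i * bfun i Y Z = 0" by simp
    qed
  qed auto
  also have "\<dots> = (\<Sum>C\<in>Pow (Y - Z). (-1) ^ card C * altsum C (\<lambda>Y. f Y Z) (Y \<inter> Z))"
    unfolding sum.reindex[OF inj] comp_def by (rule sum.cong) (auto simp: bfun_def)
  also have "\<dots> = (\<Sum>C\<in>Pow (Y - Z). (-1) ^ card C * altsum C (\<lambda>X. f (Y \<inter> Z \<union> X) Z) {})"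
  proof (rule sum.cong)
    fix C assume "C \<in> Pow (Y - Z)"
    then have "Y \<inter> Z - C = Y \<inter> Z" by auto
    then have "altsum C (\<lambda>Y. f Y Z) (Y \<inter> Z) = altsum C (\<lambda>X. f (Y \<inter> Z \<union> X) Z) {}"
      unfolding altsum_def by (intro sum.cong) auto
    then show "(-1) ^ card C * altsum C (\<lambda>Y. f Y Z) (Y \<inter> Z) = (-1) ^ card C * altsum C (\<lambda>X. f (Y \<inter> Z \<union> X) Z) {}"
      by simp
  qed simp
  also have "\<dots> = f (Y \<inter> Z \<union> (Y - Z)) Z" by (rule sum_Pow_mobius)
  also have "Y \<inter> Z \<union> (Y - Z) = Y" by auto
  finally show "f Y Z = (\<Sum>i\<in>bindex N. ?v i * bfun i Y Z)" by simp
qed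

definition coord :: "('n::finite set \<Rightarrow> 'n set \<Rightarrow> 'k::field) \<Rightarrow> ('n set \<Rightarrow> 'n set \<Rightarrow> ('n, 'k) poly_ring) \<Rightarrow> ('n, 'k) poly_ring" where
  "coord r f = (\<Sum>Y\<in>UNIV. \<Sum>Z\<in>UNIV. coeff_const (r Y Z) * f Y Z)"

definition asm :: "'n::finite cube_index set \<Rightarrow> ('n cube_index \<Rightarrow> 'b::comm_ring_1) \<Rightarrow> 'n set \<Rightarrow> 'n set \<Rightarrow> 'b" where
  "asm J s Y Z = (\<Sum>i\<in>J. s i * bfun i Y Z)"

lemma coord_add: "coord r (\<lambda>Y Z. f Y Z + g Y Z) = coord r f + coord r g"
  by (simp add: coord_def algebra_simps sum.distrib)

lemma coord_diff: "coord r (\<lambda>Y Z. f Y Z - g Y Z) = coord r f - coord r g"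
  by (simp add: coord_def algebra_simps sum_subtractf)

lemma coord_mult: "coord r (\<lambda>Y Z. k * f Y Z) = k * coord r f"
  by (simp add: coord_def algebra_simps sum_distrib_left)

lemma coord_zero [simp]: "coord r (\<lambda>Y Z. 0) = 0"
  by (simp add: coord_def)

lemma coord_sum: "coord r (\<lambda>Y Z. \<Sum>i\<in>A. f i Y Z) = (\<Sum>i\<in>A. coord r (f i))"
  by (induction A rule: infinite_finite_induct) (simp_all add: coord_add)

text \<open>\<open>J\<close> indexes a basis of the functions in \<^const>\<open>PP\<close> modulo those that split along \<open>K\<close>, with dual
  basis \<open>rho\<close>.\<close>

definition quot_basis :: "int \<Rightarrow> 'n::finite set set \<Rightarrow> 'n cube_index set \<Rightarrow> ('n cube_index \<Rightarrow> 'n set \<Rightarrow> 'n set \<Rightarrow> 'k::field) \<Rightarrow> bool" where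
  "quot_basis N K J rho \<longleftrightarrow> J \<subseteq> bindex N \<and>
     (\<forall>f :: 'n set \<Rightarrow> 'n set \<Rightarrow> ('n, 'k) poly_ring. PP N f \<longrightarrow>
         PP N (restr K (\<lambda>Y Z. f Y Z - asm J (\<lambda>i. coord (rho i) f) Y Z))) \<and>
     (\<forall>f :: 'n set \<Rightarrow> 'n set \<Rightarrow> ('n, 'k) poly_ring. PP N f \<longrightarrow> PP N (restr K f) \<longrightarrow> (\<forall>i\<in>J. coord (rho i) f = 0)) \<and>
     (\<forall>i\<in>J. \<forall>j\<in>J. coord (rho j) (bfun i :: 'n set \<Rightarrow> 'n set \<Rightarrow> ('n, 'k) poly_ring) = (if i = j then 1 else 0)) \<and>
     (\<forall>i\<in>J. \<forall>Y Z. rho i Y Z \<noteq> 0 \<longrightarrow> Z = fst (snd i) \<and> Y \<inter> Z = fst i)"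

definition altcoef :: "'n::finite set \<Rightarrow> 'n set \<Rightarrow> 'n set \<Rightarrow> 'b::comm_ring_1" where
  "altcoef D Y Y' = (if Y' - D = Y - D then (-1) ^ card (Y' \<inter> D) else 0)"

lemma altsum_altcoef: "altsum D F Y = (\<Sum>Y'\<in>UNIV. altcoef D Y Y' * F Y')"
proof -
  have "altsum D F Y = altsum D (\<lambda>W. \<Sum>Y'\<in>UNIV. if W = Y' then F Y' else 0) Y" by simp
  also have "\<dots> = (\<Sum>Y'\<in>UNIV. altsum D (\<lambda>W. if W = Y' then F Y' else 0) Y)" by (rule altsum_sum)
  also have "\<dots> = (\<Sum>Y'\<in>UNIV. altcoef D Y Y' * F Y')"
    unfolding altsum_delta altcoef_def by (rule sum.cong) auto
  finally show ?thesis .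
qed

lemma coeff_const_minus_one_power: "coeff_const ((-1) ^ n) = (-1) ^ n"
  by (induction n) simp_all

lemma coeff_const_sum: "coeff_const (\<Sum>i\<in>A. f i) = (\<Sum>i\<in>A. coeff_const (f i))"
  by (induction A rule: infinite_finite_induct) simp_all

lemma coeff_const_if: "coeff_const (if P then a else b) = (if P then coeff_const a else coeff_const b)"
  by simp

lemma coeff_const_altcoef: "coeff_const (altcoef D Y Y') = altcoef D Y Y'"
  by (simp add: altcoef_def coeff_const_minus_one_power)

lemma coeff_const_bfun: "coeff_const (bfun i Y Z) = bfun i Y Z"
  by (auto simp: bfun_def split: prod.splits)

lemma coeff_const_sg: "coeff_const (sg j Z) = sg j Z"
  by (simp add: sg_def coeff_const_minus_one_power)

text \<open>The alternating sums of \<open>restr K f\<close> that would have to vanish are linear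
  obstructions to splitting, with coefficients in the field. \<open>column_basis\<close> applied to
  the matrix of obstructions of the \<open>bfun i\<close> selects the basis.\<close>

lemma quot_basis_exists:
  fixes K :: "'n::finite set set"
  shows "\<exists>J (rho :: 'n cube_index \<Rightarrow> 'n set \<Rightarrow> 'n set \<Rightarrow> 'k::field). quot_basis N K J rho"
proof -
  define ok where "ok = (\<lambda>(Y :: 'n set, Z :: 'n set, D :: 'n set). D \<inter> Z = {} \<and> 2 * int (card D) + int (card Z) > N)"
  define L :: "'n cube_index \<Rightarrow> 'n cube_index \<Rightarrow> 'k" where
    "L i q = (case q of (Y, Z, D) \<Rightarrow> if ok q then altsum D (\<lambda>Y. restr K (bfun i) Y Z) Y else 0)" for i q
  define obs :: "'n cube_index \<Rightarrow> ('n set \<Rightarrow> 'n set \<Rightarrow> ('n, 'k) poly_ring) \<Rightarrow> ('n, 'k) poly_ring" where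
    "obs q f = (case q of (Y, Z, D) \<Rightarrow> if ok q then altsum D (\<lambda>Y. restr K f Y Z) Y else 0)" for q f
  obtain J g where J: "J \<subseteq> bindex N"
    and rep: "\<And>i q. i \<in> bindex N \<Longrightarrow> L i q = (\<Sum>j\<in>J. (\<Sum>q'\<in>UNIV. g j q' * L i q') * L j q)"
    and dual: "\<And>i j. j \<in> J \<Longrightarrow> i \<in> J \<Longrightarrow> (\<Sum>q\<in>UNIV. g j q * L i q) = (if i = j then 1 else 0)"
    using column_basis[OF finite_bindex, of N L] by blast
  have finJ: "finite J" by (rule finite)
  define same where "same i q = (case q of (Y, Z, D) \<Rightarrow> Z = fst (snd i) \<and> Y \<inter> Z = fst i)" for i q :: "'n cube_index"
  have L0: "same i q" if "L i q \<noteq> 0" for i q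
  proof -
    obtain Y Z D where q: "q = (Y, Z, D)" by (cases q)
    obtain A Z' C where i: "i = (A, Z', C)" by (cases i)
    have okq: "ok q" using that by (auto simp: L_def split: if_splits prod.splits)
    have nz: "altsum D (\<lambda>Y. restr K (bfun i) Y Z) Y \<noteq> (0 :: 'k)" using that okq by (simp add: L_def q)
    have "\<exists>C'\<subseteq>D. restr K (bfun i) ((Y - D) \<union> C') Z \<noteq> (0 :: 'k)"
    proof (rule ccontr)
      assume "\<not> ?thesis"
      then have "altsum D (\<lambda>Y. restr K (bfun i) Y Z) Y = altsum D (\<lambda>Y. 0 :: 'k) Y"
        by (intro altsum_cong) blast
      then show False using nz by simp
    qed
    then obtain C' where C': "C' \<subseteq> D" "restr K (bfun i) ((Y - D) \<union> C') Z \<noteq> (0 :: 'k)" by blast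
    then have "Z = Z'" "((Y - D) \<union> C') \<inter> Z = A" by (auto simp: restr_def bfun_def i split: if_splits)
    moreover have "((Y - D) \<union> C') \<inter> Z = Y \<inter> Z" using C' okq by (auto simp: ok_def q)
    ultimately show ?thesis by (simp add: same_def q i)
  qed
  \<comment> \<open>Cut down to the obstructions on the face of \<open>j\<close>, so that
    \<open>rho j\<close> reads only values at the vertex of \<open>j\<close> and the differential
    becomes a matrix of paths with fixed ends. Duality survives since \<open>L i\<close> vanishes
    off the face of \<open>i\<close>.\<close>
  define g' where "g' j q = (if same j q then g j q else 0)" for j q
  have same_eq: "fst i = fst j \<and> fst (snd i) = fst (snd j)" if "same i q" "same j q" for i j q
    using that by (auto simp: same_def split: prod.splits)
  have dual': "(\<Sum>q\<in>UNIV. g' j q * L i q) = (if i = j then 1 else 0)" if ij: "j \<in> J" "i \<in> J" for i j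
  proof (cases "fst i = fst j \<and> fst (snd i) = fst (snd j)")
    case True
    have "(\<Sum>q\<in>UNIV. g' j q * L i q) = (\<Sum>q\<in>UNIV. g j q * L i q)"
    proof (rule sum.cong)
      fix q
      show "g' j q * L i q = g j q * L i q"
        using L0[of i q] True by (cases "L i q = 0") (auto simp: g'_def same_def split: prod.splits)
    qed simp
    then show ?thesis using dual ij by simp
  next
    case False
    have "(\<Sum>q\<in>UNIV. g' j q * L i q) = 0"
    proof (rule sum.neutral, rule ballI)
      fix q
      have "\<not> same j q" if "L i q \<noteq> 0" using L0[OF that] same_eq[of i q j] False by blast
      then show "g' j q * L i q = 0" unfolding g'_def by (cases "L i q = 0") auto
    qed
    then show ?thesis using False by auto
  qed
  have rep': "L i q = (\<Sum>j\<in>J. (\<Sum>q'\<in>UNIV. g' j q' * L i q') * L j q)" if i: "i \<in> bindex N" for i q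
  proof -
    define c where "c m = (\<Sum>q'\<in>UNIV. g m q' * L i q')" for m
    have Lc: "L i q = (\<Sum>m\<in>J. c m * L m q)" for q
      unfolding c_def by (rule rep[OF i])
    have "(\<Sum>q'\<in>UNIV. g' j q' * L i q') = c j" if j: "j \<in> J" for j
    proof -
      have "(\<Sum>q'\<in>UNIV. g' j q' * L i q') = (\<Sum>q'\<in>UNIV. \<Sum>m\<in>J. g' j q' * (c m * L m q'))"
        by (simp only: Lc sum_distrib_left)
      also have "\<dots> = (\<Sum>m\<in>J. c m * (\<Sum>q'\<in>UNIV. g' j q' * L m q'))"
        by (subst sum.swap) (simp add: mult.left_commute sum_distrib_left)
      also have "\<dots> = (\<Sum>m\<in>J. if m = j then c j else 0)"
        by (rule sum.cong) (use dual' j in auto)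
      finally show ?thesis using finJ j by simp
    qed
    then have "(\<Sum>j\<in>J. (\<Sum>q'\<in>UNIV. g' j q' * L i q') * L j q) = (\<Sum>j\<in>J. c j * L j q)"
      by (intro sum.cong) auto
    then show ?thesis by (simp only: Lc[of q])
  qed
  define rho where "rho j Y' Z = (\<Sum>Y\<in>UNIV. \<Sum>D\<in>UNIV. if ok (Y, Z, D) \<and> Y' \<in> K then g' j (Y, Z, D) * altcoef D Y Y' else 0)" for j Y' Z
  have coord_rho: "coord (rho j) f = (\<Sum>q\<in>UNIV. coeff_const (g' j q) * obs q f)" for j f
  proof -
    have "coord (rho j) f = (\<Sum>Y'\<in>UNIV. \<Sum>Z\<in>UNIV. \<Sum>Y\<in>UNIV. \<Sum>D\<in>UNIV.
        (if ok (Y, Z, D) then coeff_const (g' j (Y, Z, D)) * (altcoef D Y Y' * restr K f Y' Z) else 0))"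
      unfolding coord_def rho_def coeff_const_sum sum_distrib_right
      by (intro sum.cong) (auto simp: restr_def coeff_const_altcoef)
    also have "\<dots> = (\<Sum>Z\<in>UNIV. \<Sum>Y'\<in>UNIV. \<Sum>Y\<in>UNIV. \<Sum>D\<in>UNIV.
        (if ok (Y, Z, D) then coeff_const (g' j (Y, Z, D)) * (altcoef D Y Y' * restr K f Y' Z) else 0))"
      by (rule sum.swap)
    also have "\<dots> = (\<Sum>Z\<in>UNIV. \<Sum>Y\<in>UNIV. \<Sum>D\<in>UNIV. \<Sum>Y'\<in>UNIV.
        (if ok (Y, Z, D) then coeff_const (g' j (Y, Z, D)) * (altcoef D Y Y' * restr K f Y' Z) else 0))"
      by (rule sum.cong[OF refl], rule trans[OF sum.swap], rule sum.cong[OF refl], rule sum.swap)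
    also have "\<dots> = (\<Sum>Z\<in>UNIV. \<Sum>Y\<in>UNIV. \<Sum>D\<in>UNIV. coeff_const (g' j (Y, Z, D)) * obs (Y, Z, D) f)"
      by (intro sum.cong refl) (auto simp: obs_def altsum_altcoef sum_distrib_left)
    also have "\<dots> = (\<Sum>Y\<in>UNIV. \<Sum>Z\<in>UNIV. \<Sum>D\<in>UNIV. coeff_const (g' j (Y, Z, D)) * obs (Y, Z, D) f)"
      by (rule sum.swap)
    also have "\<dots> = (\<Sum>q\<in>UNIV. coeff_const (g' j q) * obs q f)"
      by (simp add: sum.cartesian_product case_prod_unfold)
    finally show ?thesis .
  qed
  have obs_bfun: "obs q (bfun i) = coeff_const (L i q)" for i q
  proof -
    obtain Y Z D where q: "q = (Y, Z, D)" by (cases q)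
    have "coeff_const (altsum D (\<lambda>Y. restr K (bfun i) Y Z) Y) = (altsum D (\<lambda>Y. restr K (bfun i) Y Z) Y :: ('n, 'k) poly_ring)"
      by (auto simp: altsum_altcoef coeff_const_sum coeff_const_altcoef restr_def coeff_const_if coeff_const_bfun intro!: sum.cong)
    then show ?thesis by (simp add: obs_def L_def q)
  qed
  have coord_bfun: "coord (rho j) (bfun i) = coeff_const (\<Sum>q\<in>UNIV. g' j q * L i q)" for i j
    by (simp add: coord_rho obs_bfun coeff_const_sum)
  have obs_rel: "PP N (restr K f)" if "PP N f" "\<And>q. obs q f = 0" for f
    unfolding PP_def
  proof (intro conjI allI impI)
    fix Y Z :: "'n set" assume "odd (int (card Z) + N)"
    from PP_parity[OF that(1) this] show "restr K f Y Z = 0" by (simp add: restr_def)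
  next
    fix Y Z D :: "'n set" assume "D \<inter> Z = {}" "2 * int (card D) + int (card Z) > N"
    then show "altsum D (\<lambda>Y. restr K f Y Z) Y = 0" using that(2)[of "(Y, Z, D)"] by (simp add: obs_def ok_def)
  qed
  have obs_diff: "obs q (\<lambda>Y Z. f Y Z - h Y Z) = obs q f - obs q h" for q f h
    by (auto simp: obs_def restr_simps altsum_diff split: prod.splits)
  have obs_mult: "obs q (\<lambda>Y Z. k * f Y Z) = k * obs q f" for q f k
    by (auto simp: obs_def restr_simps altsum_const_mult split: prod.splits)
  have obs_sum: "obs q (\<lambda>Y Z. \<Sum>i\<in>A. f i Y Z) = (\<Sum>i\<in>A. obs q (f i))" for q f and A :: "'n cube_index set"
    by (auto simp: obs_def restr_sum altsum_sum split: prod.splits)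
  have "quot_basis N K J rho"
    unfolding quot_basis_def
  proof (intro conjI allI impI ballI)
    show "J \<subseteq> bindex N" by (rule J)
  next
    fix f :: "'n set \<Rightarrow> 'n set \<Rightarrow> ('n, 'k) poly_ring" assume f: "PP N f"
    define v where "v = (\<lambda>(A, Z, C). (-1) ^ card C * altsum C (\<lambda>Y. f Y Z) A)"
    have fexp: "f = (\<lambda>Y Z. \<Sum>i\<in>bindex N. v i * bfun i Y Z)"
      unfolding v_def by (rule PP_expand[OF f])
    have cf: "coord (rho j) f = (\<Sum>i\<in>bindex N. v i * coord (rho j) (bfun i))" for j
      by (subst fexp) (simp add: coord_sum coord_mult)
    show "PP N (restr K (\<lambda>Y Z. f Y Z - asm J (\<lambda>i. coord (rho i) f) Y Z))"
    proof (rule obs_rel)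
      show "PP N (\<lambda>Y Z. f Y Z - asm J (\<lambda>i. coord (rho i) f) Y Z)"
        unfolding asm_def using J by (intro PP_diff f PP_sum PP_mult PP_bfun) auto
      fix q
      have "obs q f = (\<Sum>i\<in>bindex N. v i * coeff_const (L i q))"
        by (subst fexp) (simp add: obs_sum obs_mult obs_bfun)
      also have "\<dots> = (\<Sum>i\<in>bindex N. \<Sum>j\<in>J. v i * coord (rho j) (bfun i) * coeff_const (L j q))"
      proof (rule sum.cong)
        fix i :: "'n cube_index" assume "i \<in> bindex N"
        from rep'[OF this, of q] have "coeff_const (L i q) = (\<Sum>j\<in>J. coord (rho j) (bfun i) * coeff_const (L j q))"
          by (simp add: coord_bfun coeff_const_sum)
        then show "v i * coeff_const (L i q) = (\<Sum>j\<in>J. v i * coord (rho j) (bfun i) * coeff_const (L j q))"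
          by (simp add: sum_distrib_left mult.assoc)
      qed simp
      also have "\<dots> = (\<Sum>j\<in>J. coord (rho j) f * obs q (bfun j))"
        by (subst sum.swap) (simp add: cf obs_bfun sum_distrib_right)
      also have "\<dots> = obs q (asm J (\<lambda>i. coord (rho i) f))"
        unfolding asm_def by (simp add: obs_sum obs_mult)
      finally show "obs q (\<lambda>Y Z. f Y Z - asm J (\<lambda>i. coord (rho i) f) Y Z) = 0"
        unfolding obs_diff by simp
    qed
  next
    fix f :: "'n set \<Rightarrow> 'n set \<Rightarrow> ('n, 'k) poly_ring" and i assume f: "PP N f" "PP N (restr K f)"
    have "obs q f = 0" for q
      using PP_altsum[OF f(2)] by (auto simp: obs_def ok_def split: prod.splits)
    then show "coord (rho i) f = 0" by (simp add: coord_rho)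
  next
    fix i j assume "i \<in> J" "j \<in> J"
    then show "coord (rho j) (bfun i :: 'n set \<Rightarrow> 'n set \<Rightarrow> ('n, 'k) poly_ring) = (if i = j then 1 else 0)"
      using dual' by (simp add: coord_bfun)
  next
    fix i Y' Z assume "i \<in> J" and nz: "rho i Y' Z \<noteq> 0"
    from nz obtain Y where "(\<Sum>D\<in>UNIV. if ok (Y, Z, D) \<and> Y' \<in> K then g' i (Y, Z, D) * altcoef D Y Y' else 0) \<noteq> 0"
      unfolding rho_def by (rule sum.not_neutral_contains_not_neutral)
    then obtain D where "(if ok (Y, Z, D) \<and> Y' \<in> K then g' i (Y, Z, D) * altcoef D Y Y' else 0) \<noteq> 0"
      by (rule sum.not_neutral_contains_not_neutral)
    then have YD: "ok (Y, Z, D)" "g' i (Y, Z, D) * altcoef D Y Y' \<noteq> 0" by (auto split: if_splits)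
    then have "same i (Y, Z, D)" "Y' - D = Y - D"
      by (auto simp: g'_def altcoef_def split: if_splits)
    moreover have "D \<inter> Z = {}" using YD(1) by (simp add: ok_def)
    moreover from this have "Y \<inter> Z = (Y - D) \<inter> Z" "Y' \<inter> Z = (Y' - D) \<inter> Z" by auto
    ultimately show "Z = fst (snd i)" "Y' \<inter> Z = fst i" by (auto simp: same_def)
  qed
  then show ?thesis by blast
qed

lemma quot_basis_subset: "quot_basis N K J rho \<Longrightarrow> J \<subseteq> bindex N"
  by (simp add: quot_basis_def)

lemma quot_basis_PP_asm: "quot_basis N K J rho \<Longrightarrow> PP N (asm J s)"
  unfolding asm_def by (intro PP_sum PP_mult PP_bfun) (auto dest: quot_basis_subset)

lemma quot_basis_approx:
  "quot_basis N K J rho \<Longrightarrow> PP N f \<Longrightarrow> PP N (restr K (\<lambda>Y Z. f Y Z - asm J (\<lambda>i. coord (rho i) f) Y Z))"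
  by (simp add: quot_basis_def)

lemma quot_basis_coord_split:
  "quot_basis N K J rho \<Longrightarrow> PP N f \<Longrightarrow> PP N (restr K f) \<Longrightarrow> i \<in> J \<Longrightarrow> coord (rho i) f = 0"
  by (simp add: quot_basis_def)

lemma quot_basis_coord_asm:
  fixes s :: "'n::finite cube_index \<Rightarrow> ('n, 'k::field) poly_ring"
  assumes q: "quot_basis N K J rho" and i: "i \<in> J"
  shows "coord (rho i) (asm J s) = s i"
proof -
  have "coord (rho i) (asm J s) = (\<Sum>j\<in>J. s j * coord (rho i) (bfun j))"
    unfolding asm_def by (simp add: coord_sum coord_mult)
  also have "\<dots> = (\<Sum>j\<in>J. if j = i then s i else 0)"
    by (rule sum.cong) (use q i in \<open>auto simp: quot_basis_def\<close>)
  also have "\<dots> = s i" using i by simp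
  finally show ?thesis .
qed

lemma quot_basis_coord_cong:
  assumes "quot_basis N K J rho" "PP N f" "PP N g" "PP N (restr K (\<lambda>Y Z. f Y Z - g Y Z))" "i \<in> J"
  shows "coord (rho i) f = coord (rho i) g"
  using quot_basis_coord_split[OF assms(1) PP_diff[OF assms(2,3)] assms(4,5)] by (simp add: coord_diff)

abbreviation tdd :: "('n::finite \<Rightarrow> bool \<Rightarrow> bool) \<Rightarrow> ('n set \<Rightarrow> 'n set \<Rightarrow> ('n, 'k::field) poly_ring) \<Rightarrow> 'n set \<Rightarrow> 'n set \<Rightarrow> ('n, 'k) poly_ring" where
  "tdd p \<equiv> cube_complex.dd tvar p"

text \<open>Replacing \<open>f\<close> by its representative changes it by a function that splits,
  and the differential preserves splitting; so the differential descends to coordinates.\<close>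

lemma coord_tdd_asm:
  fixes K :: "'n::finite set set" and rho :: "'n cube_index \<Rightarrow> 'n set \<Rightarrow> 'n set \<Rightarrow> 'k::field"
  assumes q: "quot_basis N K J rho" and q': "quot_basis (N + 1) K J' rho'"
    and f: "PP N f" and i: "i \<in> J'"
  shows "coord (rho' i) (tdd p (asm J (\<lambda>j. coord (rho j) f))) = coord (rho' i) (tdd p f)"
proof (rule quot_basis_coord_cong[OF q' _ _ _ i])
  let ?g = "asm J (\<lambda>j. coord (rho j) f)"
  have g: "PP N ?g" by (rule quot_basis_PP_asm[OF q])
  have r: "PP N (restr K (\<lambda>Y Z. f Y Z - ?g Y Z))" by (rule quot_basis_approx[OF q f])
  have "PP N (restr K (\<lambda>Y Z. ?g Y Z - f Y Z))"
    using PP_mult[OF r, of "-1"] by (simp add: restr_simps)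
  from tvar.PP_dd[OF this] show "PP (N + 1) (restr K (\<lambda>Y Z. tdd p ?g Y Z - tdd p f Y Z))"
    by (simp add: tvar.dd_restr tvar.dd_diff)
  show "PP (N + 1) (tdd p ?g)" "PP (N + 1) (tdd p f)" by (intro tvar.PP_dd g f)+
qed

lemma coord_tdd_tdd:
  assumes q': "quot_basis N K J' rho'" and q'': "quot_basis (N + 1) K J'' rho''"
    and f: "PP (N - 1) f" and i: "i \<in> J''"
  shows "coord (rho'' i) (tdd p (asm J' (\<lambda>j. coord (rho' j) (tdd p f)))) = 0"
proof -
  have "PP (N - 1 + 1) (tdd p f)" by (rule tvar.PP_dd[OF f])
  then have "PP N (tdd p f)" by simp
  from coord_tdd_asm[OF q' q'' this i] have "coord (rho'' i) (tdd p (asm J' (\<lambda>j. coord (rho' j) (tdd p f)))) = coord (rho'' i) (tdd p (tdd p f))" .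
  also have "tdd p (tdd p f) = (\<lambda>Y Z. 0)" by (simp add: fun_eq_iff)
  finally show ?thesis by simp
qed

lemma coord_lift:
  fixes s :: "'n::finite cube_index \<Rightarrow> ('n, 'k::field) poly_ring"
    and rho rhom :: "'n cube_index \<Rightarrow> 'n set \<Rightarrow> 'n set \<Rightarrow> 'k"
  assumes qm: "quot_basis (N - 1) K Jm rhom" and q: "quot_basis N K J rho"
    and ex: "\<exists>g. PP (N - 1) g \<and> PP N (restr K (\<lambda>Y Z. asm J s Y Z - tdd p g Y Z))"
  shows "\<exists>g. \<forall>i\<in>J. s i = coord (rho i) (tdd p (asm Jm g))"
proof -
  obtain g where g: "PP (N - 1) g" "PP N (restr K (\<lambda>Y Z. asm J s Y Z - tdd p g Y Z))" using ex by blast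
  have q1: "quot_basis (N - 1 + 1) K J rho" using q by simp
  show ?thesis
  proof (intro exI ballI)
    fix i assume i: "i \<in> J"
    have "PP N (tdd p g)" using tvar.PP_dd[OF g(1)] by simp
    then have "coord (rho i) (asm J s) = coord (rho i) (tdd p g)"
      by (intro quot_basis_coord_cong[OF q quot_basis_PP_asm[OF q] _ g(2) i])
    then show "s i = coord (rho i) (tdd p (asm Jm (\<lambda>j. coord (rhom j) g)))"
      using coord_tdd_asm[OF qm q1 g(1) i] quot_basis_coord_asm[OF q i, of s] by simp
  qed
qed

lemma quot_basis_split_tdd:
  fixes s :: "'n::finite cube_index \<Rightarrow> ('n, 'k::field) poly_ring"
  assumes q: "quot_basis N K J rho" and q': "quot_basis (N + 1) K J' rho'"
    and cyc: "\<And>i. i \<in> J' \<Longrightarrow> coord (rho' i) (tdd p (asm J s)) = 0"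
  shows "PP (N + 1) (restr K (tdd p (asm J s)))"
proof -
  have "PP (N + 1) (tdd p (asm J s))" by (intro tvar.PP_dd quot_basis_PP_asm[OF q])
  note quot_basis_approx[OF q' this]
  moreover have "asm J' (\<lambda>i. coord (rho' i) (tdd p (asm J s))) = (\<lambda>Y Z. 0)"
    by (simp add: asm_def cyc fun_eq_iff)
  ultimately show ?thesis by simp
qed

section \<open>Geometry of Cubist subsets\<close>

definition ind_vec :: "'n set \<Rightarrow> int ^ 'n::finite" where
  "ind_vec A = (\<chi> j. if j \<in> A then 1 else 0)"

definition posn :: "int ^ 'n \<Rightarrow> 'n set \<Rightarrow> 'n set \<Rightarrow> int ^ 'n::finite" where
  "posn x Y Z = (\<chi> j. x $ j + (if j \<in> Z then if j \<in> Y then 1 else -1 else 0))"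

definition cpos :: "int ^ 'n \<Rightarrow> 'n cube_index \<Rightarrow> int ^ 'n::finite" where
  "cpos x i = posn x (fst i) (fst (snd i))"

text \<open>True iff the unit step from \<open>x\<close> along \<open>j\<close>, upwards for
  \<open>b\<close>, does not approach \<open>y\<close>. For paths from \<open>y\<close> that step
  then costs no loop, while the step back closes one.\<close>

definition away :: "int ^ 'n \<Rightarrow> int ^ 'n \<Rightarrow> 'n::finite \<Rightarrow> bool \<Rightarrow> bool" where
  "away x y j b = (if b then y $ j - x $ j \<le> 0 else y $ j - x $ j \<ge> 0)"

definition arr :: "'n \<Rightarrow> 'n set \<Rightarrow> 'n set \<Rightarrow> 'n arrow" where
  "arr l Y Z = (if (l \<in> Y) = (l \<in> Z) then Up l else Down l)"

lemma posn_Int: "posn x (Y \<inter> Z) Z = posn x Y Z"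
  by (simp add: posn_def vec_eq_iff)

lemma bfun_cpos: "bfun i Y Z \<noteq> (0 :: 'b::comm_ring_1) \<Longrightarrow> posn x Y Z = cpos x i"
  by (cases i) (auto simp: bfun_def cpos_def posn_Int split: if_splits)

lemma step_arr: "step (posn x Y (toggle l Z)) (arr l Y Z) = posn x Y Z"
  by (auto simp: arr_def vec_eq_iff posn_def axis_def)

text \<open>The bridge between the two halves of the proof: for paths from \<open>y\<close>,
  appending arrows of the cube multiplies by the coefficients of the complex oriented by
  \<open>away x y\<close>.\<close>

lemma step_coeff_arr:
  "step_coeff y (posn x Y (toggle l Z)) (arr l Y Z) = cube_complex.cf tvar (away x y) l Y Z"
  by (auto simp: tvar.cf_def step_coeff_def arr_def posn_def away_def)

text \<open>The matrix entry of the cube differential from basis element \<open>i\<close> to the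
  functional \<open>r\<close>, with each coefficient \<open>cf\<close> replaced by the arrow behind
  it. In this form it no longer depends on \<open>y\<close>.\<close>

definition kap :: "int ^ 'n \<Rightarrow> ('n::finite set \<Rightarrow> 'n set \<Rightarrow> 'k::field) \<Rightarrow> 'n cube_index \<Rightarrow> ('n, 'k) valg" where
  "kap x r i = (\<Sum>Y\<in>UNIV. \<Sum>Z\<in>UNIV. \<Sum>l\<in>UNIV.
     vscale (r Y Z * (sg l Z * bfun i Y (toggle l Z))) (vword (posn x Y (toggle l Z)) [arr l Y Z]))"

lemma psi_kap:
  fixes v :: "('n::finite, 'k::field) valg"
  assumes r: "\<And>Y Z. r Y Z \<noteq> 0 \<Longrightarrow> posn x Y Z = w'"
  shows "psi y w' (v * kap x r i) = coord r (tdd (away x y) (\<lambda>Y Z. psi y (cpos x i) v * bfun i Y Z))"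
proof -
  have "psi y w' (v * vscale (r Y Z * (sg l Z * bfun i Y (toggle l Z))) (vword (posn x Y (toggle l Z)) [arr l Y Z]))
      = coeff_const (r Y Z) * (sg l Z * cube_complex.cf tvar (away x y) l Y Z * (psi y (cpos x i) v * bfun i Y (toggle l Z)))" for Y Z l
  proof (cases "r Y Z = 0 \<or> bfun i Y (toggle l Z) = (0 :: 'k)")
    case True
    moreover have "bfun i Y (toggle l Z) = (0 :: ('n, 'k) poly_ring)" if "bfun i Y (toggle l Z) = (0 :: 'k)"
      using coeff_const_bfun[of i Y "toggle l Z", where 'b = 'k] that by simp
    ultimately show ?thesis by auto
  next
    case False
    then have w': "w' = step (posn x Y (toggle l Z)) (arr l Y Z)" and w: "posn x Y (toggle l Z) = cpos x i"
      using r bfun_cpos by (metis step_arr)+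
    show ?thesis
      unfolding vscale_mult_right psi_vscale w' psi_mult_arrow step_coeff_arr
      by (simp add: w coeff_const_sg coeff_const_bfun mult_ac)
  qed
  then show ?thesis
    by (simp add: kap_def sum_distrib_left psi_sum coord_def tvar.dd_def)
qed

lemma eta_kap:
  fixes s :: "('n::finite, 'k::field) poly_ring"
  assumes r: "\<And>Y Z. r Y Z \<noteq> 0 \<Longrightarrow> posn x Y Z = w'"
  shows "eta y (cpos x i) s * kap x r i = eta y w' (coord r (tdd (away x y) (\<lambda>Y Z. s * bfun i Y Z)))"
proof -
  have "eta y (cpos x i) s * vscale (r Y Z * (sg l Z * bfun i Y (toggle l Z))) (vword (posn x Y (toggle l Z)) [arr l Y Z])
      = eta y w' (coeff_const (r Y Z) * (sg l Z * cube_complex.cf tvar (away x y) l Y Z * (s * bfun i Y (toggle l Z))))" for Y Z l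
  proof (cases "r Y Z = 0 \<or> bfun i Y (toggle l Z) = (0 :: 'k)")
    case True
    moreover have "bfun i Y (toggle l Z) = (0 :: ('n, 'k) poly_ring)" if "bfun i Y (toggle l Z) = (0 :: 'k)"
      using coeff_const_bfun[of i Y "toggle l Z", where 'b = 'k] that by simp
    ultimately show ?thesis by auto
  next
    case False
    then have w': "w' = step (posn x Y (toggle l Z)) (arr l Y Z)" and w: "posn x Y (toggle l Z) = cpos x i"
      using r bfun_cpos by (metis step_arr)+
    have "eta y (cpos x i) s * vscale (r Y Z * (sg l Z * bfun i Y (toggle l Z))) (vword (posn x Y (toggle l Z)) [arr l Y Z])
      = vscale (r Y Z * (sg l Z * bfun i Y (toggle l Z))) (eta y w' (cube_complex.cf tvar (away x y) l Y Z * s))"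
      unfolding vscale_mult_right w[symmetric] eta_mult_arrow w' step_coeff_arr ..
    also have "\<dots> = eta y w' (coeff_const (r Y Z * (sg l Z * bfun i Y (toggle l Z))) * (cube_complex.cf tvar (away x y) l Y Z * s))"
      by (simp only: eta_const)
    also have "coeff_const (r Y Z * (sg l Z * bfun i Y (toggle l Z))) * (cube_complex.cf tvar (away x y) l Y Z * s)
       = coeff_const (r Y Z) * (sg l Z * cube_complex.cf tvar (away x y) l Y Z * (s * bfun i Y (toggle l Z)))"
      by (simp add: coeff_const_sg coeff_const_bfun mult_ac)
    finally show ?thesis .
  qed
  then show ?thesis
    by (simp add: kap_def sum_distrib_left eta_sum coord_def tvar.dd_def)
qed

lemma psi_sum_kap:
  fixes v :: "'n::finite cube_index \<Rightarrow> ('n, 'k::field) valg"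
  assumes r: "\<And>Y Z. r Y Z \<noteq> 0 \<Longrightarrow> posn x Y Z = w'"
  shows "psi y w' (\<Sum>i\<in>J. v i * kap x r i) = coord r (tdd (away x y) (asm J (\<lambda>i. psi y (cpos x i) (v i))))"
proof -
  have eq: "asm J (\<lambda>i. psi y (cpos x i) (v i)) = (\<lambda>Y Z. \<Sum>i\<in>J. psi y (cpos x i) (v i) * bfun i Y Z)"
    by (simp add: asm_def fun_eq_iff)
  show ?thesis unfolding eq by (simp add: psi_sum psi_kap[OF r] tvar.dd_sum coord_sum)
qed

lemma eta_sum_kap:
  fixes s :: "'n::finite cube_index \<Rightarrow> ('n, 'k::field) poly_ring"
  assumes r: "\<And>Y Z. r Y Z \<noteq> 0 \<Longrightarrow> posn x Y Z = w'"
  shows "(\<Sum>i\<in>J. eta y (cpos x i) (s i) * kap x r i) = eta y w' (coord r (tdd (away x y) (asm J s)))"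
proof -
  have eq: "asm J s = (\<lambda>Y Z. \<Sum>i\<in>J. s i * bfun i Y Z)"
    by (simp add: asm_def fun_eq_iff)
  show ?thesis unfolding eq by (simp add: eta_sum eta_kap[OF r] tvar.dd_sum coord_sum)
qed

lemma cubist_ideal:
  assumes "cubist (X :: (int ^ 'n::finite) set)"
  obtains I where "\<And>a b. b \<in> I \<Longrightarrow> a \<le> b \<Longrightarrow> a \<in> I" "X = {x. x \<in> I \<and> x + 1 \<notin> I}"
proof -
  obtain I where I: "\<forall>y\<in>I. \<forall>x. x \<le> y \<longrightarrow> x \<in> I" "X = I - (\<lambda>x. shift x (-1)) ` I"
    using assms by (auto simp: cubist_def)
  have "x \<in> (\<lambda>x. shift x (-1)) ` I \<longleftrightarrow> x + 1 \<in> I" for x :: "int ^ 'n"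
  proof
    assume "x \<in> (\<lambda>x. shift x (-1)) ` I"
    then obtain z where z: "z \<in> I" "x = shift z (-1)" by blast
    then have "x + 1 = z" by (simp add: vec_eq_iff shift_def)
    then show "x + 1 \<in> I" using z by simp
  next
    assume "x + 1 \<in> I"
    moreover have "x = shift (x + 1) (-1)" by (simp add: vec_eq_iff shift_def)
    ultimately show "x \<in> (\<lambda>x. shift x (-1)) ` I" by blast
  qed
  then have "X = {x. x \<in> I \<and> x + 1 \<notin> I}" using I(2) by auto
  then show ?thesis using that[of I] I(1) by blast
qed

locale cubist_point =
  fixes I :: "(int ^ 'n::finite) set" and x :: "int ^ 'n"
  assumes ideal: "\<And>a b. b \<in> I \<Longrightarrow> a \<le> b \<Longrightarrow> a \<in> I"
    and xI: "x \<in> I" and xI': "x + 1 \<notin> I"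
begin

definition K :: "'n set set" where
  "K = {A. x + ind_vec A \<in> I}"

lemma K_down: "A \<in> K \<Longrightarrow> B \<subseteq> A \<Longrightarrow> B \<in> K"
  unfolding K_def mem_Collect_eq by (erule ideal) (auto simp: less_eq_vec_def ind_vec_def)

lemma K_empty: "{} \<in> K"
proof -
  have "x + ind_vec {} = x" by (simp add: vec_eq_iff ind_vec_def)
  then show ?thesis using xI by (simp add: K_def)
qed

lemma K_UNIV: "UNIV \<notin> K"
proof -
  have "x + ind_vec UNIV = x + 1" by (simp add: vec_eq_iff ind_vec_def)
  then show ?thesis using xI' by (simp add: K_def)
qed

text \<open>At a vertex outside \<open>X\<close> the whole face of \<open>i\<close> lies on one side
  of \<open>K\<close>. Then \<open>bfun i\<close> splits and its coordinate vanishes, although it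
  has to be 1.\<close>

lemma quot_basis_pos:
  assumes q: "quot_basis N K J (rho :: 'n cube_index \<Rightarrow> 'n set \<Rightarrow> 'n set \<Rightarrow> 'k::field)" and i: "i \<in> J"
  shows "cpos x i \<in> I \<and> cpos x i + 1 \<notin> I"
proof -
  obtain A Z C where i': "i = (A, Z, C)" by (cases i)
  have AZ: "A \<subseteq> Z" using quot_basis_subset[OF q] i by (auto simp: bindex_def i')
  let ?b = "bfun i :: 'n set \<Rightarrow> 'n set \<Rightarrow> ('n, 'k) poly_ring"
  have b: "PP N ?b" using quot_basis_subset[OF q] i by (intro PP_bfun) auto
  have one: "coord (rho i) ?b = 1" using q i by (simp add: quot_basis_def)
  have nrel: "\<not> PP N (restr K ?b)" using quot_basis_coord_split[OF q b _ i] one by auto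
  have A: "A \<in> K"
  proof (rule ccontr)
    assume "A \<notin> K"
    then have "restr K ?b = (\<lambda>Y Z. 0)"
      by (auto simp: restr_def bfun_def i' fun_eq_iff dest: K_down)
    then show False using nrel by simp
  qed
  have B: "- (Z - A) \<notin> K"
  proof
    assume K: "- (Z - A) \<in> K"
    have "restr K ?b = ?b"
    proof (intro ext)
      fix Y Z'
      have "Y \<in> K" if "Y \<inter> Z = A" by (rule K_down[OF K]) (use that in auto)
      then show "restr K ?b Y Z' = ?b Y Z'" by (auto simp: restr_def bfun_def i')
    qed
    then show False using nrel b by simp
  qed
  have "cpos x i \<le> x + ind_vec A"
    by (auto simp: cpos_def i' posn_def less_eq_vec_def ind_vec_def)
  moreover have "x + ind_vec (- (Z - A)) \<le> cpos x i + 1"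
    using AZ by (auto simp: cpos_def i' posn_def less_eq_vec_def ind_vec_def)
  ultimately show ?thesis using A B ideal unfolding K_def by blast
qed

lemma exact_coord:
  fixes f :: "'n set \<Rightarrow> 'n set \<Rightarrow> ('n, 'k::field) poly_ring"
  assumes y: "y \<in> I" "y + 1 \<notin> I" and N: "y \<noteq> x \<or> N < 2 * int CARD('n) - 2"
    and f: "PP N f" "PP (N + 1) (restr K (tdd (away x y) f))"
  shows "\<exists>g. PP (N - 1) g \<and> PP N (restr K (\<lambda>Y Z. f Y Z - tdd (away x y) g Y Z))"
proof (cases "y = x")
  case True
  have aw: "away x y = (\<lambda>j b. True)" using True by (simp add: away_def fun_eq_iff)
  show ?thesis
    unfolding aw
    by (rule local_cube_complex.exact_at[OF local_cube_complex_tvar])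
       (use K_down K_UNIV f[unfolded aw] N True in auto)
next
  case False
  let ?u = "\<lambda>j. y $ j - x $ j"
  let ?P = "{j. ?u j > 0}" and ?N = "{j. ?u j < 0}"
  \<comment> \<open>Membership of \<open>y\<close> in \<open>X\<close> enters in two ways:
    \<open>y \<in> I\<close> puts \<open>?P\<close> into \<open>K\<close>, and
    \<open>y + 1 \<notin> I\<close> keeps \<open>- ?N\<close> out of it.\<close>
  have P: "?P \<in> K" if "?N = {}"
  proof -
    have "x + ind_vec ?P \<le> y" unfolding less_eq_vec_def
    proof
      fix j
      have "\<not> ?u j < 0" using that by blast
      then show "(x + ind_vec ?P) $ j \<le> y $ j" by (simp add: ind_vec_def)
    qed
    then show ?thesis using ideal[OF y(1)] by (simp add: K_def)
  qed
  have Nn: "- ?N \<notin> K" if "?P = {}"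
  proof
    assume "- ?N \<in> K"
    moreover have "y + 1 \<le> x + ind_vec (- ?N)" unfolding less_eq_vec_def
    proof
      fix j
      have "\<not> ?u j > 0" using that by blast
      then show "(y + 1) $ j \<le> (x + ind_vec (- ?N)) $ j" by (simp add: ind_vec_def)
    qed
    ultimately show False using ideal y(2) by (auto simp: K_def)
  qed
  have ne: "?P \<noteq> {} \<or> ?N \<noteq> {}"
  proof (rule ccontr)
    assume "\<not> ?thesis"
    then have "\<not> ?u j > 0 \<and> \<not> ?u j < 0" for j by blast
    then have "y $ j = x $ j" for j by (metis diff_gt_0_iff_gt diff_less_0_iff_less linorder_neqE_linordered_idom)
    then show False using False by (simp add: vec_eq_iff)
  qed
  show ?thesis
  proof (rule tvar.exact_away[where u = ?u])
    show "away x y j b = (if b then ?u j \<le> 0 else ?u j \<ge> 0)" for j b by (simp add: away_def)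
    show "?N \<noteq> {} \<or> (?P \<noteq> {} \<and> ?P \<in> K)" using P ne by blast
    show "?P \<noteq> {} \<or> (?N \<noteq> {} \<and> - ?N \<notin> K)" using Nn ne by blast
  qed (use K_down f in auto)
qed

lemma exact_coord_end:
  fixes f :: "'n set \<Rightarrow> 'n set \<Rightarrow> ('n, 'k::field) poly_ring"
  assumes f: "PP (2 * int CARD('n) - 2) f" "phi K f = (\<Sum>j\<in>UNIV. tvar j * s j)"
  shows "\<exists>g. PP (2 * int CARD('n) - 3) g \<and> PP (2 * int CARD('n) - 2) (restr K (\<lambda>Y Z. f Y Z - tdd (away x x) g Y Z))"
proof -
  have aw: "away x x = (\<lambda>j b. True)" by (simp add: away_def fun_eq_iff)
  show ?thesis
    unfolding aw
    by (rule local_cube_complex.exact_end[OF local_cube_complex_tvar _ _ _ f])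
       (use K_down K_empty K_UNIV in auto)
qed

end

section \<open>The algebra of the Cubist subset: local units, grading, radical\<close>

definition vcar :: "(int ^ 'n) set \<Rightarrow> ('n::finite, 'k::field) valg set" where
  "vcar X = valg.span {videm x * v * videm y |x v y. x \<in> X \<and> y \<in> X}"

definition vrad :: "(int ^ 'n) set \<Rightarrow> ('n::finite, 'k::field) valg set" where
  "vrad X = valg.span (\<Union>n\<in>{0<..}. vcar X \<inter> vdegree n)"

lemma V_alg_simps [simp]:
  "ascale (V_alg X) = vscale" "acarrier (V_alg X) = vcar X" "vertices (V_alg X) = X"
  "idem (V_alg X) = videm" "adegree (V_alg X) n = vcar X \<inter> vdegree n"
  by (simp_all add: V_alg_def vcar_def Let_def)

lemma vcar_0 [simp]: "0 \<in> vcar X"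
  by (simp add: vcar_def valg.span_zero)

lemma vcar_add: "a \<in> vcar X \<Longrightarrow> b \<in> vcar X \<Longrightarrow> a + b \<in> vcar X"
  by (simp add: vcar_def valg.span_add)

lemma vcar_vscale: "a \<in> vcar X \<Longrightarrow> vscale c a \<in> vcar X"
  by (simp add: vcar_def valg.span_scale)

lemma vcar_sum: "(\<And>i. i \<in> A \<Longrightarrow> f i \<in> vcar X) \<Longrightarrow> (\<Sum>i\<in>A. f i) \<in> vcar X"
  by (simp add: vcar_def valg.span_sum)

lemma videm_videm: "videm x * videm y = (if x = y then videm x else 0)"
  by (simp add: videm_eq_vword vword_mult)

lemma vcar_base: "x \<in> X \<Longrightarrow> y \<in> X \<Longrightarrow> videm x * v * videm y \<in> vcar X"
  unfolding vcar_def by (rule valg.span_base) blast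

lemma vcar_vword:
  assumes "x \<in> X" "foldl step x ws \<in> X"
  shows "vword x ws \<in> vcar X"
proof -
  have "vword x ws = videm x * vword x ws * videm (foldl step x ws)"
    by (simp add: videm_eq_vword vword_mult)
  then show ?thesis using vcar_base[OF assms] by metis
qed

lemma vcar_eta: "y \<in> X \<Longrightarrow> z \<in> X \<Longrightarrow> eta y z s \<in> vcar X"
  using vcar_base[of y X z "eta y z s"] by (simp add: eta_idem)

lemma vcar_induct [consumes 1, case_names zero scale add base]:
  assumes "a \<in> vcar X" "P 0" "\<And>c a. P a \<Longrightarrow> P (vscale c a)" "\<And>a b. P a \<Longrightarrow> P b \<Longrightarrow> P (a + b)"
    "\<And>x v y. x \<in> X \<Longrightarrow> y \<in> X \<Longrightarrow> P (videm x * v * videm y)"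
  shows "P a"
  using assms(1) unfolding vcar_def
proof (induction rule: valg.span_induct_alt)
  case base
  show ?case by (rule assms(2))
next
  case (step c a b)
  then obtain x v y where "a = videm x * v * videm y" "x \<in> X" "y \<in> X" by blast
  then show ?case using step assms by auto
qed

lemma vcar_mult:
  assumes "a \<in> vcar X" "b \<in> vcar X"
  shows "a * b \<in> vcar X"
  using assms(1)
proof (induction rule: vcar_induct)
  case (base x v y)
  note xy = base
  show ?case using assms(2)
  proof (induction rule: vcar_induct)
    case (base x' v' y')
    have "videm x * v * videm y * (videm x' * v' * videm y') = videm x * (v * videm y * videm x' * v') * videm y'"
      by (simp add: mult.assoc)
    then show ?case using vcar_base[of x X y'] xy base by metis
  qed (simp_all add: vscale_mult_right distrib_left vcar_vscale vcar_add)
qed (simp_all add: vscale_mult_left distrib_right vcar_vscale vcar_add)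

lemma vcar_videm: "x \<in> X \<Longrightarrow> videm x \<in> vcar X"
  unfolding videm_eq_vword by (rule vcar_vword) simp_all

text \<open>A finite sum of idempotents acts as a left unit on \<open>a\<close>. Admitting all
  larger \<open>Y'\<close> lets several elements share one such sum.\<close>

lemma vcar_left_decomp:
  assumes "a \<in> vcar X"
  shows "\<exists>Y\<subseteq>X. finite Y \<and> (\<forall>Y'. finite Y' \<longrightarrow> Y \<subseteq> Y' \<longrightarrow> (\<Sum>y\<in>Y'. videm y * a) = a)"
  using assms
proof (induction rule: vcar_induct)
  case zero
  show ?case by (intro exI[of _ "{}"]) simp
next
  case (scale c a)
  then obtain Y where "Y \<subseteq> X" "finite Y" "\<And>Y'. finite Y' \<Longrightarrow> Y \<subseteq> Y' \<Longrightarrow> (\<Sum>y\<in>Y'. videm y * a) = a" by blast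
  then show ?case by (intro exI[of _ Y]) (simp add: vscale_mult_right flip: valg.scale_sum_right)
next
  case (add a b)
  then obtain Y1 Y2 where "Y1 \<subseteq> X" "finite Y1" "\<And>Y'. finite Y' \<Longrightarrow> Y1 \<subseteq> Y' \<Longrightarrow> (\<Sum>y\<in>Y'. videm y * a) = a"
    "Y2 \<subseteq> X" "finite Y2" "\<And>Y'. finite Y' \<Longrightarrow> Y2 \<subseteq> Y' \<Longrightarrow> (\<Sum>y\<in>Y'. videm y * b) = b" by metis
  then show ?case by (intro exI[of _ "Y1 \<union> Y2"]) (simp add: distrib_left sum.distrib)
next
  case (base x v y)
  have "(\<Sum>z\<in>Y'. videm z * (videm x * v * videm y)) = videm x * v * videm y" if "finite Y'" "{x} \<subseteq> Y'" for Y'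
  proof -
    have "(\<Sum>z\<in>Y'. videm z * (videm x * v * videm y)) = (\<Sum>z\<in>Y'. if z = x then videm x * v * videm y else 0)"
      by (rule sum.cong) (auto simp: mult.assoc[symmetric] videm_videm)
    then show ?thesis using that by simp
  qed
  then show ?case using base by (intro exI[of _ "{x}"]) auto
qed

lemma vword_vdegree: "vword x ws \<in> vdegree (length ws)"
  unfolding vdegree_def vword_def by (rule valg.span_base) blast

lemma vdegree_0 [simp]: "0 \<in> vdegree n"
  by (simp add: vdegree_def valg.span_zero)

lemma vdegree_add: "a \<in> vdegree n \<Longrightarrow> b \<in> vdegree n \<Longrightarrow> a + b \<in> vdegree n"
  by (simp add: vdegree_def valg.span_add)

lemma vdegree_vscale: "a \<in> vdegree n \<Longrightarrow> vscale c a \<in> vdegree n"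
  by (simp add: vdegree_def valg.span_scale)

lemma vdegree_sum: "(\<And>i. i \<in> A \<Longrightarrow> f i \<in> vdegree n) \<Longrightarrow> (\<Sum>i\<in>A. f i) \<in> vdegree n"
  by (simp add: vdegree_def valg.span_sum)

lemma vdegree_induct [consumes 1, case_names zero step]:
  assumes "a \<in> vdegree n" "P 0" "\<And>c x ws b. length ws = n \<Longrightarrow> P b \<Longrightarrow> P (vscale c (vword x ws) + b)"
  shows "P a"
  using assms(1) unfolding vdegree_def
proof (induction rule: valg.span_induct_alt)
  case base
  show ?case by (rule assms(2))
next
  case (step c a b)
  then show ?case using assms(3) by (auto simp: vword_def)
qed

lemma vdegree_mult:
  fixes a b :: "('n::finite, 'k::field) valg"
  assumes "a \<in> vdegree m" "b \<in> vdegree n"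
  shows "a * b \<in> vdegree (m + n)"
  using assms(1)
proof (induction rule: vdegree_induct)
  case (step c x ws a')
  note outer = step
  have "vword x ws * b \<in> vdegree (m + n)" using assms(2)
  proof (induction rule: vdegree_induct)
    case (step c' x' ws' b')
    have "(vword x ws * vword x' ws' :: ('n, 'k) valg) \<in> vdegree (m + n)"
      using vword_vdegree[of x "ws @ ws'"] step outer by (auto simp: vword_mult)
    then show ?case using step by (simp add: distrib_left vscale_mult_right vdegree_add vdegree_vscale)
  qed simp
  then show ?case using step by (simp add: distrib_right vscale_mult_left vdegree_add vdegree_vscale)
qed simp

lemma videm_vdegree: "videm x \<in> vdegree 0"
  using vword_vdegree[of x "[]"] by (simp add: videm_eq_vword)

lemma vrad_0 [simp]: "0 \<in> vrad X"
  by (simp add: vrad_def valg.span_zero)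

lemma vrad_add: "a \<in> vrad X \<Longrightarrow> b \<in> vrad X \<Longrightarrow> a + b \<in> vrad X"
  by (simp add: vrad_def valg.span_add)

lemma vrad_vscale: "a \<in> vrad X \<Longrightarrow> vscale c a \<in> vrad X"
  by (simp add: vrad_def valg.span_scale)

lemma vrad_sum: "(\<And>i. i \<in> A \<Longrightarrow> f i \<in> vrad X) \<Longrightarrow> (\<Sum>i\<in>A. f i) \<in> vrad X"
  by (simp add: vrad_def valg.span_sum)

lemma vrad_base: "a \<in> vcar X \<Longrightarrow> a \<in> vdegree n \<Longrightarrow> n > 0 \<Longrightarrow> a \<in> vrad X"
  unfolding vrad_def by (rule valg.span_base) auto

lemma vrad_induct [consumes 1, case_names zero step]:
  assumes "a \<in> vrad X" "P 0"
    "\<And>c a b n. a \<in> vcar X \<Longrightarrow> a \<in> vdegree n \<Longrightarrow> n > 0 \<Longrightarrow> P b \<Longrightarrow> P (vscale c a + b)"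
  shows "P a"
  using assms(1) unfolding vrad_def
proof (induction rule: valg.span_induct_alt)
  case base
  show ?case by (rule assms(2))
next
  case (step c a b)
  then show ?case using assms(3) by auto
qed

text \<open>The left factor need not be homogeneous; it is expanded into words, each adding its own
  length to the degree.\<close>

lemma vcar_mult_vrad_base:
  assumes "a \<in> vcar X" "b \<in> vcar X" "b \<in> vdegree n" "n > 0"
  shows "a * b \<in> vrad X"
  using assms(1)
proof (induction rule: vcar_induct)
  case (base x v y)
  show ?case
  proof (induction v rule: valg_induct)
    case (vword c z ws)
    let ?a = "videm x * vword z ws * videm y"
    have "?a \<in> vdegree (length ws)"
      using vdegree_mult[OF vdegree_mult[OF videm_vdegree vword_vdegree] videm_vdegree] by simp
    then have "?a * b \<in> vdegree (length ws + n)" using assms(3) by (rule vdegree_mult)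
    moreover have "?a * b \<in> vcar X" using base assms(2) by (intro vcar_mult vcar_base)
    ultimately have "?a * b \<in> vrad X" using vrad_base[of "?a * b" X "length ws + n"] assms(4) by simp
    then show ?case by (simp add: vscale_mult_left vscale_mult_right vrad_vscale)
  qed (simp_all add: distrib_left distrib_right vrad_add)
qed (simp_all add: vscale_mult_left distrib_right vrad_vscale vrad_add)

lemma vcar_mult_vrad:
  assumes "a \<in> vcar X" "b \<in> vrad X"
  shows "a * b \<in> vrad X"
  using assms(2)
  by (induction rule: vrad_induct)
     (use assms(1) in \<open>simp_all add: distrib_left vscale_mult_right vrad_add vrad_vscale vcar_mult_vrad_base\<close>)

text \<open>A nonempty closed path uses some arrow, hence also the opposite one, so it contains a
  loop.\<close>

lemma loops_mon_ideal:
  assumes "foldl step x ws = x" "ws \<noteq> []"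
  shows "\<exists>s. loops_mon (mset ws) = (\<Sum>j\<in>UNIV. tvar j * s j :: ('n::finite, 'k::field) poly_ring)"
proof -
  obtain a where a: "a \<in> set ws" using assms(2) by (cases ws) auto
  define j where "j = (case a of Up j \<Rightarrow> j | Down j \<Rightarrow> j)"
  have "count (mset ws) (Up j) = count (mset ws) (Down j)"
    using foldl_step_nth[of x ws j] assms(1) by simp
  moreover have "count (mset ws) a > 0" using a by (simp only: count_greater_zero_iff set_mset_mset)
  ultimately have "count (mset ws) (Up j) > 0 \<and> count (mset ws) (Down j) > 0"
    by (cases a) (auto simp: j_def)
  then obtain M where M: "mset ws = add_mset (Down j) (add_mset (Up j) M)"
    by (metis arrow.distinct(1) count_add_mset count_greater_zero_iff multi_member_split)
  have "loops_mon (mset ws) = (\<Sum>l\<in>UNIV. tvar l * (if l = j then loops_mon M else 0) :: ('n, 'k) poly_ring)"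
    by (simp add: M loops_mon_add_loop if_distrib cong: if_cong)
  then show ?thesis by (rule exI[of _ "\<lambda>l. if l = j then loops_mon M else 0"])
qed

lemma psi_vrad:
  fixes b :: "('n::finite, 'k::field) valg"
  assumes "b \<in> vrad X"
  shows "\<exists>s. psi x x b = (\<Sum>j\<in>UNIV. tvar j * s j)"
proof -
  have sub: "\<exists>s. c * (\<Sum>j\<in>UNIV. tvar j * s1 j) + (\<Sum>j\<in>UNIV. tvar j * s2 j) = (\<Sum>j\<in>UNIV. tvar j * s j)"
    for s1 s2 and c :: "('n, 'k) poly_ring"
    by (rule exI[of _ "\<lambda>j. c * s1 j + s2 j"]) (simp add: distrib_left sum.distrib sum_distrib_left mult_ac)
  have ideal0: "\<exists>s. (0 :: ('n, 'k) poly_ring) = (\<Sum>j\<in>UNIV. tvar j * s j)"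
    by (rule exI[of _ "\<lambda>j. 0"]) simp
  have deg: "\<exists>s. psi x x a = (\<Sum>j\<in>UNIV. tvar j * s j)" if "a \<in> vdegree n" "n > 0" for a :: "('n, 'k) valg" and n
    using that(1)
  proof (induction rule: vdegree_induct)
    case zero
    show ?case unfolding psi_zero by (rule ideal0)
  next
    case (step c z ws b)
    have "\<exists>s. psi x x (vword z ws) = (\<Sum>j\<in>UNIV. tvar j * s j :: ('n, 'k) poly_ring)"
    proof (cases "z = x \<and> foldl step z ws = x")
      case True
      then show ?thesis using loops_mon_ideal[of x ws] step.hyps that(2) by (auto simp: psi_vword)
    next
      case False
      then show ?thesis using ideal0 by (auto simp: psi_vword)
    qed
    then obtain s1 where s1: "psi x x (vword z ws) = (\<Sum>j\<in>UNIV. tvar j * s1 j :: ('n, 'k) poly_ring)" by blast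
    obtain s2 where s2: "psi x x b = (\<Sum>j\<in>UNIV. tvar j * s2 j)" using step.IH by blast
    show ?case unfolding psi_add psi_vscale s1 s2 by (rule sub)
  qed
  show ?thesis using assms
  proof (induction rule: vrad_induct)
    case zero
    show ?case unfolding psi_zero by (rule ideal0)
  next
    case (step c a b n)
    then obtain s1 where s1: "psi x x a = (\<Sum>j\<in>UNIV. tvar j * s1 j)" using deg[of a n] by blast
    obtain s2 where s2: "psi x x b = (\<Sum>j\<in>UNIV. tvar j * s2 j)" using step.IH by blast
    show ?case unfolding psi_add psi_vscale s1 s2 by (rule sub)
  qed
qed

lemma proj_mod_V_alg:
  assumes w: "w \<in> X"
  shows "mcarrier (proj_mod (V_alg X) w) = {v \<in> vcar X :: ('n::finite, 'k::field) valg set. v * videm w = v}"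
    "mdegree (proj_mod (V_alg X) w) k = (if k < 0 then {0} else {v \<in> vcar X :: ('n, 'k) valg set. v \<in> vdegree (nat k) \<and> v * videm w = v})"
proof -
  have idem: "a * videm w * videm w = a * videm w" for a :: "('n, 'k) valg" by (simp add: mult.assoc videm_videm)
  have car: "a * videm w \<in> vcar X" if "a \<in> vcar X" for a :: "('n, 'k) valg"
    using that w by (intro vcar_mult vcar_videm)
  have deg: "a * videm w \<in> vdegree n" if "a \<in> vdegree n" for a :: "('n, 'k) valg" and n
    using vdegree_mult[OF that videm_vdegree] by simp
  have set_eq: "{a * videm w |a. a \<in> S} = {v \<in> S. v * videm w = v}"
    if "\<And>a. a \<in> S \<Longrightarrow> a * videm w \<in> S" for S :: "('n, 'k) valg set"
    using that idem by (auto, metis)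
  show "mcarrier (proj_mod (V_alg X) w) = {v \<in> vcar X :: ('n, 'k) valg set. v * videm w = v}"
    using set_eq[of "vcar X"] car by (simp add: proj_mod_def)
  show "mdegree (proj_mod (V_alg X) w) k = (if k < 0 then {0} else {v \<in> vcar X :: ('n, 'k) valg set. v \<in> vdegree (nat k) \<and> v * videm w = v})"
    using set_eq[of "vcar X \<inter> vdegree (nat k)"] car deg by (simp add: proj_mod_def)
qed

lemma proj_mod_simps [simp]:
  "mzero (proj_mod A w) = 0" "madd (proj_mod A w) = (+)" "mscale (proj_mod A w) = ascale A" "mact (proj_mod A w) = (*)"
  by (simp_all add: proj_mod_def)

lemma lookup_map_mult: "Poly_Mapping.lookup (Poly_Mapping.map ((*) a) u) l = a * Poly_Mapping.lookup u l"
  for u :: "'i \<Rightarrow>\<^sub>0 'a::ring"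
  by (simp add: map.rep_eq when_def)

lemma lookup_map_vscale: "Poly_Mapping.lookup (Poly_Mapping.map (vscale c) u) l = vscale c (Poly_Mapping.lookup u l)"
  by (simp add: map.rep_eq when_def)

lemma coset_cong:
  fixes R :: "('n::finite, 'k::field) valg set"
  assumes "\<And>a b. a \<in> R \<Longrightarrow> b \<in> R \<Longrightarrow> a + b \<in> R" "\<And>a. a \<in> R \<Longrightarrow> - a \<in> R" "v - u \<in> R"
  shows "(+) u ` R = (+) v ` R"
proof -
  have "v + r \<in> (+) u ` R" if "r \<in> R" for r
    by (rule image_eqI[of _ _ "(v - u) + r"]) (use assms that in auto)
  moreover have "u + r \<in> (+) v ` R" if "r \<in> R" for r
  proof (rule image_eqI[of _ _ "- (v - u) + r"])
    show "- (v - u) + r \<in> R" by (intro assms that)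
  qed simp
  ultimately show ?thesis by blast
qed

lemma asm_cong: "(\<And>i. i \<in> J \<Longrightarrow> s i = s' i) \<Longrightarrow> asm J s = asm J s'"
  by (simp add: asm_def fun_eq_iff cong: sum.cong)

lemma coeff_const_phi: "coeff_const (phi K (bfun i)) = phi K (bfun i)"
  by (simp add: phi_def coeff_const_sum coeff_const_minus_one_power coeff_const_bfun)

section \<open>The resolution of a simple module\<close>

text \<open>For \<open>n > 2 * CARD('n) - 2\<close> the bound is negative, \<open>bindex\<close> and
  hence \<open>J n\<close> are empty, and the term is zero; integer bounds avoid a case
  distinction.\<close>

locale cubist_resolution = cubist_point I x for I :: "(int ^ 'n::finite) set" and x +
  fixes J :: "nat \<Rightarrow> 'n cube_index set" and rho :: "nat \<Rightarrow> 'n cube_index \<Rightarrow> 'n set \<Rightarrow> 'n set \<Rightarrow> 'k::field"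
    and X :: "(int ^ 'n) set"
  assumes X: "X = {x. x \<in> I \<and> x + 1 \<notin> I}"
    and basis: "quot_basis (2 * int CARD('n) - 2 - int n) K (J n) (rho n)"
begin

lemma xX: "x \<in> X"
  using xI xI' by (simp add: X)

lemma cpos_X: "i \<in> J n \<Longrightarrow> cpos x i \<in> X"
  using quot_basis_pos[OF basis] by (simp add: X)

lemma rho_pos: "i \<in> J n \<Longrightarrow> rho n i Y Z \<noteq> 0 \<Longrightarrow> posn x Y Z = cpos x i"
  using basis[of n] unfolding quot_basis_def cpos_def by (metis posn_Int)

lemma finite_J: "finite (J n)"
  by (rule finite)

definition kappa :: "nat \<Rightarrow> 'n cube_index \<Rightarrow> 'n cube_index \<Rightarrow> ('n, 'k) valg" where
  "kappa n i i' = kap x (rho n i') i"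

lemma kappa_term:
  assumes "i \<in> J (Suc n)" "i' \<in> J n"
  shows "vscale (rho n i' Y Z * (sg l Z * bfun i Y (toggle l Z))) (vword (posn x Y (toggle l Z)) [arr l Y Z]) \<in> vcar X \<inter> vdegree 1
    \<and> vscale (rho n i' Y Z * (sg l Z * bfun i Y (toggle l Z))) (vword (posn x Y (toggle l Z)) [arr l Y Z]) * videm (cpos x i')
      = vscale (rho n i' Y Z * (sg l Z * bfun i Y (toggle l Z))) (vword (posn x Y (toggle l Z)) [arr l Y Z])"
proof (cases "rho n i' Y Z = 0 \<or> bfun i Y (toggle l Z) = (0 :: 'k)")
  case True
  then show ?thesis by auto
next
  case False
  then have w': "posn x Y Z = cpos x i'" and w: "posn x Y (toggle l Z) = cpos x i"
    using rho_pos assms bfun_cpos by blast+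
  have st: "step (posn x Y (toggle l Z)) (arr l Y Z) = cpos x i'" by (simp add: step_arr w')
  have "(vword (posn x Y (toggle l Z)) [arr l Y Z] :: ('n, 'k) valg) \<in> vcar X"
    by (rule vcar_vword) (use st w cpos_X assms in auto)
  moreover have "(vword (posn x Y (toggle l Z)) [arr l Y Z] :: ('n, 'k) valg) \<in> vdegree 1"
    using vword_vdegree[of "posn x Y (toggle l Z)" "[arr l Y Z]"] by simp
  ultimately show ?thesis
    using st by (simp add: vcar_vscale vdegree_vscale vscale_mult_left videm_eq_vword vword_mult)
qed

lemma kappa_props:
  assumes "i \<in> J (Suc n)" "i' \<in> J n"
  shows "kappa n i i' \<in> vcar X" "kappa n i i' \<in> vdegree 1" "kappa n i i' * videm (cpos x i') = kappa n i i'"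
  using kappa_term[OF assms] unfolding kappa_def kap_def
  by (auto intro!: vcar_sum vdegree_sum sum.cong simp: sum_distrib_right)

definition fam :: "nat \<Rightarrow> ('n cube_index \<Rightarrow> ('n, 'k) valg) \<Rightarrow> bool" where
  "fam n v \<longleftrightarrow> (\<forall>i\<in>J n. v i \<in> vcar X \<and> v i * videm (cpos x i) = v i)"

text \<open>A row vector times the matrix \<open>kappa\<close>: right multiplication commutes with
  the left module action.\<close>

definition dfam :: "nat \<Rightarrow> ('n cube_index \<Rightarrow> ('n, 'k) valg) \<Rightarrow> 'n cube_index \<Rightarrow> ('n, 'k) valg" where
  "dfam n v i' = (\<Sum>i\<in>J (Suc n). v i * kappa n i i')"

lemma fam_dfam: "fam (Suc n) v \<Longrightarrow> fam n (dfam n v)"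
  unfolding fam_def dfam_def
  by (auto intro!: vcar_sum vcar_mult kappa_props sum.cong simp: sum_distrib_right mult.assoc kappa_props)

lemma psi_dfam:
  assumes "i' \<in> J n"
  shows "psi y (cpos x i') (dfam n v i') = coord (rho n i') (tdd (away x y) (asm (J (Suc n)) (\<lambda>i. psi y (cpos x i) (v i))))"
  unfolding dfam_def kappa_def by (rule psi_sum_kap) (use rho_pos assms in blast)

lemma dfam_eta:
  assumes "i' \<in> J n"
  shows "dfam n (\<lambda>i. eta y (cpos x i) (s i)) i' = eta y (cpos x i') (coord (rho n i') (tdd (away x y) (asm (J (Suc n)) s)))"
  unfolding dfam_def kappa_def by (rule eta_sum_kap) (use rho_pos assms in blast)

lemma dfam_sum: "dfam n (\<lambda>i. \<Sum>y\<in>Y. v y i) i' = (\<Sum>y\<in>Y. dfam n (v y) i')"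
  unfolding dfam_def by (simp add: sum_distrib_right) (rule sum.swap)

lemma basis_Suc: "quot_basis (2 * int CARD('n) - 2 - int (Suc n) + 1) K (J n) (rho n)"
proof -
  have "2 * int CARD('n) - 2 - int (Suc n) + 1 = 2 * int CARD('n) - 2 - int n" by simp
  then show ?thesis using basis[of n] by (simp only:)
qed

lemma basis_pred: "quot_basis (2 * int CARD('n) - 2 - int n - 1) K (J (Suc n)) (rho (Suc n))"
proof -
  have "2 * int CARD('n) - 2 - int n - 1 = 2 * int CARD('n) - 2 - int (Suc n)" by simp
  then show ?thesis using basis[of "Suc n"] by (simp only:)
qed

lemma vcar_eqI:
  fixes v v' :: "('n, 'k) valg"
  assumes "v \<in> vcar X" "v' \<in> vcar X" "v * videm w = v" "v' * videm w = v'"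
    "\<And>y. y \<in> X \<Longrightarrow> psi y w v = psi y w v'"
  shows "v = v'"
proof -
  obtain Y where Y: "Y \<subseteq> X" "finite Y" "\<And>Y'. finite Y' \<Longrightarrow> Y \<subseteq> Y' \<Longrightarrow> (\<Sum>y\<in>Y'. videm y * v) = v"
    using vcar_left_decomp[OF assms(1)] by blast
  obtain Y' where Y': "Y' \<subseteq> X" "finite Y'" "\<And>Y''. finite Y'' \<Longrightarrow> Y' \<subseteq> Y'' \<Longrightarrow> (\<Sum>y\<in>Y''. videm y * v') = v'"
    using vcar_left_decomp[OF assms(2)] by blast
  have "v = (\<Sum>y\<in>Y \<union> Y'. videm y * v)" using Y Y' by simp
  also have "\<dots> = (\<Sum>y\<in>Y \<union> Y'. videm y * v')"
  proof (rule sum.cong)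
    fix y assume "y \<in> Y \<union> Y'"
    then have "psi y w v = psi y w v'" using Y Y' assms(5) by blast
    then have "videm y * v * videm w = videm y * v' * videm w" by (metis eta_psi)
    then show "videm y * v = videm y * v'" using assms(3,4) by (simp add: mult.assoc)
  qed simp
  also have "\<dots> = v'" using Y Y' by simp
  finally show ?thesis .
qed

lemma dfam_dfam:
  assumes v: "fam (Suc (Suc n)) v" and i: "i \<in> J n"
  shows "dfam n (dfam (Suc n) v) i = 0"
proof (rule vcar_eqI[where w = "cpos x i"])
  have f: "fam n (dfam n (dfam (Suc n) v))" using v by (intro fam_dfam)
  then show "dfam n (dfam (Suc n) v) i \<in> vcar X"
    "dfam n (dfam (Suc n) v) i * videm (cpos x i) = dfam n (dfam (Suc n) v) i"
    using i by (auto simp: fam_def)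
  fix y
  let ?f = "asm (J (Suc (Suc n))) (\<lambda>i. psi y (cpos x i) (v i))"
  have "psi y (cpos x i) (dfam n (dfam (Suc n) v) i)
     = coord (rho n i) (tdd (away x y) (asm (J (Suc n)) (\<lambda>i. coord (rho (Suc n) i) (tdd (away x y) ?f))))"
    unfolding psi_dfam[OF i]
    by (rule arg_cong[where f = "\<lambda>a. coord (rho n i) (tdd (away x y) a)"], rule asm_cong) (rule psi_dfam)
  also have "\<dots> = 0"
    by (rule coord_tdd_tdd[OF basis basis_Suc _ i]) (rule quot_basis_PP_asm[OF basis_pred])
  finally show "psi y (cpos x i) (dfam n (dfam (Suc n) v) i) = psi y (cpos x i) 0" by simp
qed simp_all

text \<open>Lifts are known for one source \<open>y\<close> at a time. Local units leave finitely
  many \<open>y\<close> to consider; \<open>eta\<close> turns the coordinate lifts into elements,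
  which are added up.\<close>

lemma family_lift:
  assumes v: "fam n v"
    and ex: "\<And>y. y \<in> X \<Longrightarrow> \<exists>g. \<forall>i\<in>J n. psi y (cpos x i) (v i) = coord (rho n i) (tdd (away x y) (asm (J (Suc n)) g))"
  shows "\<exists>v'. fam (Suc n) v' \<and> (\<forall>i\<in>J n. dfam n v' i = v i)"
proof -
  have "\<forall>i\<in>J n. \<exists>Y\<subseteq>X. finite Y \<and> (\<forall>Y'. finite Y' \<longrightarrow> Y \<subseteq> Y' \<longrightarrow> (\<Sum>y\<in>Y'. videm y * v i) = v i)"
    using v vcar_left_decomp unfolding fam_def by blast
  then obtain Y where Y: "\<And>i. i \<in> J n \<Longrightarrow> Y i \<subseteq> X" "\<And>i. i \<in> J n \<Longrightarrow> finite (Y i)"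
    "\<And>i Y'. i \<in> J n \<Longrightarrow> finite Y' \<Longrightarrow> Y i \<subseteq> Y' \<Longrightarrow> (\<Sum>y\<in>Y'. videm y * v i) = v i"
    by metis
  define Y0 where "Y0 = (\<Union>i\<in>J n. Y i)"
  have Y0: "Y0 \<subseteq> X" "finite Y0" using Y finite_J by (auto simp: Y0_def)
  obtain g where g: "\<And>y i. y \<in> X \<Longrightarrow> i \<in> J n \<Longrightarrow>
      psi y (cpos x i) (v i) = coord (rho n i) (tdd (away x y) (asm (J (Suc n)) (g y)))"
    using ex by metis
  define v' where "v' i = (\<Sum>y\<in>Y0. eta y (cpos x i) (g y i))" for i
  have "fam (Suc n) v'" unfolding fam_def
  proof (intro ballI conjI)
    fix i assume i: "i \<in> J (Suc n)"
    show "v' i \<in> vcar X" unfolding v'_def using Y0 cpos_X[OF i] by (intro vcar_sum vcar_eta) auto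
    have "eta y (cpos x i) s * videm (cpos x i) = eta y (cpos x i) s" for y and s :: "('n, 'k) poly_ring"
      by (subst (1 2) eta_idem[symmetric]) (simp add: mult.assoc videm_videm)
    then show "v' i * videm (cpos x i) = v' i" by (simp add: v'_def sum_distrib_right)
  qed
  moreover have "dfam n v' i = v i" if i: "i \<in> J n" for i
  proof -
    have "dfam n v' i = (\<Sum>y\<in>Y0. eta y (cpos x i) (coord (rho n i) (tdd (away x y) (asm (J (Suc n)) (g y)))))"
      unfolding v'_def dfam_sum by (simp add: dfam_eta[OF i])
    also have "\<dots> = (\<Sum>y\<in>Y0. videm y * v i * videm (cpos x i))"
    proof (rule sum.cong)
      fix y assume "y \<in> Y0"
      then have "psi y (cpos x i) (v i) = coord (rho n i) (tdd (away x y) (asm (J (Suc n)) (g y)))"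
        using g i Y0 by blast
      from this[symmetric] show "eta y (cpos x i) (coord (rho n i) (tdd (away x y) (asm (J (Suc n)) (g y)))) = videm y * v i * videm (cpos x i)"
        by (simp only: eta_psi)
    qed simp
    also have "\<dots> = (\<Sum>y\<in>Y0. videm y * v i)"
      using v i by (simp add: fam_def mult.assoc)
    also have "\<dots> = v i" by (rule Y(3)[OF i Y0(2)]) (use i in \<open>auto simp: Y0_def\<close>)
    finally show ?thesis .
  qed
  ultimately show ?thesis by blast
qed

lemma dfam_exact:
  assumes v: "fam (Suc n) v" and cyc: "\<And>i. i \<in> J n \<Longrightarrow> dfam n v i = 0"
  shows "\<exists>v'. fam (Suc (Suc n)) v' \<and> (\<forall>i\<in>J (Suc n). dfam (Suc n) v' i = v i)"
proof (rule family_lift[OF v])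
  fix y assume y: "y \<in> X"
  let ?s = "\<lambda>i. psi y (cpos x i) (v i)"
  have split: "PP (2 * int CARD('n) - 2 - int (Suc n) + 1) (restr K (tdd (away x y) (asm (J (Suc n)) ?s)))"
    by (rule quot_basis_split_tdd[OF basis basis_Suc]) (simp add: psi_dfam[symmetric] cyc)
  show "\<exists>g. \<forall>i\<in>J (Suc n). ?s i = coord (rho (Suc n) i) (tdd (away x y) (asm (J (Suc (Suc n))) g))"
    by (rule coord_lift[OF basis_pred basis], rule exact_coord[OF _ _ _ quot_basis_PP_asm[OF basis] split])
       (use y X in auto)
qed

abbreviation "phi_k i \<equiv> (phi K (bfun i) :: 'k)"

lemma phi_k_pos:
  assumes "phi_k i \<noteq> 0"
  shows "cpos x i = x"
proof -
  obtain Y where "(-1) ^ card Y * bfun i Y {} \<noteq> (0 :: 'k)"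
    using assms unfolding phi_def by (rule sum.not_neutral_contains_not_neutral)
  then have "posn x Y {} = cpos x i" by (intro bfun_cpos[where 'b = 'k]) auto
  moreover have "posn x Y {} = x" by (simp add: posn_def vec_eq_iff)
  ultimately show ?thesis by simp
qed

text \<open>The module map induced by \<open>phi\<close>. It has scalar entries, and only generators
  at \<open>x\<close> contribute, since \<open>phi\<close> reads functions at the empty
  \<open>Z\<close>.\<close>

definition aug :: "('n cube_index \<Rightarrow> ('n, 'k) valg) \<Rightarrow> ('n, 'k) valg" where
  "aug v = (\<Sum>i\<in>J 0. vscale (phi_k i) (v i))"

definition rad_x :: "('n, 'k) valg set" where
  "rad_x = {b \<in> vrad X. b * videm x = b}"

lemma aug_videm:
  assumes "fam 0 v"
  shows "aug v * videm x = aug v"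
proof -
  have "vscale (phi_k i) (v i) * videm x = vscale (phi_k i) (v i)" if "i \<in> J 0" for i
    using that assms phi_k_pos[of i] by (cases "phi_k i = 0") (auto simp: fam_def vscale_mult_left)
  then show ?thesis by (simp add: aug_def sum_distrib_right)
qed

lemma aug_vcar: "fam 0 v \<Longrightarrow> aug v \<in> vcar X"
  unfolding aug_def by (intro vcar_sum vcar_vscale) (simp add: fam_def)

lemma aug_dfam:
  assumes "fam 1 v"
  shows "aug (dfam 0 v) \<in> rad_x"
  unfolding rad_x_def mem_Collect_eq
proof
  show "aug (dfam 0 v) * videm x = aug (dfam 0 v)"
    using assms by (intro aug_videm fam_dfam) simp
  show "aug (dfam 0 v) \<in> vrad X"
    unfolding aug_def dfam_def
    by (intro vrad_sum vrad_vscale vcar_mult_vrad_base[where n = 1])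
       (use assms kappa_props[of _ 0] in \<open>auto simp: fam_def\<close>)
qed

text \<open>At \<open>y = x\<close> the coordinate of the augmentation is \<open>phi\<close> of the
  assembled function, and lying in the radical puts it into the ideal of the \<open>tvar j\<close>.
  At any other \<open>y\<close> the cycle condition is automatic by \<open>PP_top\<close>.\<close>

lemma aug_exact:
  assumes v: "fam 0 v" and rad: "aug v \<in> rad_x"
  shows "\<exists>v'. fam 1 v' \<and> (\<forall>i\<in>J 0. dfam 0 v' i = v i)"
  unfolding One_nat_def
proof (rule family_lift[OF v])
  fix y assume y: "y \<in> X"
  let ?N = "2 * int CARD('n) - 2 - int 0"
  let ?s = "\<lambda>i. psi y (cpos x i) (v i)"
  let ?f = "asm (J 0) ?s"
  have f: "PP ?N ?f" by (rule quot_basis_PP_asm[OF basis])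
  have "\<exists>g. PP (?N - 1) g \<and> PP ?N (restr K (\<lambda>Y Z. ?f Y Z - tdd (away x y) g Y Z))"
  proof (cases "y = x")
    case False
    have top: "?N + 1 = 2 * int CARD('n) - 1" by simp
    have "PP (?N + 1) (restr K (tdd (away x y) ?f))"
      unfolding top by (rule PP_top) (use tvar.PP_dd[OF f] in simp)
    then show ?thesis using False y f by (intro exact_coord) (auto simp: X)
  next
    case True
    have term_eq: "?s i * phi K (bfun i) = psi x x (vscale (phi_k i) (v i))" for i
    proof (cases "phi_k i = 0")
      case True
      then have "phi K (bfun i) = (0 :: ('n, 'k) poly_ring)" using coeff_const_phi[of K i, where 'b = 'k] by simp
      then show ?thesis using True by simp
    next
      case False
      then show ?thesis using phi_k_pos[of i] \<open>y = x\<close> by (simp add: psi_vscale coeff_const_phi mult.commute)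
    qed
    have "phi K ?f = (\<Sum>i\<in>J 0. ?s i * phi K (bfun i))"
      unfolding asm_def by (simp add: phi_sum phi_mult)
    also have "\<dots> = psi x x (aug v)" by (simp add: aug_def psi_sum term_eq)
    finally have phi: "phi K ?f = psi x x (aug v)" .
    obtain s where "psi x x (aug v) = (\<Sum>j\<in>UNIV. tvar j * s j)"
      using psi_vrad[of "aug v" X x] rad by (auto simp: rad_x_def)
    then have "\<exists>g. PP (2 * int CARD('n) - 3) g \<and> PP (2 * int CARD('n) - 2) (restr K (\<lambda>Y Z. ?f Y Z - tdd (away x x) g Y Z))"
      using f phi by (intro exact_coord_end) auto
    then show ?thesis using True by simp
  qed
  then show "\<exists>g. \<forall>i\<in>J 0. ?s i = coord (rho 0 i) (tdd (away x y) (asm (J (Suc 0)) g))"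
    by (rule coord_lift[OF basis_pred basis])
qed

text \<open>\<open>phi\<close> kills the functions that split; if it killed the basis as well it
  would vanish throughout, but it takes the value 1.\<close>

lemma phi_k_nonzero: "\<exists>i\<in>J 0. phi_k i \<noteq> 0"
proof (rule ccontr)
  assume none: "\<not> ?thesis"
  obtain f :: "'n set \<Rightarrow> 'n set \<Rightarrow> ('n, 'k) poly_ring" where f: "PP (2 * int CARD('n) - 2) f" "phi K f = 1"
    using phi_unit[OF K_empty K_UNIV] by blast
  have b: "quot_basis (2 * int CARD('n) - 2) K (J 0) (rho 0)" using basis[of 0] by simp
  let ?g = "asm (J 0) (\<lambda>i. coord (rho 0 i) f)"
  have "phi K (bfun i) = (0 :: ('n, 'k) poly_ring)" if "i \<in> J 0" for i
    using that none coeff_const_phi[of K i, where 'b = 'k] by auto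
  then have "phi K ?g = 0" unfolding asm_def by (simp add: phi_sum phi_mult)
  moreover have "phi K (\<lambda>Y Z. f Y Z - ?g Y Z) = 0"
    using phi_eq_0_iff[of "\<lambda>Y Z. f Y Z - ?g Y Z" K] quot_basis_approx[OF b f(1)] PP_diff[OF f(1) quot_basis_PP_asm[OF b]] by blast
  ultimately show False using f(2) by (simp add: phi_diff)
qed

lemma aug_surj:
  assumes "v \<in> vcar X" "v * videm x = v"
  shows "\<exists>u. fam 0 u \<and> (\<forall>i. i \<notin> J 0 \<longrightarrow> u i = 0) \<and> aug u = v"
proof -
  obtain i where i: "i \<in> J 0" "phi_k i \<noteq> 0" using phi_k_nonzero by blast
  let ?u = "\<lambda>l. if l = i then vscale (inverse (phi_k i)) v else 0"
  have "aug ?u = (\<Sum>l\<in>J 0. if l = i then v else 0)"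
    unfolding aug_def by (rule sum.cong) (use i in auto)
  then have "aug ?u = v" using i finite_J by simp
  moreover have "fam 0 ?u"
    using assms phi_k_pos[OF i(2)] by (auto simp: fam_def vcar_vscale vscale_mult_left)
  ultimately show ?thesis using i by (intro exI[of _ ?u]) auto
qed

end

lemma vrad_mult_videm:
  assumes "x \<in> X" "b \<in> vrad X"
  shows "b * videm x \<in> vrad X"
  using assms(2)
proof (induction rule: vrad_induct)
  case (step c a b n)
  have "a * videm x \<in> vrad X"
    using vrad_base[of "a * videm x" X "n + 0"] vdegree_mult[OF step(2) videm_vdegree] vcar_mult[OF step(1) vcar_videm[OF assms(1)]] step(3)
    by simp
  then show ?case using step by (simp add: distrib_right vscale_mult_left vrad_add vrad_vscale)
qed simp

lemma proj_sum_simps [simp]: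
  "mzero (proj_sum A m J y) = 0" "madd (proj_sum A m J y) = (+)"
  "mscale (proj_sum A m J y) = (\<lambda>c. Poly_Mapping.map (ascale A c))"
  "mact (proj_sum A m J y) = (\<lambda>a. Poly_Mapping.map ((*) a))"
  by (simp_all add: proj_sum_def)

section \<open>The resolution as a complex of graded modules\<close>

context cubist_resolution
begin

text \<open>Any injection into lists serves as the naming of basis elements required by \<^const>\<open>koszul\<close>.\<close>

definition enc :: "'n cube_index \<Rightarrow> ('n, 'k) valg list" where
  "enc i = replicate (to_nat i) 0"

definition dec :: "('n, 'k) valg list \<Rightarrow> 'n cube_index" where
  "dec l = from_nat (length l)"

lemma dec_enc [simp]: "dec (enc i) = i"
  by (simp add: dec_def enc_def)

lemma enc_eq_iff [simp]: "enc i = enc j \<longleftrightarrow> i = j"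
  by (metis dec_enc)

definition res :: "nat \<Rightarrow> ('k, ('n, 'k) valg, ('n, 'k) valg list \<Rightarrow>\<^sub>0 ('n, 'k) valg) gmod" where
  "res n = proj_sum (V_alg X) (int n) (enc ` J n) (\<lambda>l. cpos x (dec l))"

definition coords :: "(('n, 'k) valg list \<Rightarrow>\<^sub>0 ('n, 'k) valg) \<Rightarrow> 'n cube_index \<Rightarrow> ('n, 'k) valg" where
  "coords u i = Poly_Mapping.lookup u (enc i)"

definition pack :: "nat \<Rightarrow> ('n cube_index \<Rightarrow> ('n, 'k) valg) \<Rightarrow> ('n, 'k) valg list \<Rightarrow>\<^sub>0 ('n, 'k) valg" where
  "pack n v = (\<Sum>i\<in>J n. Poly_Mapping.single (enc i) (v i))"

definition dmat :: "nat \<Rightarrow> (('n, 'k) valg list \<Rightarrow>\<^sub>0 ('n, 'k) valg) \<Rightarrow> ('n, 'k) valg list \<Rightarrow>\<^sub>0 ('n, 'k) valg" where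
  "dmat n u = pack n (dfam n (coords u))"

definition eps :: "(('n, 'k) valg list \<Rightarrow>\<^sub>0 ('n, 'k) valg) \<Rightarrow> ('n, 'k) valg set" where
  "eps u = (+) (aug (coords u)) ` rad_x"

lemma coords_pack: "i \<in> J n \<Longrightarrow> coords (pack n v) i = v i"
  by (simp add: coords_def pack_def lookup_sum lookup_single when_def finite_J)

lemma lookup_pack_outside: "l \<notin> enc ` J n \<Longrightarrow> Poly_Mapping.lookup (pack n v) l = 0"
  by (auto simp: pack_def lookup_sum lookup_single when_def intro!: sum.neutral)

lemma keys_pack: "Poly_Mapping.keys (pack n v) \<subseteq> enc ` J n"
  by (metis in_keys_iff lookup_pack_outside subsetI)

lemma pack_eqI:
  assumes "\<And>i. i \<in> J n \<Longrightarrow> v i = coords u i" "Poly_Mapping.keys u \<subseteq> enc ` J n"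
  shows "pack n v = u"
proof (rule poly_mapping_eqI)
  fix l
  show "Poly_Mapping.lookup (pack n v) l = Poly_Mapping.lookup u l"
  proof (cases "l \<in> enc ` J n")
    case True
    then show ?thesis using assms(1) coords_pack by (auto simp: coords_def)
  next
    case False
    then show ?thesis using assms(2) by (auto simp: lookup_pack_outside in_keys_iff)
  qed
qed

lemma coords_simps [simp]:
  "coords (u + v) = (\<lambda>i. coords u i + coords v i)"
  "coords (Poly_Mapping.map ((*) a) u) = (\<lambda>i. a * coords u i)"
  "coords (Poly_Mapping.map (vscale c) u) = (\<lambda>i. vscale c (coords u i))"
  "coords 0 = (\<lambda>i. 0)"
  by (simp_all add: coords_def fun_eq_iff lookup_add lookup_map_mult lookup_map_vscale)

lemma dfam_linear:
  "dfam n (\<lambda>i. v i + w i) = (\<lambda>i. dfam n v i + dfam n w i)"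
  "dfam n (\<lambda>i. a * v i) = (\<lambda>i. a * dfam n v i)"
  "dfam n (\<lambda>i. vscale c (v i)) = (\<lambda>i. vscale c (dfam n v i))"
  by (simp_all add: dfam_def fun_eq_iff distrib_right sum.distrib sum_distrib_left mult.assoc
        vscale_mult_left valg.scale_sum_right)

lemma aug_linear:
  "aug (\<lambda>i. v i + w i) = aug v + aug w"
  "aug (\<lambda>i. a * v i) = a * aug v"
  "aug (\<lambda>i. vscale c (v i)) = vscale c (aug v)"
  by (simp_all add: aug_def valg.scale_right_distrib sum.distrib sum_distrib_left vscale_mult_right
        valg.scale_sum_right mult.commute)

lemma dfam_cong: "(\<And>i. i \<in> J (Suc n) \<Longrightarrow> v i = w i) \<Longrightarrow> dfam n v = dfam n w"
  by (simp add: dfam_def fun_eq_iff cong: sum.cong)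

lemma aug_cong: "(\<And>i. i \<in> J 0 \<Longrightarrow> v i = w i) \<Longrightarrow> aug v = aug w"
  by (simp add: aug_def cong: sum.cong)

lemma fam_cong: "(\<And>i. i \<in> J n \<Longrightarrow> v i = w i) \<Longrightarrow> fam n v = fam n w"
  by (simp add: fam_def)

lemma res_carrier: "u \<in> mcarrier (res n) \<longleftrightarrow> Poly_Mapping.keys u \<subseteq> enc ` J n \<and> fam n (coords u)"
  by (auto simp: res_def proj_sum_def fam_def coords_def proj_mod_V_alg cpos_X)

lemma res_degree: "u \<in> mdegree (res n) k \<longleftrightarrow> Poly_Mapping.keys u \<subseteq> enc ` J n \<and>
    (\<forall>i\<in>J n. if k < int n then coords u i = 0
       else coords u i \<in> vcar X \<and> coords u i \<in> vdegree (nat (k - int n)) \<and> coords u i * videm (cpos x i) = coords u i)"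
  by (auto simp: res_def proj_sum_def coords_def proj_mod_V_alg cpos_X)

lemma res_simps [simp]:
  "mzero (res n) = 0" "madd (res n) = (+)" "mscale (res n) = (\<lambda>c. Poly_Mapping.map (vscale c))"
  "mact (res n) = (\<lambda>a. Poly_Mapping.map ((*) a))"
  by (simp_all add: res_def)

lemma pack_carrier: "fam n v \<Longrightarrow> pack n v \<in> mcarrier (res n)"
  using fam_cong[of n "coords (pack n v)" v] by (simp add: res_carrier keys_pack coords_pack)

lemma keys_map_subset: "Poly_Mapping.keys (Poly_Mapping.map f u) \<subseteq> Poly_Mapping.keys u"
  by (auto simp: in_keys_iff map.rep_eq when_def)

lemma graded_hom_dmat: "graded_hom (V_alg X) (res (Suc n)) (res n) (dmat n)"
  unfolding graded_hom_def
proof (intro conjI ballI allI image_subsetI)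
  fix u assume "u \<in> mcarrier (res (Suc n))"
  then show "dmat n u \<in> mcarrier (res n)"
    unfolding dmat_def by (intro pack_carrier fam_dfam) (simp add: res_carrier)
next
  fix u v
  show "dmat n (madd (res (Suc n)) u v) = madd (res n) (dmat n u) (dmat n v)"
    by (simp add: dmat_def dfam_linear pack_def single_add sum.distrib)
next
  fix c u
  have "pack n (\<lambda>i. vscale c (dfam n (coords u) i)) = Poly_Mapping.map (vscale c) (pack n (dfam n (coords u)))"
    by (rule pack_eqI) (simp add: coords_pack, rule subset_trans[OF keys_map_subset keys_pack])
  then show "dmat n (mscale (res (Suc n)) c u) = mscale (res n) c (dmat n u)"
    by (simp add: dmat_def dfam_linear)
next
  fix a u
  have "pack n (\<lambda>i. a * dfam n (coords u) i) = Poly_Mapping.map ((*) a) (pack n (dfam n (coords u)))"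
    by (rule pack_eqI) (simp add: coords_pack, rule subset_trans[OF keys_map_subset keys_pack])
  then show "dmat n (mact (res (Suc n)) a u) = mact (res n) a (dmat n u)"
    by (simp add: dmat_def dfam_linear)
next
  fix k u assume u: "u \<in> mdegree (res (Suc n)) k"
  show "dmat n u \<in> mdegree (res n) k"
    unfolding res_degree
  proof (intro conjI ballI)
    show "Poly_Mapping.keys (dmat n u) \<subseteq> enc ` J n" by (simp add: dmat_def keys_pack)
    fix i assume i: "i \<in> J n"
    have ci: "coords (dmat n u) i = (\<Sum>j\<in>J (Suc n). coords u j * kappa n j i)"
      using i by (simp add: dmat_def coords_pack dfam_def)
    show "if k < int n then coords (dmat n u) i = 0
       else coords (dmat n u) i \<in> vcar X \<and> coords (dmat n u) i \<in> vdegree (nat (k - int n)) \<and>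
         coords (dmat n u) i * videm (cpos x i) = coords (dmat n u) i"
    proof (cases "k < int (Suc n)")
      case True
      then have "coords u j = 0" if "j \<in> J (Suc n)" for j using u that by (auto simp: res_degree)
      then show ?thesis by (simp add: ci)
    next
      case False
      then have uj: "coords u j \<in> vcar X" "coords u j \<in> vdegree (nat (k - int (Suc n)))" if "j \<in> J (Suc n)" for j
        using u that by (auto simp: res_degree)
      \<comment> \<open>Passing from generators in degree \<open>Suc n\<close> to generators in
        degree \<open>n\<close> is made up for by the degree one of \<open>kappa\<close>.\<close>
      have deg: "nat (k - int n) = nat (k - int (Suc n)) + 1" using False by simp
      have "coords u j * kappa n j i \<in> vcar X" "coords u j * kappa n j i \<in> vdegree (nat (k - int n))"
        "coords u j * kappa n j i * videm (cpos x i) = coords u j * kappa n j i" if "j \<in> J (Suc n)" for j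
        using vcar_mult[OF uj(1) kappa_props(1)] vdegree_mult[OF uj(2) kappa_props(2)] kappa_props(3) that i
        unfolding deg by (simp_all add: mult.assoc)
      then show ?thesis using False
        by (auto simp: ci sum_distrib_right intro!: vcar_sum vdegree_sum sum.cong)
    qed
  qed
qed

lemma rad_x_closed:
  "0 \<in> rad_x" "a \<in> rad_x \<Longrightarrow> b \<in> rad_x \<Longrightarrow> a + b \<in> rad_x" "a \<in> rad_x \<Longrightarrow> vscale c a \<in> rad_x"
  "a \<in> rad_x \<Longrightarrow> - a \<in> rad_x" "v \<in> vcar X \<Longrightarrow> a \<in> rad_x \<Longrightarrow> v * a \<in> rad_x"
proof -
  show 3: "vscale c a \<in> rad_x" if "a \<in> rad_x" for a c
    using that by (simp add: rad_x_def vrad_vscale vscale_mult_left)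
  show "- a \<in> rad_x" if "a \<in> rad_x" for a using 3[OF that, of "-1"] by simp
qed (auto simp: rad_x_def vrad_add distrib_right vcar_mult_vrad mult.assoc)

lemma simple_mod_eq: "simple_mod (V_alg X) x = quot_mod (proj_mod (V_alg X) x) (rad_x :: ('n, 'k) valg set)"
proof -
  have "{a * videm x |a. a \<in> vrad X} = (rad_x :: ('n, 'k) valg set)"
    unfolding rad_x_def using vrad_mult_videm[OF xX] by (auto simp: mult.assoc videm_videm) (metis)
  then show ?thesis by (simp add: simple_mod_def vrad_def)
qed

abbreviation "cs (v :: ('n, 'k) valg) \<equiv> (+) v ` rad_x"

lemma cs_cong: "v - u \<in> rad_x \<Longrightarrow> cs u = cs v"
  by (rule coset_cong) (auto intro: rad_x_closed)

lemma cs_mem_cong: "a \<in> cs u \<Longrightarrow> a - u \<in> rad_x"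
  by auto

lemma cs_self: "u \<in> cs u"
  by (rule image_eqI[of _ _ 0]) (simp_all add: rad_x_closed)

text \<open>Operations of \<open>quot_mod\<close> are unions over representatives; such a union
  collapses once all representatives give the same coset.\<close>

lemma Union_cs:
  assumes "\<And>a. a \<in> cs u \<Longrightarrow> F a = S"
  shows "(\<Union>a\<in>cs u. F a) = S"
  using assms cs_self by auto

lemma simple_ops:
  defines "L \<equiv> simple_mod (V_alg X) x :: ('k, ('n, 'k) valg, ('n, 'k) valg set) gmod"
  shows "mcarrier L = cs ` {v \<in> vcar X. v * videm x = v}"
    "mzero L = cs 0" "madd L (cs u) (cs v) = cs (u + v)" "mscale L c (cs u) = cs (vscale c u)"
    "a \<in> vcar X \<Longrightarrow> mact L a (cs u) = cs (a * u)"
    "mdegree L k = cs ` (if k < 0 then {0} else {v \<in> vcar X. v \<in> vdegree (nat k) \<and> v * videm x = v})"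
proof -
  show "mcarrier L = cs ` {v \<in> vcar X. v * videm x = v}" "mzero L = cs 0"
    "mdegree L k = cs ` (if k < 0 then {0} else {v \<in> vcar X. v \<in> vdegree (nat k) \<and> v * videm x = v})"
    by (simp_all add: L_def simple_mod_eq quot_mod_def coset_def proj_mod_V_alg xX)
  have "(\<Union>a\<in>cs u. \<Union>b\<in>cs v. cs (a + b)) = cs (u + v)"
  proof (intro Union_cs)
    fix a b assume "a \<in> cs u" "b \<in> cs v"
    then have "(a - u) + (b - v) \<in> rad_x" by (intro rad_x_closed cs_mem_cong)
    then show "cs (a + b) = cs (u + v)" by (intro cs_cong[symmetric]) (simp add: algebra_simps)
  qed
  then show "madd L (cs u) (cs v) = cs (u + v)"
    by (simp add: L_def simple_mod_eq quot_mod_def coset_def)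
  have "(\<Union>a\<in>cs u. cs (vscale c a)) = cs (vscale c u)"
  proof (intro Union_cs)
    fix a assume "a \<in> cs u"
    then have "vscale c (a - u) \<in> rad_x" by (intro rad_x_closed cs_mem_cong)
    then show "cs (vscale c a) = cs (vscale c u)" by (intro cs_cong[symmetric]) (simp add: valg.scale_right_diff_distrib)
  qed
  then show "mscale L c (cs u) = cs (vscale c u)"
    by (simp add: L_def simple_mod_eq quot_mod_def coset_def)
  assume a: "a \<in> vcar X"
  have "(\<Union>b\<in>cs u. cs (a * b)) = cs (a * u)"
  proof (intro Union_cs)
    fix b assume "b \<in> cs u"
    then have "a * (b - u) \<in> rad_x" using a by (intro rad_x_closed cs_mem_cong)
    then show "cs (a * b) = cs (a * u)" by (intro cs_cong[symmetric]) (simp add: algebra_simps)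
  qed
  then show "mact L a (cs u) = cs (a * u)"
    by (simp add: L_def simple_mod_eq quot_mod_def coset_def)
qed

lemma graded_hom_eps: "graded_hom (V_alg X) (res 0) (simple_mod (V_alg X) x) eps"
  unfolding graded_hom_def
proof (intro conjI ballI allI image_subsetI)
  fix u assume "u \<in> mcarrier (res 0)"
  then show "eps u \<in> mcarrier (simple_mod (V_alg X) x)"
    using aug_vcar aug_videm by (auto simp: res_carrier simple_ops eps_def)
next
  fix k u assume u: "u \<in> mdegree (res 0) k"
  show "eps u \<in> mdegree (simple_mod (V_alg X) x) k"
  proof (cases "k < 0")
    case True
    then have "aug (coords u) = 0" using u by (auto simp: res_degree aug_def intro!: sum.neutral)
    then show ?thesis using True by (auto simp: simple_ops eps_def)
  next
    case False
    then have f: "fam 0 (coords u)" and d: "\<And>i. i \<in> J 0 \<Longrightarrow> coords u i \<in> vdegree (nat k)"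
      using u by (auto simp: res_degree fam_def)
    have "aug (coords u) \<in> vdegree (nat k)" unfolding aug_def by (intro vdegree_sum vdegree_vscale d)
    then show ?thesis using False aug_vcar[OF f] aug_videm[OF f] by (auto simp: simple_ops eps_def)
  qed
qed (simp_all add: eps_def simple_ops aug_linear)

lemma resolution_res: "resolution (V_alg X) (simple_mod (V_alg X) x) res dmat eps"
  unfolding resolution_def
proof (intro conjI allI)
  show "graded_hom (V_alg X) (res 0) (simple_mod (V_alg X) x) eps" by (rule graded_hom_eps)
  show "graded_hom (V_alg X) (res (Suc n)) (res n) (dmat n)" for n by (rule graded_hom_dmat)
  show "eps ` mcarrier (res 0) = mcarrier (simple_mod (V_alg X) x)"
  proof
    show "eps ` mcarrier (res 0) \<subseteq> mcarrier (simple_mod (V_alg X) x)"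
      using graded_hom_eps by (simp add: graded_hom_def)
    show "mcarrier (simple_mod (V_alg X) x) \<subseteq> eps ` mcarrier (res 0)"
    proof
      fix c assume "c \<in> mcarrier (simple_mod (V_alg X) x :: ('k, ('n, 'k) valg, ('n, 'k) valg set) gmod)"
      then obtain v where v: "v \<in> vcar X" "v * videm x = v" "c = cs v" by (auto simp: simple_ops)
      then obtain w where w: "fam 0 w" "aug w = v" using aug_surj by blast
      have "eps (pack 0 w) = cs v"
        using aug_cong[of "coords (pack 0 w)" w] w by (simp add: eps_def coords_pack)
      then show "c \<in> eps ` mcarrier (res 0)" using v w pack_carrier by blast
    qed
  qed
  have ker: "u \<in> hom_kernel (res 0) (simple_mod (V_alg X) x) eps \<longleftrightarrow> u \<in> mcarrier (res 0) \<and> aug (coords u) \<in> rad_x" for u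
  proof -
    have "cs (aug (coords u)) = cs 0 \<longleftrightarrow> aug (coords u) \<in> rad_x"
    proof
      assume "cs (aug (coords u)) = cs 0"
      then have "aug (coords u) \<in> cs 0" using cs_self by blast
      then show "aug (coords u) \<in> rad_x" by simp
    next
      assume "aug (coords u) \<in> rad_x"
      then show "cs (aug (coords u)) = cs 0" by (intro cs_cong[symmetric]) simp
    qed
    then show ?thesis by (simp add: hom_kernel_def eps_def simple_ops)
  qed
  show "dmat 0 ` mcarrier (res 1) = hom_kernel (res 0) (simple_mod (V_alg X) x) eps"
  proof (intro set_eqI iffI)
    fix u assume "u \<in> dmat 0 ` mcarrier (res 1)"
    then obtain w where w: "w \<in> mcarrier (res 1)" "u = dmat 0 w" by blast
    have "u \<in> mcarrier (res 0)" using graded_hom_dmat[of 0] w by (auto simp: graded_hom_def)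
    moreover have "aug (coords u) = aug (dfam 0 (coords w))"
      by (rule aug_cong) (simp add: w dmat_def coords_pack)
    moreover have "aug (dfam 0 (coords w)) \<in> rad_x" using w by (intro aug_dfam) (simp add: res_carrier)
    ultimately show "u \<in> hom_kernel (res 0) (simple_mod (V_alg X) x) eps" by (simp add: ker)
  next
    fix u assume "u \<in> hom_kernel (res 0) (simple_mod (V_alg X) x) eps"
    then have u: "u \<in> mcarrier (res 0)" "aug (coords u) \<in> rad_x" by (auto simp: ker)
    then obtain w where w: "fam 1 w" "\<And>i. i \<in> J 0 \<Longrightarrow> dfam 0 w i = coords u i"
      using aug_exact[of "coords u"] by (auto simp: res_carrier)
    have "dfam 0 (coords (pack 1 w)) = dfam 0 w"
      by (rule dfam_cong) (simp add: coords_pack)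
    then have "dmat 0 (pack 1 w) = u"
      unfolding dmat_def using w u by (intro pack_eqI) (auto simp: res_carrier)
    then show "u \<in> dmat 0 ` mcarrier (res 1)" using pack_carrier[OF w(1)] by blast
  qed
  fix n
  show "dmat (Suc n) ` mcarrier (res (Suc (Suc n))) = hom_kernel (res (Suc n)) (res n) (dmat n)"
  proof (intro set_eqI iffI)
    fix u assume "u \<in> dmat (Suc n) ` mcarrier (res (Suc (Suc n)))"
    then obtain w where w: "w \<in> mcarrier (res (Suc (Suc n)))" "u = dmat (Suc n) w" by blast
    have "u \<in> mcarrier (res (Suc n))" using graded_hom_dmat[of "Suc n"] w by (auto simp: graded_hom_def)
    moreover have "dmat n u = 0"
      unfolding dmat_def
    proof (rule pack_eqI)
      fix i assume i: "i \<in> J n"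
      have "dfam n (coords u) = dfam n (dfam (Suc n) (coords w))"
        by (rule dfam_cong) (simp add: w dmat_def coords_pack)
      then show "dfam n (coords u) i = coords 0 i"
        using dfam_dfam[of n "coords w" i] w i by (simp add: res_carrier)
    qed simp
    ultimately show "u \<in> hom_kernel (res (Suc n)) (res n) (dmat n)" by (simp add: hom_kernel_def)
  next
    fix u assume "u \<in> hom_kernel (res (Suc n)) (res n) (dmat n)"
    then have u: "u \<in> mcarrier (res (Suc n))" "dmat n u = 0" by (auto simp: hom_kernel_def)
    have "dfam n (coords u) i = 0" if "i \<in> J n" for i
      using coords_pack[OF that, of "dfam n (coords u)"] u(2) by (simp add: dmat_def)
    then obtain w where w: "fam (Suc (Suc n)) w" "\<And>i. i \<in> J (Suc n) \<Longrightarrow> dfam (Suc n) w i = coords u i"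
      using dfam_exact[of n "coords u"] u(1) by (auto simp: res_carrier)
    have "dfam (Suc n) (coords (pack (Suc (Suc n)) w)) = dfam (Suc n) w"
      by (rule dfam_cong) (simp add: coords_pack)
    then have "dmat (Suc n) (pack (Suc (Suc n)) w) = u"
      unfolding dmat_def using w u by (intro pack_eqI) (auto simp: res_carrier)
    then show "u \<in> dmat (Suc n) ` mcarrier (res (Suc (Suc n)))" using pack_carrier[OF w(1)] by blast
  qed
qed

end

theorem theorem47:
  fixes X :: "(int ^ 'n) set"
  assumes "cubist X"
  shows "koszul (V_alg X :: ('k::field, int ^ 'n, ('n, 'k) valg) galg)"
  unfolding koszul_def
proof
  fix x assume "x \<in> vertices (V_alg X :: ('k, int ^ 'n, ('n, 'k) valg) galg)"
  then have x: "x \<in> X" by simp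
  obtain I where I: "\<And>a b. b \<in> I \<Longrightarrow> a \<le> b \<Longrightarrow> a \<in> I" "X = {x. x \<in> I \<and> x + 1 \<notin> I}"
    using cubist_ideal[OF assms] by metis
  interpret cubist_point I x
  proof
    show "a \<in> I" if "b \<in> I" "a \<le> b" for a b using I(1) that .
  qed (use x I(2) in simp_all)
  have "\<forall>n. \<exists>J (rho :: 'n cube_index \<Rightarrow> 'n set \<Rightarrow> 'n set \<Rightarrow> 'k). quot_basis (2 * int CARD('n) - 2 - int n) K J rho"
    by (intro allI) (rule quot_basis_exists)
  then obtain J and rho :: "nat \<Rightarrow> 'n cube_index \<Rightarrow> 'n set \<Rightarrow> 'n set \<Rightarrow> 'k"
    where b: "\<And>n. quot_basis (2 * int CARD('n) - 2 - int n) K (J n) (rho n)" by metis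
  interpret cubist_resolution I x J rho X
    by standard (fact I(2) b)+
  show "\<exists>(J :: nat \<Rightarrow> ('n, 'k) valg list set) (y :: nat \<Rightarrow> ('n, 'k) valg list \<Rightarrow> int ^ 'n) d \<epsilon>.
      (\<forall>n. y n ` J n \<subseteq> vertices (V_alg X :: ('k, int ^ 'n, ('n, 'k) valg) galg)) \<and>
      resolution (V_alg X) (simple_mod (V_alg X :: ('k, int ^ 'n, ('n, 'k) valg) galg) x) (\<lambda>n. proj_sum (V_alg X) (int n) (J n) (y n)) d \<epsilon>"
  proof (intro exI conjI allI)
    show "(\<lambda>l. cpos x (dec l)) ` (enc ` J n) \<subseteq> vertices (V_alg X :: ('k, int ^ 'n, ('n, 'k) valg) galg)" for n
      using cpos_X by auto
    show "resolution (V_alg X) (simple_mod (V_alg X :: ('k, int ^ 'n, ('n, 'k) valg) galg) x)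
        (\<lambda>n. proj_sum (V_alg X) (int n) (enc ` J n) (\<lambda>l. cpos x (dec l))) dmat eps"
      using resolution_res unfolding res_def[abs_def] .
  qed
qed

end
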